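(* Let $Q=(-1,0)\times(-1,1)$ and let $D$ be a fixed nonempty open rectangle with $D\subset\subset Q_{1/2}=(-1/4,0)\times(-1/2,1/2)$. Let $0<\kappa<1$ and $p=\frac{2}{1-\kappa}$. There exists a Borel function $a:Q\to[\kappa,\kappa^{-1}]$ which has properties (i) and (ii) listed in the context and for which, in addition, the following hold. (A) There exists a bounded continuous weak solution $v$ of $$v_t-(av_x)_x=0\quad\text{in }Q$$ with $$v_x\in L_2(Q)\cap L_{p,\infty}(Q),\qquad v_x\notin L_p(D).$$ (B) There exist a sequence $v_j\in C_0^\infty(Q)$, functions $f_j\in L_p(Q)$, and constants $c,N>0$ independent of $j$ such that $$v_{j,t}-(av_{j,x})_x=(f_j)_x\ \text{ in }Q,\qquad \|f_j\|_{L_p(Q)}+\|v_j\|_{L_p(Q)}\le N,$$ while for all sufficiently large $j$, $$\int_D|v_{j,x}|^p\,dx\,dt\ge c\log j.$$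
   Context: Points are written $(t,x)$ with $t$ time and $x$ space. Rectangles have sides parallel to the axes; $D\subset\subset Q_{1/2}$ means that $\overline D$ is a compact subset of $Q_{1/2}$. $L_{p,\infty}$ is the weak $L_p$ space. $W^{1,2}_2(Q)=\{u:u,u_x,u_t,u_{xx}\in L_2(Q)\}$. The divergence-form equations are understood in the weak (distributional) sense: $v_t-(av_x)_x=f_x$ in $Q$ means $\int_Q(v\varphi_t-av_x\varphi_x)\,dx\,dt=\int_Qf\varphi_x\,dx\,dt$ for all $\varphi\in C_c^\infty(Q)$. Properties of the coefficient $a$ (the coefficient is the same one as in the nondivergence counterexample): (i) There exists $u\in W^{1,2}_2(Q)$ with $u_t-au_{xx}=0$ a.e. in $Q$, such that $u,u_x$ are bounded and continuous in $Q$ and, for some constants $c,N>0$, $c\tau^{-p}\le|\{(t,x)\in D:u_{xx}(t,x)>\tau\}|\le N\tau^{-p}$ for all sufficiently large $\tau>0$; in particular $u_t,u_{xx}\in L_{p,\infty}(D)\setminus L_p(D)$. (ii) There exist $\{\phi_j\}_{j\ge1}\subset C_0^\infty(Q)$ and constants $c,N>0$ independent of $j$ such that $\|\phi_j\|_{L_\infty}+\|\phi_{j,x}\|_{L_\infty}+\|\phi_{j,t}-a\phi_{j,xx}\|_{L_p(Q)}\le N$ and $\int_D|\phi_{j,xx}|^p\,dx\,dt\ge c\log j$. *)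

theory Defs
  imports "HOL-Analysis.Analysis" "HOL-Probability.Essential_Supremum"
begin

text \<open>Points of the plane are pairs (t, x). Functions on an open set \<open>\<Omega>\<close> are represented by total
  functions whose values outside \<open>\<Omega>\<close> are irrelevant; test functions are extended by zero.\<close>

subsection \<open>Classical partial derivatives and test functions\<close>

definition Dt :: "(real \<times> real \<Rightarrow> real) \<Rightarrow> real \<times> real \<Rightarrow> real" where
  "Dt f z = deriv (\<lambda>s. f (s, snd z)) (fst z)"

definition Dx :: "(real \<times> real \<Rightarrow> real) \<Rightarrow> real \<times> real \<Rightarrow> real" where
  "Dx f z = deriv (\<lambda>y. f (fst z, y)) (snd z)"

primrec Ck :: "nat \<Rightarrow> (real \<times> real \<Rightarrow> real) \<Rightarrow> bool" where
  "Ck 0 f \<longleftrightarrow> continuous_on UNIV f"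
| "Ck (Suc n) f \<longleftrightarrow> f differentiable_on UNIV \<and> Ck n (Dt f) \<and> Ck n (Dx f)"

text \<open>Smooth functions with compact support in \<open>\<Omega>\<close>.\<close>

definition test_functions :: "(real \<times> real) set \<Rightarrow> (real \<times> real \<Rightarrow> real) set" where
  "test_functions \<Omega> =
     {\<phi>. (\<forall>n. Ck n \<phi>) \<and> compact (closure {z. \<phi> z \<noteq> 0}) \<and> closure {z. \<phi> z \<noteq> 0} \<subseteq> \<Omega>}"

subsection \<open>Lebesgue spaces\<close>

definition Lp :: "real \<Rightarrow> (real \<times> real) set \<Rightarrow> (real \<times> real \<Rightarrow> real) set" where
  "Lp p \<Omega> = {f \<in> borel_measurable (lebesgue_on \<Omega>).
               integrable (lebesgue_on \<Omega>) (\<lambda>z. \<bar>f z\<bar> powr p)}"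

text \<open>Meaningful for \<open>f \<in> Lp p \<Omega>\<close> only: the Bochner integral of a non-integrable function is 0.\<close>

definition Lp_norm :: "real \<Rightarrow> (real \<times> real) set \<Rightarrow> (real \<times> real \<Rightarrow> real) \<Rightarrow> real" where
  "Lp_norm p \<Omega> f = (\<integral>z. \<bar>f z\<bar> powr p \<partial>lebesgue_on \<Omega>) powr (1 / p)"

definition Linf_norm :: "(real \<times> real) set \<Rightarrow> (real \<times> real \<Rightarrow> real) \<Rightarrow> ereal" where
  "Linf_norm \<Omega> f = esssup (lebesgue_on \<Omega>) (\<lambda>z. ereal \<bar>f z\<bar>)"

definition weak_Lp :: "real \<Rightarrow> (real \<times> real) set \<Rightarrow> (real \<times> real \<Rightarrow> real) set" where
  "weak_Lp p \<Omega> = {f \<in> borel_measurable (lebesgue_on \<Omega>).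
     \<exists>N::real. \<forall>\<tau>>0. emeasure lebesgue {z \<in> \<Omega>. \<bar>f z\<bar> > \<tau>} \<le> ennreal (N * \<tau> powr (- p))}"

definition loc_integrable :: "(real \<times> real) set \<Rightarrow> (real \<times> real \<Rightarrow> real) \<Rightarrow> bool" where
  "loc_integrable \<Omega> f \<longleftrightarrow> (\<forall>K. compact K \<and> K \<subseteq> \<Omega> \<longrightarrow> integrable (lebesgue_on K) f)"

subsection \<open>Weak derivatives, Sobolev space, weak solutions\<close>

definition has_weak_dt ::
  "(real \<times> real) set \<Rightarrow> (real \<times> real \<Rightarrow> real) \<Rightarrow> (real \<times> real \<Rightarrow> real) \<Rightarrow> bool" where
  "has_weak_dt \<Omega> u g \<longleftrightarrow> loc_integrable \<Omega> u \<and> loc_integrable \<Omega> g \<and>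
     (\<forall>\<phi>\<in>test_functions \<Omega>.
        (\<integral>z. u z * Dt \<phi> z \<partial>lebesgue_on \<Omega>) = - (\<integral>z. g z * \<phi> z \<partial>lebesgue_on \<Omega>))"

definition has_weak_dx ::
  "(real \<times> real) set \<Rightarrow> (real \<times> real \<Rightarrow> real) \<Rightarrow> (real \<times> real \<Rightarrow> real) \<Rightarrow> bool" where
  "has_weak_dx \<Omega> u g \<longleftrightarrow> loc_integrable \<Omega> u \<and> loc_integrable \<Omega> g \<and>
     (\<forall>\<phi>\<in>test_functions \<Omega>.
        (\<integral>z. u z * Dx \<phi> z \<partial>lebesgue_on \<Omega>) = - (\<integral>z. g z * \<phi> z \<partial>lebesgue_on \<Omega>))"

text \<open>The parabolic Sobolev space: u, u_x, u_t, u_xx are all square integrable.\<close>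

definition W122 :: "(real \<times> real) set \<Rightarrow> (real \<times> real \<Rightarrow> real) set" where
  "W122 \<Omega> = {u \<in> Lp 2 \<Omega>.
     (\<exists>ut \<in> Lp 2 \<Omega>. has_weak_dt \<Omega> u ut) \<and>
     (\<exists>ux \<in> Lp 2 \<Omega>. has_weak_dx \<Omega> u ux \<and> (\<exists>uxx \<in> Lp 2 \<Omega>. has_weak_dx \<Omega> ux uxx))}"

text \<open>\<open>v\<close> solves v_t - (a v_x)_x = f_x in the sense of distributions. The witness w is v_x, which is
  determined up to a null set.\<close>

definition weak_div_solution ::
  "(real \<times> real) set \<Rightarrow> (real \<times> real \<Rightarrow> real) \<Rightarrow> (real \<times> real \<Rightarrow> real) \<Rightarrow>
   (real \<times> real \<Rightarrow> real) \<Rightarrow> bool" where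
  "weak_div_solution \<Omega> a f v \<longleftrightarrow> loc_integrable \<Omega> f \<and>
     (\<exists>w. has_weak_dx \<Omega> v w \<and> loc_integrable \<Omega> (\<lambda>z. a z * w z) \<and>
       (\<forall>\<phi>\<in>test_functions \<Omega>.
          (\<integral>z. (v z * Dt \<phi> z - a z * w z * Dx \<phi> z) \<partial>lebesgue_on \<Omega>)
            = (\<integral>z. f z * Dx \<phi> z \<partial>lebesgue_on \<Omega>)))"

subsection \<open>The two properties of the nondivergence-form equation\<close>

text \<open>The functions \<open>ux\<close>, \<open>ut\<close>, \<open>uxx\<close> are representatives of the weak derivatives of \<open>u\<close>; those of
  \<open>u\<close> and \<open>ux\<close> are the bounded continuous ones.\<close>

definition property_i ::
  "(real \<times> real) set \<Rightarrow> (real \<times> real) set \<Rightarrow> real \<Rightarrow> (real \<times> real \<Rightarrow> real) \<Rightarrow> bool" where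
  "property_i Q D p a \<longleftrightarrow>
    (\<exists>u ux ut uxx.
       u \<in> W122 Q \<and> has_weak_dx Q u ux \<and> has_weak_dt Q u ut \<and> has_weak_dx Q ux uxx \<and>
       (AE z in lebesgue_on Q. ut z - a z * uxx z = 0) \<and>
       bounded (u ` Q) \<and> continuous_on Q u \<and> bounded (ux ` Q) \<and> continuous_on Q ux \<and>
       (\<exists>c>0. \<exists>N>0. \<forall>\<^sub>F \<tau> in at_top.
          c * \<tau> powr (- p) \<le> measure lebesgue {z \<in> D. uxx z > \<tau>} \<and>
          measure lebesgue {z \<in> D. uxx z > \<tau>} \<le> N * \<tau> powr (- p)) \<and>
       ut \<in> weak_Lp p D - Lp p D \<and> uxx \<in> weak_Lp p D - Lp p D)"

definition property_ii ::
  "(real \<times> real) set \<Rightarrow> (real \<times> real) set \<Rightarrow> real \<Rightarrow> (real \<times> real \<Rightarrow> real) \<Rightarrow> bool" where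
  "property_ii Q D p a \<longleftrightarrow>
    (\<exists>\<phi> :: nat \<Rightarrow> real \<times> real \<Rightarrow> real. \<exists>c>0. \<exists>N>0. \<forall>j\<ge>1.
       \<phi> j \<in> test_functions Q \<and>
       (\<lambda>z. Dt (\<phi> j) z - a z * Dx (Dx (\<phi> j)) z) \<in> Lp p Q \<and>
       Linf_norm Q (\<phi> j) + Linf_norm Q (Dx (\<phi> j))
         + ereal (Lp_norm p Q (\<lambda>z. Dt (\<phi> j) z - a z * Dx (Dx (\<phi> j)) z)) \<le> ereal N \<and>
       (\<integral>z. \<bar>Dx (Dx (\<phi> j)) z\<bar> powr p \<partial>lebesgue_on D) \<ge> c * ln (real j))"

end

theory Submission
  imports Defs
begin

text \<open>The pair \<open>(s, r) = (u_t, u_xx)\<close> has to stay in the wedge \<open>\<kappa> \<le> s / r \<le> 1 / \<kappa>\<close>; then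
  \<open>a = u_t / u_xx\<close> is an admissible coefficient. Start with \<open>(l, l)\<close> on a product set. A rapid
  oscillation in \<open>x\<close> splits \<open>r\<close> into \<open>l + 1\<close> and values slightly above \<open>\<kappa> l\<close>; on the part with
  \<open>r = l + 1\<close> a rapid oscillation in \<open>t\<close> splits \<open>s\<close> in the same way. Each time the better part
  keeps the fraction \<open>B / (1 + B)\<close> of the measure, \<open>B = (1 - \<kappa>) l - 2\<close>, and the values there are
  \<open>(l + 1, l + 1)\<close>, so the construction can be iterated. The set \<open>B_k\<close> reached after \<open>k\<close> steps has
  measure comparable to \<open>k powr (- 2 / (1 - \<kappa>)) = k powr - p\<close>, while \<open>u_t = u_xx = l_k\<close>, which is comparable to \<open>k\<close>:
  this is exactly weak \<open>L_p\<close>, with a logarithmically divergent \<open>L_p\<close> norm. The corrections are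
  small in \<open>C^0\<close> together with their \<open>x\<close>-derivatives, so \<open>u\<close> and \<open>u_x\<close> are continuous. Stopping after
  \<open>j\<close> steps leaves an error \<open>f_j\<close> of size \<open>j\<close> on \<open>B_j\<close> only, hence bounded in \<open>L_p\<close>.
  Differentiating \<open>u_t = a u_xx\<close> and \<open>\<phi>_t = a \<phi>_xx + f\<close> in \<open>x\<close> gives the divergence form for
  \<open>u_x\<close> and \<open>\<phi>_x\<close>.\<close>

section \<open>Smooth functions of one variable\<close>

text \<open>The exponent is born in the product of the retained fractions. With
  \<open>l = k + 1 + p\<close> the identity (1 - \<kappa>) p = 2 turns each fraction into (k + 1) /
  (k + 1 + p / 2); a step squares it, and such products decay like k powr - p. The obstacle is that
  the two derivatives cannot be moved independently: a localized oscillation in x also changes u_t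
  through the derivative of its time cutoff, and one in t also changes u_xx through its space
  cutoff. Both errors are a cutoff derivative, which may be huge, times an oscillation amplitude. So
  each cutoff is fixed before the oscillation that it multiplies, and the frequency is then raised
  until the error fits into the margin of the wedge. All corrections are finite sums of products
  f(t) g(x), and the good sets are products of finite unions of intervals; every step reproduces
  this shape, which is why it can be iterated. The measure lost at the edges of cutoffs and
  oscillations costs step k at most a factor 1 - 2^-(k+2), and the infinite product of these factors
  is positive.\<close>

primrec ndiff :: "nat \<Rightarrow> (real \<Rightarrow> real) \<Rightarrow> bool" where
  "ndiff 0 f \<longleftrightarrow> True"
| "ndiff (Suc n) f \<longleftrightarrow> (\<exists>f'. (\<forall>x. (f has_real_derivative f' x) (at x)) \<and> ndiff n f')"

text \<open>Derivatives are asserted to exist through a witness at each order instead of iterating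
  \<open>deriv\<close>, so the closure lemmas are inductions on the order that construct the next
  derivative explicitly.\<close>

definition smooth :: "(real \<Rightarrow> real) \<Rightarrow> bool" where
  "smooth f \<longleftrightarrow> (\<forall>n. ndiff n f)"

lemma ndiff_SucI:
  "(\<And>x. (f has_real_derivative f' x) (at x)) \<Longrightarrow> ndiff n f' \<Longrightarrow> ndiff (Suc n) f"
  by auto

lemma ndiff_Suc_imp: "ndiff (Suc n) f \<Longrightarrow> ndiff n f"
  by (induction n arbitrary: f) auto

lemma ndiff_const: "ndiff n (\<lambda>x. c)"
proof (induction n arbitrary: c)
  case (Suc n)
  show ?case by (rule ndiff_SucI[OF DERIV_const Suc])
qed simp

lemma ndiff_add: "ndiff n f \<Longrightarrow> ndiff n g \<Longrightarrow> ndiff n (\<lambda>x. f x + g x)"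
proof (induction n arbitrary: f g)
  case (Suc n)
  then obtain f' g' where
    "\<forall>x. (f has_real_derivative f' x) (at x)" "ndiff n f'"
    "\<forall>x. (g has_real_derivative g' x) (at x)" "ndiff n g'"
    unfolding ndiff.simps by blast
  then have "((\<lambda>x. f x + g x) has_real_derivative f' x + g' x) (at x)"
    "ndiff n (\<lambda>x. f' x + g' x)" for x
    using Suc.IH by (auto intro!: derivative_eq_intros)
  then show ?case by (rule ndiff_SucI)
qed simp

lemma ndiff_mult: "ndiff n f \<Longrightarrow> ndiff n g \<Longrightarrow> ndiff n (\<lambda>x. f x * g x)"
proof (induction n arbitrary: f g)
  case (Suc n)
  obtain f' g' where *:
    "\<forall>x. (f has_real_derivative f' x) (at x)" "ndiff n f'"
    "\<forall>x. (g has_real_derivative g' x) (at x)" "ndiff n g'"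
    using Suc.prems unfolding ndiff.simps by blast
  then have "((\<lambda>x. f x * g x) has_real_derivative f' x * g x + f x * g' x) (at x)" for x
    by (auto intro!: derivative_eq_intros)
  moreover have "ndiff n (\<lambda>x. f' x * g x + f x * g' x)"
    by (rule ndiff_add[OF Suc.IH[OF *(2) Suc.prems(2)[THEN ndiff_Suc_imp]]
        Suc.IH[OF Suc.prems(1)[THEN ndiff_Suc_imp] *(4)]])
  ultimately show ?case by (rule ndiff_SucI)
qed simp

lemma ndiff_affine: "ndiff n f \<Longrightarrow> ndiff n (\<lambda>x. f (a * x + b))"
proof (induction n arbitrary: f)
  case (Suc n)
  obtain f' where *: "\<forall>x. (f has_real_derivative f' x) (at x)" "ndiff n f'"
    using Suc.prems unfolding ndiff.simps by blast
  have "((\<lambda>x. f (a * x + b)) has_real_derivative a * f' (a * x + b)) (at x)" for x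
  proof -
    have "((\<lambda>x. a * x + b) has_real_derivative a) (at x)"
      by (auto intro!: derivative_eq_intros)
    from DERIV_chain2[OF spec[OF *(1)] this] show ?thesis by (simp add: mult.commute)
  qed
  moreover have "ndiff n (\<lambda>x. a * f' (a * x + b))"
    using ndiff_mult[OF ndiff_const Suc.IH[OF *(2)]] .
  ultimately show ?case by (rule ndiff_SucI)
qed simp

lemma smooth_const [simp]: "smooth (\<lambda>x. c)"
  by (simp add: smooth_def ndiff_const)

lemma smooth_add: "smooth f \<Longrightarrow> smooth g \<Longrightarrow> smooth (\<lambda>x. f x + g x)"
  by (simp add: smooth_def ndiff_add)

lemma smooth_mult: "smooth f \<Longrightarrow> smooth g \<Longrightarrow> smooth (\<lambda>x. f x * g x)"
  by (simp add: smooth_def ndiff_mult)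

lemma smooth_cmult: "smooth f \<Longrightarrow> smooth (\<lambda>x. c * f x)"
  using smooth_mult[OF smooth_const] .

lemma smooth_affine: "smooth f \<Longrightarrow> smooth (\<lambda>x. f (a * x + b))"
  by (simp add: smooth_def ndiff_affine)

lemma smooth_antiderivative:
  assumes "\<And>x. (F has_real_derivative f x) (at x)" "smooth f"
  shows "smooth F"
  unfolding smooth_def
proof
  fix n
  show "ndiff n F"
    using assms by (cases n) (auto simp: smooth_def)
qed

lemma smooth_id: "smooth (\<lambda>x. x)"
  by (rule smooth_antiderivative[where f = "\<lambda>x. 1"]) (auto intro!: derivative_eq_intros)

lemma smooth_has_derivative:
  assumes "smooth f"
  shows "(f has_real_derivative deriv f x) (at x)"
proof -
  have "ndiff (Suc 0) f" using assms unfolding smooth_def by blast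
  then obtain f' where "(f has_real_derivative f' x) (at x)" by auto
  then show ?thesis using DERIV_imp_deriv by fastforce
qed

lemma smooth_deriv:
  assumes "smooth f"
  shows "smooth (deriv f)"
  unfolding smooth_def
proof
  fix n
  have "ndiff (Suc n) f" using assms unfolding smooth_def by blast
  then obtain f' where *: "\<forall>x. (f has_real_derivative f' x) (at x)" "ndiff n f'" by auto
  then have "deriv f = f'" by (auto dest!: DERIV_imp_deriv)
  with * show "ndiff n (deriv f)" by simp
qed

lemma smooth_continuous_on: "smooth f \<Longrightarrow> continuous_on S f"
  by (auto intro!: continuous_at_imp_continuous_on DERIV_isCont[OF smooth_has_derivative])

lemma deriv_add_smooth:
  assumes "smooth f" "smooth g"
  shows "deriv (\<lambda>x. f x + g x) = (\<lambda>x. deriv f x + deriv g x)"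
  using DERIV_add[OF smooth_has_derivative[OF assms(1)] smooth_has_derivative[OF assms(2)]]
  by (auto intro!: DERIV_imp_deriv)

lemma deriv_cmult_smooth:
  assumes "smooth f"
  shows "deriv (\<lambda>x. c * f x) = (\<lambda>x. c * deriv f x)"
  using DERIV_cmult[OF smooth_has_derivative[OF assms(1)]]
  by (auto intro!: DERIV_imp_deriv)

lemma deriv_affine_smooth:
  assumes "smooth f"
  shows "deriv (\<lambda>x. f (a * x + b)) = (\<lambda>x. a * deriv f (a * x + b))"
proof
  fix x
  have "((\<lambda>x. f (a * x + b)) has_real_derivative deriv f (a * x + b) * a) (at x)"
    by (rule DERIV_chain2[OF smooth_has_derivative[OF assms]]) (auto intro!: derivative_eq_intros)
  then show "deriv (\<lambda>x. f (a * x + b)) x = a * deriv f (a * x + b)"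
    using DERIV_imp_deriv by force
qed

lemma smooth_has_antiderivative:
  assumes "smooth f"
  obtains F where "\<And>x. (F has_real_derivative f x) (at x)" "F 0 = 0" "smooth F"
proof -
  define F where "F u = (LBINT y=0..u. f y)" for u :: real
  have "(F has_real_derivative f x) (at x)" for x
  proof -
    \<comment> \<open>The fundamental theorem is stated within a compact interval. This radius puts
      0 and x in its interior, so the one-sided restriction disappears.\<close>
    define r where "r = \<bar>x\<bar> + 1"
    have "((\<lambda>u. LBINT y=ereal 0..ereal u. f y) has_vector_derivative f x) (at x within {-r..r})"
      by (rule interval_integral_FTC2) (auto simp: r_def intro!: smooth_continuous_on assms)
    moreover have "at x within {-r..r} = at x"
      by (rule at_within_interior) (auto simp: r_def)
    ultimately show ?thesis
      by (simp add: F_def[abs_def] has_real_derivative_iff_has_vector_derivative zero_ereal_def)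
  qed
  moreover have "F 0 = 0" by (simp add: F_def zero_ereal_def)
  ultimately show ?thesis using that smooth_antiderivative[OF _ assms] by blast
qed

section \<open>Flat functions, smooth steps and bumps\<close>

definition flat :: "nat \<Rightarrow> real \<Rightarrow> real" where
  "flat n x = (if x \<le> 0 then 0 else inverse x ^ n * exp (- inverse x))"

lemma flat_tendsto_0: "(flat n \<longlongrightarrow> 0) (at 0)"
proof (rule filterlim_split_at)
  have "eventually (\<lambda>x. flat n x = 0) (at_left 0)"
    unfolding eventually_at_filter by (auto simp: flat_def)
  then show "(flat n \<longlongrightarrow> 0) (at_left 0)" by (rule tendsto_eventually)
  have "((\<lambda>x. inverse x ^ n / exp (inverse x)) \<longlongrightarrow> (0::real)) (at_right 0)"
    by (rule filterlim_compose[OF tendsto_power_div_exp_0 filterlim_inverse_at_top_right])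
  moreover have "eventually (\<lambda>x. inverse x ^ n / exp (inverse x) = flat n x) (at_right 0)"
    unfolding eventually_at_filter by (auto simp: flat_def exp_minus divide_inverse)
  ultimately show "(flat n \<longlongrightarrow> 0) (at_right 0)"
    by (rule Lim_transform_eventually)
qed

text \<open>Differentiation maps the family \<open>flat n\<close> into its own linear span, which
  makes all members smooth simultaneously. At 0 the difference quotient of \<open>flat n\<close> is
  \<open>flat (Suc n)\<close>, and this tends to 0.\<close>

lemma flat_has_derivative:
  "(flat n has_real_derivative (- real n * flat (Suc n) x + flat (Suc (Suc n)) x)) (at x)"
proof (cases x "0::real" rule: linorder_cases)
  case less
  have "((\<lambda>x. 0) has_real_derivative 0) (at x)" by simp
  then have "(flat n has_real_derivative 0) (at x)"
    by (rule has_field_derivative_transform_within_open[where S = "{..<0}"])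
      (use less in \<open>auto simp: flat_def\<close>)
  then show ?thesis using less by (simp add: flat_def)
next
  case equal
  have "(\<lambda>y. (flat n y - flat n 0) / (y - 0)) = flat (Suc n)"
    by (rule ext) (auto simp: flat_def divide_simps)
  then have "(flat n has_real_derivative 0) (at 0)"
    using flat_tendsto_0[of "Suc n"] by (simp add: has_field_derivative_iff)
  then show ?thesis using equal by (simp add: flat_def)
next
  case greater
  have "((\<lambda>x. inverse x ^ n * exp (- inverse x)) has_real_derivative
      real n * inverse x ^ (n - Suc 0) * (- (inverse x * inverse x)) * exp (- inverse x)
      + inverse x ^ n * (exp (- inverse x) * (inverse x * inverse x))) (at x)"
    using greater by (auto intro!: derivative_eq_intros)
  also have "real n * inverse x ^ (n - Suc 0) * (- (inverse x * inverse x)) * exp (- inverse x)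
      + inverse x ^ n * (exp (- inverse x) * (inverse x * inverse x))
      = - real n * flat (Suc n) x + flat (Suc (Suc n)) x"
    using greater by (cases n) (simp_all add: flat_def algebra_simps)
  finally have "((\<lambda>x. inverse x ^ n * exp (- inverse x)) has_real_derivative
      (- real n * flat (Suc n) x + flat (Suc (Suc n)) x)) (at x)" .
  then show ?thesis
    by (rule has_field_derivative_transform_within_open[where S = "{0<..}"])
      (use greater in \<open>auto simp: flat_def\<close>)
qed

lemma smooth_flat: "smooth (flat n)"
proof -
  have "ndiff k (flat n)" for k
  proof (induction k arbitrary: n)
    case (Suc k)
    have "ndiff k (\<lambda>x. - real n * flat (Suc n) x + flat (Suc (Suc n)) x)"
      by (intro ndiff_add ndiff_mult ndiff_const Suc)
    then show ?case by (rule ndiff_SucI[OF flat_has_derivative])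
  qed simp
  then show ?thesis by (simp add: smooth_def)
qed

text \<open>The step is the normalized antiderivative of x \<mapsto> exp(-1/x) exp(-1/(1-x)),
  extended by zero: that function is positive exactly on (0, 1), so its antiderivative is constant
  on either side.\<close>

lemma smooth_step_exists:
  obtains s where "smooth s" "\<And>x. x \<le> 0 \<Longrightarrow> s x = 0" "\<And>x. 1 \<le> x \<Longrightarrow> s x = 1"
    "\<And>x. 0 \<le> s x" "\<And>x. s x \<le> 1"
proof -
  define g where "g x = flat 0 x * flat 0 (-1 * x + 1)" for x
  have "smooth g"
    unfolding g_def by (intro smooth_mult smooth_flat smooth_affine[OF smooth_flat])
  then obtain H where H: "\<And>x. (H has_real_derivative g x) (at x)" "H 0 = 0" "smooth H"
    by (rule smooth_has_antiderivative) blast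
  have g0: "0 \<le> g x" for x by (simp add: g_def flat_def)
  have gz: "g x = 0" if "x \<le> 0 \<or> 1 \<le> x" for x using that by (auto simp: g_def flat_def)
  have mono: "H x \<le> H y" if "x \<le> y" for x y
    by (rule DERIV_nonneg_imp_nondecreasing[OF that]) (use H(1) g0 in blast)
  have left: "H x = 0" if "x \<le> 0" for x
  proof -
    have "H x \<ge> H 0"
      by (rule DERIV_nonpos_imp_nonincreasing[OF that]) (use H(1) gz in fastforce)
    with mono[OF that] H(2) show ?thesis by simp
  qed
  have right: "H x = H 1" if "1 \<le> x" for x
  proof -
    have "H 1 \<ge> H x"
      by (rule DERIV_nonpos_imp_nonincreasing[OF that]) (use H(1) gz in fastforce)
    with mono[OF that] show ?thesis by simp
  qed
  have "H 0 < H 1"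
  proof (rule DERIV_pos_imp_increasing_open[of 0 1 H])
    fix x :: real assume "0 < x" "x < 1"
    then have "g x > 0" by (simp add: g_def flat_def)
    with H(1) show "\<exists>y. DERIV H x :> y \<and> y > 0" by blast
  qed (use smooth_continuous_on[OF H(3)] in auto)
  then have pos: "H 1 > 0" using H(2) by simp
  have bd: "0 \<le> H x" "H x \<le> H 1" for x
    using mono[of 0 x] mono[of x 1] right[of x] left[of x] H(2) pos by linarith+
  show ?thesis
  proof
    show "smooth (\<lambda>x. (1 / H 1) * H x)" by (rule smooth_cmult[OF H(3)])
    show "1 / H 1 * H x = 0" if "x \<le> 0" for x by (simp add: left[OF that])
    show "1 / H 1 * H x = 1" if "1 \<le> x" for x using right[OF that] pos by simp
    show "0 \<le> 1 / H 1 * H x" for x using bd(1)[of x] pos by simp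
    show "1 / H 1 * H x \<le> 1" for x using bd(2)[of x] pos by simp
  qed
qed

text \<open>The bump is a product of a step rising on [-d, -c] and one falling on [c, d]. Reflection
  swaps the two factors, which gives evenness; that symmetry is what later makes antiderivatives odd
  or even.\<close>

lemma smooth_bump_exists:
  fixes c d :: real
  assumes "0 \<le> c" "c < d"
  obtains b where "smooth b" "\<And>x. b (- x) = b x" "\<And>x. \<bar>x\<bar> \<le> c \<Longrightarrow> b x = 1"
    "\<And>x. d \<le> \<bar>x\<bar> \<Longrightarrow> b x = 0" "\<And>x. 0 \<le> b x" "\<And>x. b x \<le> 1"
proof -
  obtain s where s: "smooth s" "\<And>x. x \<le> 0 \<Longrightarrow> s x = 0" "\<And>x. 1 \<le> x \<Longrightarrow> s x = 1"
    "\<And>x. 0 \<le> s x" "\<And>x. s x \<le> 1" by (rule smooth_step_exists) blast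
  define q where "q = 1 / (d - c)"
  have q: "q > 0" using assms by (simp add: q_def)
  define b where "b x = s ((- q) * x + q * d) * s (q * x + q * d)" for x
  have qd: "q * c + 1 = q * d" using assms by (simp add: q_def field_simps)
  show ?thesis
  proof
    show "smooth b" unfolding b_def by (intro smooth_mult smooth_affine[OF s(1)])
    show "b (- x) = b x" for x by (simp add: b_def mult.commute)
    show "b x = 1" if "\<bar>x\<bar> \<le> c" for x
    proof -
      have "q * x \<le> q * c" "q * (- c) \<le> q * x" using that q by (intro mult_left_mono; simp)+
      then show ?thesis using qd s(3) by (simp add: b_def)
    qed
    show "b x = 0" if "d \<le> \<bar>x\<bar>" for x
    proof (cases "d \<le> x")
      case True
      then have "q * d \<le> q * x" using q by (intro mult_left_mono; simp)
      then show ?thesis using s(2) by (simp add: b_def)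
    next
      case False
      then have "q * x \<le> q * (- d)" using q that by (intro mult_left_mono; simp)
      then show ?thesis using s(2) by (simp add: b_def)
    qed
    show "0 \<le> b x" "b x \<le> 1" for x using s(4,5) by (auto simp: b_def mult_le_one)
  qed
qed

section \<open>Oscillating profiles on finite unions of intervals\<close>

text \<open>Finite disjoint unions of nonempty bounded open intervals. Disjointness is built into
  the rule so that measures add, and the induction reduces every existence statement to a single
  interval.\<close>

inductive interval_union :: "real set \<Rightarrow> bool" where
  interval: "a < b \<Longrightarrow> interval_union {a<..<b}"
| union: "interval_union X \<Longrightarrow> interval_union Y \<Longrightarrow> X \<inter> Y = {} \<Longrightarrow> interval_union (X \<union> Y)"

lemma interval_union_open: "interval_union X \<Longrightarrow> open X"
  by (induction rule: interval_union.induct) auto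

lemma interval_union_fmeasurable: "interval_union X \<Longrightarrow> X \<in> fmeasurable lborel"
proof (induction rule: interval_union.induct)
  case (interval a b)
  then show ?case by (auto intro!: fmeasurableI)
qed (rule fmeasurable.Un)

lemma interval_union_measure_union:
  assumes "interval_union X" "interval_union Y" "X \<inter> Y = {}"
  shows "measure lborel (X \<union> Y) = measure lborel X + measure lborel Y"
  by (rule measure_Un3[THEN trans])
    (use assms interval_union_fmeasurable in auto)

lemma interval_union_measure_pos: "interval_union X \<Longrightarrow> measure lborel X > 0"
  by (induction rule: interval_union.induct) (auto simp: interval_union_measure_union)

text \<open>Some compact subset of X carries f. Compared with a condition on the closure of {f
  \<noteq> 0}, this passes to sums, products and derivatives by naming the compact set.\<close>

definition supported_in :: "('a::topological_space \<Rightarrow> real) \<Rightarrow> 'a set \<Rightarrow> bool" where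
  "supported_in f X \<longleftrightarrow> (\<exists>K. compact K \<and> K \<subseteq> X \<and> (\<forall>x. x \<notin> K \<longrightarrow> f x = 0))"

lemma supported_in_zero: "supported_in f X \<Longrightarrow> x \<notin> X \<Longrightarrow> f x = 0"
  by (auto simp: supported_in_def)

lemma supported_in_mono: "supported_in f X \<Longrightarrow> X \<subseteq> Y \<Longrightarrow> supported_in f Y"
  by (auto simp: supported_in_def)

lemma deriv_zero_outside:
  assumes "compact K" "\<And>x. x \<notin> K \<Longrightarrow> f x = 0" "x \<notin> K"
  shows "deriv f x = (0::real)"
proof -
  have "((\<lambda>x. 0) has_real_derivative 0) (at x)" by simp
  then have "(f has_real_derivative 0) (at x)"
    by (rule has_field_derivative_transform_within_open[where S = "- K"])
      (use assms in \<open>auto intro: open_Compl compact_imp_closed\<close>)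
  then show ?thesis by (rule DERIV_imp_deriv)
qed

lemma supported_in_deriv: "supported_in f X \<Longrightarrow> supported_in (deriv f) X"
  unfolding supported_in_def using deriv_zero_outside by metis

definition jet :: "(real \<Rightarrow> real) \<Rightarrow> real \<Rightarrow> real \<times> real \<times> real" where
  "jet f x = (f x, deriv f x, deriv (deriv f) x)"

text \<open>A profile on \<open>X\<close> is a smooth function supported in \<open>X\<close> whose 2-jet stays in \<open>V\<close> everywhere and
  in the smaller set \<open>S\<close> on a part of \<open>X\<close> of measure \<open>m\<close>. Profiles on disjoint sets add up, which reduces
  everything to one interval.\<close>

definition profile ::
  "(real \<times> real \<times> real) set \<Rightarrow> (real \<times> real \<times> real) set \<Rightarrow> real set \<Rightarrow> real \<Rightarrow> bool" where
  "profile V S X m \<longleftrightarrow> (\<exists>f X'. smooth f \<and> supported_in f X \<and> range (jet f) \<subseteq> V \<and>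
     interval_union X' \<and> X' \<subseteq> X \<and> jet f ` X' \<subseteq> S \<and> measure lborel X' = m)"

lemma profile_mono: "profile V S X m \<Longrightarrow> X \<subseteq> Y \<Longrightarrow> profile V S Y m"
  unfolding profile_def
  by (elim exE conjE, rule exI, rule exI) (auto intro: supported_in_mono)

lemma jet_add:
  assumes "smooth f" "smooth g"
  shows "jet (\<lambda>x. f x + g x) x = jet f x + jet g x"
  using assms by (simp add: jet_def deriv_add_smooth smooth_deriv)

lemma jet_zero_outside:
  assumes "compact K" "\<And>x. x \<notin> K \<Longrightarrow> f x = 0" "x \<notin> K"
  shows "jet f x = 0"
proof -
  have "deriv f x = 0" if "x \<notin> K" for x using deriv_zero_outside[OF assms(1,2) that] .
  then show ?thesis
    using assms deriv_zero_outside[OF assms(1), of "deriv f" x] by (simp add: jet_def zero_prod_def)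
qed

text \<open>The compact supports lie in disjoint sets, so off either of them the jet of the sum is
  the jet of the other summand. Thus every jet of the sum is a jet of one summand, and membership in
  \<open>V\<close> and \<open>S\<close> is inherited.\<close>

lemma profile_union:
  assumes "profile V S X m" "profile V S Y n" "X \<inter> Y = {}"
  shows "profile V S (X \<union> Y) (m + n)"
proof -
  obtain f X' K where f: "smooth f" "compact K" "K \<subseteq> X" "\<And>x. x \<notin> K \<Longrightarrow> f x = 0"
    "range (jet f) \<subseteq> V" "interval_union X'" "X' \<subseteq> X" "jet f ` X' \<subseteq> S" "measure lborel X' = m"
    using assms(1) unfolding profile_def supported_in_def by blast
  obtain g Y' L where g: "smooth g" "compact L" "L \<subseteq> Y" "\<And>x. x \<notin> L \<Longrightarrow> g x = 0"
    "range (jet g) \<subseteq> V" "interval_union Y'" "Y' \<subseteq> Y" "jet g ` Y' \<subseteq> S" "measure lborel Y' = n"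
    using assms(2) unfolding profile_def supported_in_def by blast
  define h where "h x = f x + g x" for x
  have jf: "jet h x = jet f x" if "x \<notin> L" for x
    using jet_zero_outside[OF g(2,4) that] jet_add[OF f(1) g(1)] by (simp add: h_def[abs_def])
  have jg: "jet h x = jet g x" if "x \<notin> K" for x
    using jet_zero_outside[OF f(2,4) that] jet_add[OF f(1) g(1)] by (simp add: h_def[abs_def])
  have "jet h x \<in> V" for x
  proof (cases "x \<in> L")
    case True
    then have "x \<notin> K" using f(3) g(3) assms(3) by blast
    then show ?thesis using jg[of x] g(5) by auto
  next
    case False
    then show ?thesis using jf[of x] f(5) by auto
  qed
  moreover have "jet h x \<in> S" if "x \<in> X' \<union> Y'" for x
  proof (cases "x \<in> X'")
    case True
    then have "x \<notin> L" using f(7) g(3) assms(3) by blast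
    then show ?thesis using jf[of x] f(8) True by auto
  next
    case False
    then have "x \<in> Y'" using that by blast
    then have "x \<notin> K" using f(3) g(7) assms(3) by blast
    then show ?thesis using jg[of x] g(8) \<open>x \<in> Y'\<close> by auto
  qed
  moreover have "smooth h" unfolding h_def by (rule smooth_add[OF f(1) g(1)])
  moreover have "supported_in h (X \<union> Y)"
    unfolding supported_in_def
    by (rule exI[of _ "K \<union> L"]) (use f(2,3,4) g(2,3,4) in \<open>auto simp: h_def\<close>)
  moreover have XY: "X' \<inter> Y' = {}" using f(7) g(7) assms(3) by blast
  moreover have "measure lborel (X' \<union> Y') = m + n"
    using interval_union_measure_union[OF f(6) g(6) XY] f(9) g(9) by simp
  moreover have "interval_union (X' \<union> Y')" by (rule interval_union.union[OF f(6) g(6) XY])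
  ultimately show ?thesis unfolding profile_def
    using f(7) g(7) by (intro exI[of _ h] exI[of _ "X' \<union> Y'"]) blast
qed

lemma profile_interval_union:
  assumes "\<And>a b. a < b \<Longrightarrow> profile V S {a<..<b} ((b - a) * c)" "interval_union X"
  shows "profile V S X (measure lborel X * c)"
  using assms(2)
proof (induction rule: interval_union.induct)
  case (interval a b)
  with assms(1)[OF interval] show ?case by simp
next
  case (union X Y)
  then show ?case
    using profile_union[OF union.IH union.hyps(3)] interval_union_measure_union[OF union.hyps]
    by (simp add: algebra_simps)
qed

text \<open>Each tile carries a function that vanishes near its endpoints, so neighbouring copies
  join smoothly. The common endpoints are missing from the union of open tiles and are recovered by
  \<open>profile_mono\<close>.\<close>

lemma profile_tiling:
  assumes "\<And>a. profile V S {a<..<a + h} m" "0 < h"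
  shows "profile V S {a<..<a + real (Suc n) * h} (real (Suc n) * m)"
proof (induction n)
  case (Suc n)
  have "profile V S ({a<..<a + real (Suc n) * h} \<union> {a + real (Suc n) * h<..<a + real (Suc n) * h + h})
      (real (Suc n) * m + m)"
    by (rule profile_union[OF Suc assms(1)]) auto
  moreover have "{a<..<a + q} \<union> {a + q<..<a + q + h} \<subseteq> {a<..<a + q + h}" if "0 \<le> q" for q
    using that assms(2) by auto
  ultimately have "profile V S {a<..<a + real (Suc n) * h + h} (real (Suc n) * m + m)"
    using assms(2) by (elim profile_mono) simp
  then show ?case by (simp add: algebra_simps)
qed (use assms(1)[of a] in simp)

lemma jet_affine_smooth:
  assumes "smooth f"
  shows "jet (\<lambda>x. c * f (a * x + b)) x
    = (c * f (a * x + b), c * a * deriv f (a * x + b), c * a * a * deriv (deriv f) (a * x + b))"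
proof -
  have 1: "smooth (\<lambda>x. f (a * x + b))" by (rule smooth_affine[OF assms])
  have 2: "smooth (\<lambda>x. deriv f (a * x + b))" by (rule smooth_affine[OF smooth_deriv[OF assms]])
  show ?thesis
    by (simp add: jet_def deriv_cmult_smooth[OF 1] deriv_affine_smooth[OF assms]
        deriv_affine_smooth[OF smooth_deriv[OF assms]] deriv_cmult_smooth[OF smooth_cmult[OF 2]]
        deriv_cmult_smooth[OF 2] mult.assoc)
qed

text \<open>The function is s f((x - (a + h)) / h), which carries (-1, 1) to the given interval and
  multiplies the three jet components by s, s/h and s/h^2. The choice s = 1 serves for cutoffs; s =
  h^2 keeps the second derivative and shrinks the value and the slope with h.\<close>

lemma profile_rescale:
  assumes f: "smooth f" "\<And>x. r \<le> \<bar>x\<bar> \<Longrightarrow> f x = 0" "0 < r" "r < 1" "0 < c" "c < 1" "0 < h"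
    and V: "\<And>x. (s * f x, s / h * deriv f x, s / h / h * deriv (deriv f) x) \<in> V"
    and S: "\<And>x. \<bar>x\<bar> < c \<Longrightarrow> (s * f x, s / h * deriv f x, s / h / h * deriv (deriv f) x) \<in> S"
  shows "profile V S {a<..<a + 2 * h} (2 * h * c)"
proof -
  define g where "g x = s * f (1 / h * x + (- 1 - a / h))" for x
  have eq: "1 / h * x + (- 1 - a / h) = (x - (a + h)) / h" for x
    using f by (simp add: field_simps)
  have jet: "jet g x = (s * f ((x - (a + h)) / h), s / h * deriv f ((x - (a + h)) / h),
      s / h / h * deriv (deriv f) ((x - (a + h)) / h))" for x
    using jet_affine_smooth[OF f(1), of s "1 / h" "- 1 - a / h" x]
    unfolding eq g_def[abs_def] by simp
  define X where "X = {a + h - h * c<..<a + h + h * c}"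
  have "smooth g" unfolding g_def by (rule smooth_cmult[OF smooth_affine[OF f(1)]])
  moreover have "supported_in g {a<..<a + 2 * h}"
    unfolding supported_in_def
  proof (intro exI[of _ "{a + h - h * r..a + h + h * r}"] conjI allI impI)
    show "{a + h - h * r..a + h + h * r} \<subseteq> {a<..<a + 2 * h}"
    proof -
      have "0 < h * r" "h * r < h" using f(3,4,7) by (simp_all add: mult_less_cancel_left2)
      then show ?thesis by auto
    qed
    fix x assume "x \<notin> {a + h - h * r..a + h + h * r}"
    then have "r \<le> \<bar>(x - (a + h)) / h\<bar>"
      using f(7) by (auto simp: abs_if field_simps)
    then show "g x = 0" unfolding g_def eq by (simp only: f(2) mult_zero_right)
  qed simp
  moreover have "range (jet g) \<subseteq> V" using V by (auto simp: jet)
  moreover have "interval_union X" unfolding X_def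
    by (rule interval_union.interval) (use f in auto)
  moreover have "X \<subseteq> {a<..<a + 2 * h}"
  proof -
    have "0 < h * c" "h * c < h" using f(5,6,7) by (simp_all add: mult_less_cancel_left2)
    then show ?thesis by (auto simp: X_def)
  qed
  moreover have "jet g x \<in> S" if "x \<in> X" for x
  proof -
    have "\<bar>(x - (a + h)) / h\<bar> < c" using that f(7) by (auto simp: X_def abs_if field_simps)
    then show ?thesis unfolding jet by (rule S)
  qed
  moreover have "measure lborel X = 2 * h * c" using f by (simp add: X_def)
  ultimately show ?thesis unfolding profile_def by blast
qed

lemma cutoff_profile:
  assumes X: "interval_union X" and eta: "0 < \<eta>" "\<eta> < 1"
  obtains f X' where "smooth f" "supported_in f X" "\<And>x. 0 \<le> f x" "\<And>x. f x \<le> 1"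
    "interval_union X'" "X' \<subseteq> X" "\<And>x. x \<in> X' \<Longrightarrow> f x = 1"
    "measure lborel X' = (1 - \<eta>) * measure lborel X"
proof -
  \<comment> \<open>Only the value component is constrained; the derivatives of a cutoff may be
    arbitrarily large.\<close>
  let ?V = "{0..1} \<times> UNIV :: (real \<times> real \<times> real) set" and ?S = "{1} \<times> UNIV :: (real \<times> real \<times> real) set"
  obtain b :: "real \<Rightarrow> real" where b: "smooth b" "\<And>x. \<bar>x\<bar> \<le> 1 - \<eta> \<Longrightarrow> b x = 1"
    "\<And>x. 1 - \<eta> / 2 \<le> \<bar>x\<bar> \<Longrightarrow> b x = 0" "\<And>x. 0 \<le> b x" "\<And>x. b x \<le> 1"
    by (rule smooth_bump_exists[of "1 - \<eta>" "1 - \<eta> / 2"]) (use eta in auto)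
  have "profile ?V ?S {u<..<v} ((v - u) * (1 - \<eta>))" if "u < v" for u v
  proof -
    have "profile ?V ?S {u<..<u + 2 * ((v - u) / 2)} (2 * ((v - u) / 2) * (1 - \<eta>))"
      by (rule profile_rescale[where f = b and r = "1 - \<eta> / 2" and s = 1])
        (use b that eta in auto)
    moreover have "2 * ((v - u) / 2) = v - u" "u + (v - u) = v" by auto
    ultimately show ?thesis by metis
  qed
  from profile_interval_union[OF this X]
  obtain f X' where f: "smooth f" "supported_in f X" "range (jet f) \<subseteq> ?V"
    "interval_union X'" "X' \<subseteq> X" "jet f ` X' \<subseteq> ?S" "measure lborel X' = measure lborel X * (1 - \<eta>)"
    unfolding profile_def by blast
  have "jet f x \<in> ?V" for x using f(3) by auto
  then have "f x \<in> {0..1}" for x by (auto simp: jet_def)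
  moreover have "f x = 1" if "x \<in> X'" for x using f(6) that by (auto simp: jet_def)
  ultimately show ?thesis using that f by (auto simp: mult.commute)
qed

lemma DERIV_difference_bounds:
  fixes F :: "real \<Rightarrow> real"
  assumes "\<And>x. (F has_real_derivative f x) (at x)" "a \<le> b"
    "\<And>x. a \<le> x \<Longrightarrow> x \<le> b \<Longrightarrow> l \<le> f x \<and> f x \<le> u"
  shows "l * (b - a) \<le> F b - F a \<and> F b - F a \<le> u * (b - a)"
proof (cases "a = b")
  case False
  then have "a < b" using assms(2) by simp
  then obtain z where "a < z" "z < b" "F b - F a = (b - a) * f z"
    using MVT2[of a b F f] assms(1) by auto
  then show ?thesis using assms(3)[of z] \<open>a < b\<close>
    by (simp add: mult.commute mult_left_mono)
qed simp

text \<open>The second derivative \<open>\<psi>\<close> is even with mean zero. Hence its antiderivative \<open>F\<close> is odd with compact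
  support, and so the antiderivative of \<open>F\<close> has compact support as well.\<close>

lemma oscillation_exists:
  assumes B: "0 < B" and eta: "0 < \<eta>" "\<eta> < 1"
  obtains f c r where "smooth f" "\<And>x. r \<le> \<bar>x\<bar> \<Longrightarrow> f x = 0" "0 < r" "r < 1"
    "0 < c" "c < 1" "(1 - \<eta>) * (B / (1 + B)) \<le> c" "c \<le> B / (1 + B)"
    "\<And>x. - B \<le> deriv (deriv f) x" "\<And>x. deriv (deriv f) x \<le> 1"
    "\<And>x. \<bar>x\<bar> < c \<Longrightarrow> deriv (deriv f) x = 1"
proof -
  \<comment> \<open>A third of \<eta>, because the plateau fraction c = (1 - \<epsilon>) (1 - 2
    \<epsilon>) \<theta> must be at least (1 - 3 \<epsilon>) \<theta>.\<close>
  define \<epsilon> where "\<epsilon> = \<eta> / 3"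
  \<comment> \<open>The optimal fraction: a mean-zero function with values in [-B, 1] that equals 1
    on a fraction \<theta> satisfies \<theta> \<le> B (1 - \<theta>).\<close>
  define \<theta> where "\<theta> = B / (1 + B)"
  define d where "d = (1 - 2 * \<epsilon>) * \<theta>"
  define c where "c = (1 - \<epsilon>) * d"
  have eps: "0 < \<epsilon>" "\<epsilon> < 1 / 3" using eta by (auto simp: \<epsilon>_def)
  have th: "0 < \<theta>" "\<theta> < 1" "\<theta> = B * (1 - \<theta>)" using B by (auto simp: \<theta>_def field_simps)
  have d: "0 < d" "d < 1 - 2 * \<epsilon>" using th eps by (auto simp: d_def)
  have c: "0 < c" "c < d" using d eps by (auto simp: c_def algebra_simps)
  have c_le: "c \<le> \<theta>"
  proof -
    have "d \<le> 1 * \<theta>" unfolding d_def using eps th by (intro mult_right_mono) auto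
    then show ?thesis using c by simp
  qed
  have c_ge: "(1 - \<eta>) * \<theta> \<le> c"
  proof -
    have "1 - \<eta> \<le> (1 - \<epsilon>) * (1 - 2 * \<epsilon>)" using eps by (simp add: \<epsilon>_def algebra_simps)
    then show ?thesis unfolding c_def d_def mult.assoc[symmetric]
      using th by (intro mult_right_mono) auto
  qed
  obtain b1 :: "real \<Rightarrow> real" where b1: "smooth b1" "\<And>x. b1 (- x) = b1 x" "\<And>x. \<bar>x\<bar> \<le> c \<Longrightarrow> b1 x = 1"
    "\<And>x. d \<le> \<bar>x\<bar> \<Longrightarrow> b1 x = 0" "\<And>x. 0 \<le> b1 x" "\<And>x. b1 x \<le> 1"
    by (rule smooth_bump_exists[of c d]) (use c in auto)
  obtain b2 :: "real \<Rightarrow> real" where b2: "smooth b2" "\<And>x. b2 (- x) = b2 x" "\<And>x. \<bar>x\<bar> \<le> 1 - 2 * \<epsilon> \<Longrightarrow> b2 x = 1"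
    "\<And>x. 1 - \<epsilon> \<le> \<bar>x\<bar> \<Longrightarrow> b2 x = 0" "\<And>x. 0 \<le> b2 x" "\<And>x. b2 x \<le> 1"
    by (rule smooth_bump_exists[of "1 - 2 * \<epsilon>" "1 - \<epsilon>"]) (use eps in auto)
  obtain F1 where F1: "\<And>x. (F1 has_real_derivative b1 x) (at x)" "F1 0 = 0" "smooth F1"
    using smooth_has_antiderivative[OF b1(1)] by blast
  obtain F2 where F2: "\<And>x. (F2 has_real_derivative b2 x) (at x)" "F2 0 = 0" "smooth F2"
    using smooth_has_antiderivative[OF b2(1)] by blast
  have "F1 1 - F1 d = 0"
    using DERIV_difference_bounds[OF F1(1), of d 1 0 0] b1(4) c d eps by fastforce
  moreover have "F1 d - F1 0 \<le> d"
    using DERIV_difference_bounds[OF F1(1), of 0 d 0 1] b1(5,6) d by fastforce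
  moreover have "F1 1 - F1 0 \<ge> 0"
    using DERIV_difference_bounds[OF F1(1), of 0 1 0 1] b1(5,6) by fastforce
  ultimately have A1: "F1 1 \<le> d" "0 \<le> F1 1" using F1(2) by auto
  have "F2 1 - F2 (1 - 2 * \<epsilon>) \<ge> 0"
    using DERIV_difference_bounds[OF F2(1), of "1 - 2 * \<epsilon>" 1 0 1] b2(5,6) eps by fastforce
  moreover have "F2 (1 - 2 * \<epsilon>) - F2 0 \<ge> 1 - 2 * \<epsilon>"
    using DERIV_difference_bounds[OF F2(1), of 0 "1 - 2 * \<epsilon>" 1 1] b2(3) eps by fastforce
  ultimately have A2: "1 - 2 * \<epsilon> \<le> F2 1" using F2(2) by auto
  \<comment> \<open>With this weight (1 + b) \<open>b1\<close> - b \<open>b2\<close> has integral 0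
    over (0, 1): a plateau of height 1 in the middle, compensated by values down to -b.\<close>
  define b where "b = F1 1 / (F2 1 - F1 1)"
  have pos: "F2 1 - F1 1 > 0" using A1 A2 d by linarith
  have b0: "0 \<le> b" using A1 pos by (simp add: b_def)
  have bB: "b \<le> B"
  proof -
    \<comment> \<open>This is \<theta> = B (1 - \<theta>) multiplied by 1 - 2 \<epsilon>. Since
      \<open>F1 1\<close> is at most d and \<open>F2 1\<close> at least 1 - 2 \<epsilon>, it yields
      b \<le> B.\<close>
    have dB: "d = B * ((1 - 2 * \<epsilon>) - d)"
      using th(3) unfolding d_def by (metis mult.left_commute mult.right_neutral right_diff_distrib)
    have "F1 1 \<le> d" by (rule A1)
    also have "d \<le> B * (F2 1 - F1 1)"
      using A1 A2 B by (subst dB) (auto intro!: mult_left_mono)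
    finally show ?thesis using pos by (simp add: b_def field_simps)
  qed
  define \<psi> where "\<psi> x = (1 + b) * b1 x + (- b) * b2 x" for x
  define F where "F x = (1 + b) * F1 x + (- b) * F2 x" for x
  have sm: "smooth F" "smooth \<psi>"
    unfolding F_def \<psi>_def by (intro smooth_add smooth_cmult F1(3) F2(3) b1(1) b2(1))+
  have F: "(F has_real_derivative \<psi> x) (at x)" for x
    unfolding F_def \<psi>_def by (intro DERIV_add DERIV_cmult F1(1) F2(1))
  have "F 1 = F1 1 - b * (F2 1 - F1 1)" by (simp add: F_def algebra_simps)
  also have "\<dots> = 0" using pos by (simp add: b_def)
  finally have F_1: "F 1 = 0" .
  have F_0: "F 0 = 0" by (simp add: F_def F1(2) F2(2))
  have \<psi>_even: "\<psi> (- x) = \<psi> x" for x by (simp add: \<psi>_def b1(2) b2(2))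
  have \<psi>_far: "\<psi> x = 0" if "1 - \<epsilon> \<le> \<bar>x\<bar>" for x
  proof -
    have "d \<le> \<bar>x\<bar>" using that d eps by linarith
    then show ?thesis using b1(4) b2(4)[OF that] by (simp add: \<psi>_def)
  qed
  have \<psi>_bd: "- b \<le> \<psi> x \<and> \<psi> x \<le> 1" for x
  proof (cases "d \<le> \<bar>x\<bar>")
    case True
    have "b * b2 x \<le> b * 1" by (rule mult_left_mono[OF b2(6) b0])
    moreover have "0 \<le> b * b2 x" using b2(5) b0 by simp
    ultimately have "b * b2 x \<le> b" "0 \<le> b * b2 x" by auto
    then show ?thesis using b1(4)[OF True] by (auto simp: \<psi>_def)
  next
    case False
    then have "b2 x = 1" using d by (intro b2(3)) auto
    moreover have "(1 + b) * b1 x \<le> (1 + b) * 1" "0 \<le> (1 + b) * b1 x"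
      using b1(5,6) b0 by (auto intro: mult_left_mono)
    ultimately show ?thesis by (auto simp: \<psi>_def)
  qed
  have \<psi>_one: "\<psi> x = 1" if "\<bar>x\<bar> < c" for x
  proof -
    have "b1 x = 1" "b2 x = 1" using that c d by (auto intro!: b1(3) b2(3))
    then show ?thesis by (simp add: \<psi>_def)
  qed
  have refl: "((\<lambda>x. g (- x)) has_real_derivative - g' (- x)) (at x)"
    if "\<And>x. (g has_real_derivative g' x) (at x)" for g g' :: "real \<Rightarrow> real" and x
    using DERIV_chain2[OF that DERIV_minus[OF DERIV_ident], of x UNIV] by simp
  have F_odd: "F (- x) = - F x" for x
  proof -
    have "((\<lambda>x. F x + F (- x)) has_real_derivative 0) (at x)" for x
      using DERIV_add[OF F refl[OF F], of x] \<psi>_even[of x] by simp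
    from DERIV_isconst_all[OF allI[OF this], of x 0] show ?thesis by (simp add: F_0)
  qed
  have F_far: "F x = 0" if "1 - \<epsilon> \<le> x" for x
  proof (cases "x \<le> 1")
    case True
    then show ?thesis
      using DERIV_difference_bounds[OF F, of x 1 0 0] \<psi>_far F_1 that by force
  next
    case False
    then show ?thesis
      using DERIV_difference_bounds[OF F, of 1 x 0 0] \<psi>_far F_1 eps by force
  qed
  obtain G where G: "\<And>x. (G has_real_derivative F x) (at x)" "G 0 = 0" "smooth G"
    using smooth_has_antiderivative[OF sm(1)] by blast
  have G_even: "G (- x) = G x" for x
  proof -
    have "((\<lambda>x. G x - G (- x)) has_real_derivative 0) (at x)" for x
      using DERIV_diff[OF G(1) refl[OF G(1)], of x] F_odd[of x] by simp
    from DERIV_isconst_all[OF allI[OF this], of x 0] show ?thesis by simp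
  qed
  have G_far: "G x = G 1" if "1 - \<epsilon> \<le> x" for x
  proof (cases "x \<le> 1")
    case True
    then show ?thesis
      using DERIV_difference_bounds[OF G(1), of x 1 0 0] F_far that by force
  next
    case False
    then show ?thesis
      using DERIV_difference_bounds[OF G(1), of 1 x 0 0] F_far eps by force
  qed
  define f where "f x = G x + (- G 1)" for x
  have "smooth f" unfolding f_def by (intro smooth_add G(3) smooth_const)
  have "(f has_real_derivative F x) (at x)" for x
    using DERIV_add[OF G(1) DERIV_const[of "- G 1"]] by (simp add: f_def[abs_def])
  then have df: "deriv f = F" by (auto intro!: DERIV_imp_deriv)
  have ddf: "deriv F = \<psi>" using F by (auto intro!: DERIV_imp_deriv)
  show ?thesis
  proof
    show "smooth f" by fact
    show "f x = 0" if "1 - \<epsilon> \<le> \<bar>x\<bar>" for x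
      using G_far[of "\<bar>x\<bar>"] that G_even[of x] by (auto simp: f_def abs_if split: if_splits)
    show "0 < 1 - \<epsilon>" "1 - \<epsilon> < 1" using eps by auto
    show "0 < c" "c < 1" using c d eps by auto
    show "(1 - \<eta>) * (B / (1 + B)) \<le> c" "c \<le> B / (1 + B)" using c_ge c_le by (auto simp: \<theta>_def)
    show "- B \<le> deriv (deriv f) x" "deriv (deriv f) x \<le> 1" for x
      using \<psi>_bd[of x] bB by (auto simp: df ddf)
    show "deriv (deriv f) x = 1" if "\<bar>x\<bar> < c" for x using \<psi>_one[OF that] by (simp add: df ddf)
  qed
qed

lemma smooth_supported_bounded:
  assumes "smooth f" "supported_in f X"
  obtains M where "0 < M" "\<And>x. \<bar>f x\<bar> \<le> M"
proof -
  obtain K where K: "compact K" "\<And>x. x \<notin> K \<Longrightarrow> f x = 0" using assms(2) by (auto simp: supported_in_def)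
  have "compact (f ` K)" by (intro compact_continuous_image smooth_continuous_on assms(1) K(1))
  then obtain M where M: "0 < M" "\<And>x. x \<in> K \<Longrightarrow> \<bar>f x\<bar> \<le> M"
    using bounded_pos[of "f ` K"] compact_imp_bounded by (auto simp: real_norm_def)
  have "\<bar>f x\<bar> \<le> M" for x using K(2)[of x] M by (cases "x \<in> K") auto
  with M(1) that show ?thesis by blast
qed

text \<open>Filling an interval with copies h^2 g((x - m) / h) of one function leaves the range of
  the second derivative and the fraction c where it equals 1 unchanged, while value and slope are of
  order h^2 and h. The fraction is the same on every component, so it survives the union.\<close>

lemma oscillation_profile:
  assumes X: "interval_union X" and B: "0 < B" and eta: "0 < \<eta>" "\<eta> < 1" and \<delta>: "0 < \<delta>"
  obtains f X' c where "smooth f" "supported_in f X" "\<And>x. \<bar>f x\<bar> \<le> \<delta>" "\<And>x. \<bar>deriv f x\<bar> \<le> \<delta>"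
    "\<And>x. - B \<le> deriv (deriv f) x" "\<And>x. deriv (deriv f) x \<le> 1"
    "interval_union X'" "X' \<subseteq> X" "\<And>x. x \<in> X' \<Longrightarrow> deriv (deriv f) x = 1"
    "measure lborel X' = c * measure lborel X"
    "(1 - \<eta>) * (B / (1 + B)) \<le> c" "c \<le> B / (1 + B)"
proof -
  let ?V = "{-\<delta>..\<delta>} \<times> {-\<delta>..\<delta>} \<times> {-B..1}" and ?S = "UNIV \<times> UNIV \<times> {1} :: (real \<times> real \<times> real) set"
  obtain g c r where g: "smooth g" "\<And>x. r \<le> \<bar>x\<bar> \<Longrightarrow> g x = 0" "0 < r" "r < 1"
    and c: "0 < c" "c < 1" "(1 - \<eta>) * (B / (1 + B)) \<le> c" "c \<le> B / (1 + B)"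
    and g2: "\<And>x. - B \<le> deriv (deriv g) x" "\<And>x. deriv (deriv g) x \<le> 1"
    "\<And>x. \<bar>x\<bar> < c \<Longrightarrow> deriv (deriv g) x = 1"
    by (rule oscillation_exists[OF B eta]) blast
  have sup: "supported_in g UNIV" unfolding supported_in_def
    by (rule exI[of _ "{-r..r}"]) (auto intro!: g(2))
  obtain M0 where M0: "0 < M0" "\<And>x. \<bar>g x\<bar> \<le> M0" by (rule smooth_supported_bounded[OF g(1) sup]) blast
  obtain M1 where M1: "0 < M1" "\<And>x. \<bar>deriv g x\<bar> \<le> M1"
    by (rule smooth_supported_bounded[OF smooth_deriv[OF g(1)] supported_in_deriv[OF sup]]) blast
  \<comment> \<open>For h \<le> H \<le> 1 this single bound controls both h^2 \<open>M0\<close>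
    \<le> h \<open>M0\<close> and h \<open>M1\<close>.\<close>
  define H where "H = min 1 (\<delta> / (M0 + M1))"
  have H: "0 < H" "H \<le> 1" "H * (M0 + M1) \<le> \<delta>"
  proof -
    have pos: "0 < M0 + M1" using M0(1) M1(1) by simp
    have "H \<le> \<delta> / (M0 + M1)" by (simp add: H_def)
    then show "H * (M0 + M1) \<le> \<delta>" using pos by (simp only: pos_le_divide_eq)
    show "0 < H" "H \<le> 1" using pos \<delta> by (auto simp: H_def)
  qed
  have tile: "profile ?V ?S {a<..<a + 2 * h} (2 * h * c)" if h: "0 < h" "h \<le> H" for a h
  proof (rule profile_rescale[where f = g and s = "h * h", OF g c(1,2) h(1)])
    fix x
    have hH: "h * (M0 + M1) \<le> \<delta>" using H(3) h M0(1) M1(1)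
      by (meson add_pos_pos less_imp_le mult_right_mono order_trans)
    have "\<bar>h * h * g x\<bar> \<le> 1 * h * M0"
      unfolding abs_mult using h H M0 by (intro mult_mono) auto
    also have "\<dots> \<le> \<delta>" using hH h M0(1) M1(1) by (simp add: algebra_simps) (smt (verit) mult_pos_pos)
    finally have 1: "\<bar>h * h * g x\<bar> \<le> \<delta>" .
    have "\<bar>h * deriv g x\<bar> \<le> h * M1" unfolding abs_mult using h M1 by (intro mult_mono) auto
    also have "\<dots> \<le> \<delta>" using hH h M0(1) M1(1) by (simp add: algebra_simps) (smt (verit) mult_pos_pos)
    finally have 2: "\<bar>h * deriv g x\<bar> \<le> \<delta>" .
    have eq: "h * h / h = h" "h / h = 1" using h by auto
    show "(h * h * g x, h * h / h * deriv g x, h * h / h / h * deriv (deriv g) x) \<in> ?V"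
      unfolding eq using 1 2 g2(1,2)[of x] by auto
    show "(h * h * g x, h * h / h * deriv g x, h * h / h / h * deriv (deriv g) x) \<in> ?S"
      if "\<bar>x\<bar> < c" unfolding eq using g2(3)[OF that] by auto
  qed
  have "profile ?V ?S {u<..<v} ((v - u) * c)" if uv: "u < v" for u v
  proof -
    obtain n :: nat where n: "(v - u) / (2 * H) < real n" using reals_Archimedean2 by blast
    \<comment> \<open>The cell size is adjusted so that n + 1 cells of length 2 h fill the interval
      exactly; the choice of n forces h \<le> H.\<close>
    define h where "h = (v - u) / (2 * real (Suc n))"
    have "(v - u) < real n * (2 * H)" using n H(1) by (simp add: field_simps)
    also have "\<dots> \<le> real (Suc n) * (2 * H)" using H(1) by (intro mult_right_mono) auto
    finally have h: "0 < h" "h \<le> H" using uv unfolding h_def by (auto simp: field_simps)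
    have eq: "real (Suc n) * (2 * h) = v - u" unfolding h_def by (simp add: field_simps del: of_nat_Suc)
    have "profile ?V ?S {u<..<u + real (Suc n) * (2 * h)} (real (Suc n) * (2 * h * c))"
      by (rule profile_tiling[OF tile[OF h]]) (use h in simp)
    moreover have "real (Suc n) * (2 * h * c) = (v - u) * c" using eq by (simp only: mult.assoc[symmetric])
    moreover have "u + (v - u) = v" by simp
    ultimately show ?thesis unfolding eq by metis
  qed
  from profile_interval_union[OF this X]
  obtain f X' where f: "smooth f" "supported_in f X" "range (jet f) \<subseteq> ?V"
    "interval_union X'" "X' \<subseteq> X" "jet f ` X' \<subseteq> ?S" "measure lborel X' = measure lborel X * c"
    unfolding profile_def by blast
  have "jet f x \<in> ?V" for x using f(3) by auto
  then have fV: "\<bar>f x\<bar> \<le> \<delta>" "\<bar>deriv f x\<bar> \<le> \<delta>" "- B \<le> deriv (deriv f) x" "deriv (deriv f) x \<le> 1" for x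
    by (auto simp: jet_def abs_le_iff) (smt (verit))+
  have "jet f x \<in> ?S" if "x \<in> X'" for x using f(6) that by blast
  then have fS: "deriv (deriv f) x = 1" if "x \<in> X'" for x using that by (simp add: jet_def)
  show ?thesis
    by (rule that[OF f(1,2) fV f(4,5) fS _ c(3,4)]) (use f(7) in \<open>auto simp: mult.commute\<close>)
qed

section \<open>Finite sums of tensor products\<close>

text \<open>Every smooth function of two variables in the construction has this form. Regularity of
  all orders and the commutation of partial derivatives thereby reduce to one-variable
  facts.\<close>

inductive tame :: "(real \<times> real \<Rightarrow> real) \<Rightarrow> bool" where
  tensor: "smooth f \<Longrightarrow> smooth g \<Longrightarrow> tame (\<lambda>z. f (fst z) * g (snd z))"
| add: "tame u \<Longrightarrow> tame v \<Longrightarrow> tame (\<lambda>z. u z + v z)"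

lemma Dt_tensor:
  "smooth f \<Longrightarrow> Dt (\<lambda>z. f (fst z) * g (snd z)) = (\<lambda>z. deriv f (fst z) * g (snd z))"
  unfolding Dt_def using DERIV_cmult_right[OF smooth_has_derivative]
  by (auto intro!: DERIV_imp_deriv)

lemma Dx_tensor:
  "smooth g \<Longrightarrow> Dx (\<lambda>z. f (fst z) * g (snd z)) = (\<lambda>z. f (fst z) * deriv g (snd z))"
  unfolding Dx_def using DERIV_cmult[OF smooth_has_derivative]
  by (auto intro!: DERIV_imp_deriv)

lemma differentiable_slices:
  fixes u :: "real \<times> real \<Rightarrow> real"
  assumes "u differentiable_on UNIV"
  shows "((\<lambda>s. u (s, x)) has_real_derivative Dt u (t, x)) (at t)"
    and "((\<lambda>y. u (t, y)) has_real_derivative Dx u (t, x)) (at x)"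
proof -
  have u: "u differentiable (at z)" for z
    using assms unfolding differentiable_on_def by blast
  have "(\<lambda>s. (s, x)) differentiable (at t)" "(\<lambda>y. (t, y)) differentiable (at x)"
    unfolding differentiable_def by (auto intro!: exI derivative_eq_intros)
  note pair = this
  have "(\<lambda>s. u (s, x)) differentiable (at t)" "(\<lambda>y. u (t, y)) differentiable (at x)"
    by (rule differentiable_compose[OF u pair(1)] differentiable_compose[OF u pair(2)])+
  then show "((\<lambda>s. u (s, x)) has_real_derivative Dt u (t, x)) (at t)"
    "((\<lambda>y. u (t, y)) has_real_derivative Dx u (t, x)) (at x)"
    by (simp_all add: Dt_def Dx_def DERIV_deriv_iff_real_differentiable)
qed

lemma Dt_eqI: "(\<And>t x. ((\<lambda>s. h (s, x)) has_real_derivative h' (t, x)) (at t)) \<Longrightarrow> Dt h = h'"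
proof
  assume *: "\<And>t x. ((\<lambda>s. h (s, x)) has_real_derivative h' (t, x)) (at t)"
  show "Dt h z = h' z" for z
    using DERIV_imp_deriv[OF *[where t = "fst z" and x = "snd z"]] by (simp add: Dt_def)
qed

lemma Dx_eqI: "(\<And>t x. ((\<lambda>y. h (t, y)) has_real_derivative h' (t, x)) (at x)) \<Longrightarrow> Dx h = h'"
proof
  assume *: "\<And>t x. ((\<lambda>y. h (t, y)) has_real_derivative h' (t, x)) (at x)"
  show "Dx h z = h' z" for z
    using DERIV_imp_deriv[OF *[where t = "fst z" and x = "snd z"]] by (simp add: Dx_def)
qed

lemma tame_differentiable: "tame u \<Longrightarrow> u differentiable_on UNIV"
proof (induction rule: tame.induct)
  case (tensor f g)
  have "f differentiable (at s)" "g differentiable (at s)" for s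
    using smooth_has_derivative[of f] smooth_has_derivative[of g] tensor
    by (auto simp: real_differentiable_def)
  moreover have "fst differentiable (at z)" "snd differentiable (at z)" for z :: "real \<times> real"
    unfolding differentiable_def by (auto intro!: exI derivative_eq_intros)
  ultimately show ?case unfolding differentiable_on_def
    by (auto intro!: differentiable_mult differentiable_compose[of f fst]
        differentiable_compose[of g snd])
qed (auto intro: differentiable_on_add)

lemma differentiable_add_partials:
  assumes "u differentiable_on UNIV" "v differentiable_on UNIV"
  shows "Dt (\<lambda>z. u z + v z) = (\<lambda>z. Dt u z + Dt v z)"
    and "Dx (\<lambda>z. u z + v z) = (\<lambda>z. Dx u z + Dx v z)"
  by (rule Dt_eqI, rule DERIV_add[OF differentiable_slices(1)[OF assms(1)]
        differentiable_slices(1)[OF assms(2)]])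
    (rule Dx_eqI, rule DERIV_add[OF differentiable_slices(2)[OF assms(1)]
        differentiable_slices(2)[OF assms(2)]])

text \<open>For a tensor product the mixed partials agree by inspection, and sums preserve this. The
  commutation is the source of the divergence-form equations: it allows u_t = a u_xx to be
  differentiated in x weakly.\<close>

lemma tame_partials: "tame u \<Longrightarrow> tame (Dt u) \<and> tame (Dx u) \<and> Dt (Dx u) = Dx (Dt u)"
proof (induction rule: tame.induct)
  case (tensor f g)
  then show ?case
    by (auto simp: Dt_tensor Dx_tensor smooth_deriv intro!: tame.tensor)
next
  case (add u v)
  then have d: "u differentiable_on UNIV" "v differentiable_on UNIV"
    "Dt u differentiable_on UNIV" "Dt v differentiable_on UNIV"
    "Dx u differentiable_on UNIV" "Dx v differentiable_on UNIV"
    by (auto intro: tame_differentiable)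
  show ?case using add
    unfolding differentiable_add_partials[OF d(1,2)] differentiable_add_partials[OF d(3,4)]
      differentiable_add_partials[OF d(5,6)]
    by (auto intro: tame.add)
qed

lemmas tame_Dt = tame_partials[THEN conjunct1]
lemmas tame_Dx = tame_partials[THEN conjunct2, THEN conjunct1]
lemmas tame_Dt_Dx = tame_partials[THEN conjunct2, THEN conjunct2]
lemmas tame_add_partials = differentiable_add_partials[OF tame_differentiable tame_differentiable]

lemma tame_continuous_on: "tame u \<Longrightarrow> continuous_on S u"
  by (rule continuous_on_subset[OF differentiable_imp_continuous_on[OF tame_differentiable] subset_UNIV])

lemma tame_Ck: "tame u \<Longrightarrow> Ck n u"
  by (induction n arbitrary: u) (auto simp: tame_continuous_on tame_differentiable tame_Dt tame_Dx)

lemma tame_sum: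
  fixes m :: nat
  assumes "tame u" "\<And>k. tame (w k)"
  shows "tame (\<lambda>z. u z + (\<Sum>k<m. w k z))"
proof (induction m)
  case (Suc m)
  show ?case using tame.add[OF Suc assms(2)[of m]] by (simp add: add.assoc)
qed (use assms in simp)

lemma tame_sum_partials:
  fixes m :: nat
  assumes "tame u" "\<And>k. tame (w k)"
  shows "Dt (\<lambda>z. u z + (\<Sum>k<m. w k z)) = (\<lambda>z. Dt u z + (\<Sum>k<m. Dt (w k) z))"
    and "Dx (\<lambda>z. u z + (\<Sum>k<m. w k z)) = (\<lambda>z. Dx u z + (\<Sum>k<m. Dx (w k) z))"
proof -
  have "Dt (\<lambda>z. u z + (\<Sum>k<m. w k z)) = (\<lambda>z. Dt u z + (\<Sum>k<m. Dt (w k) z)) \<and>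
    Dx (\<lambda>z. u z + (\<Sum>k<m. w k z)) = (\<lambda>z. Dx u z + (\<Sum>k<m. Dx (w k) z))"
  proof (induction m)
    case (Suc m)
    have "(\<lambda>z. u z + (\<Sum>k<Suc m. w k z)) = (\<lambda>z. (u z + (\<Sum>k<m. w k z)) + w m z)"
      by (auto simp: add.assoc)
    then show ?case
      using tame_add_partials[OF tame_sum[of u w m, OF assms] assms(2)[of m]] Suc
      by (auto simp: add.assoc)
  qed simp
  then show "Dt (\<lambda>z. u z + (\<Sum>k<m. w k z)) = (\<lambda>z. Dt u z + (\<Sum>k<m. Dt (w k) z))"
    "Dx (\<lambda>z. u z + (\<Sum>k<m. w k z)) = (\<lambda>z. Dx u z + (\<Sum>k<m. Dx (w k) z))" by auto
qed

lemma partials_zero_outside: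
  fixes h :: "real \<times> real \<Rightarrow> real"
  assumes "closed K" "\<And>z. z \<notin> K \<Longrightarrow> h z = 0" "z \<notin> K"
  shows "Dt h z = 0" "Dx h z = 0"
proof -
  obtain t x where z: "z = (t, x)" by (cases z)
  have "open ((\<lambda>s. (s, x)) -` (- K))" "open ((\<lambda>y. (t, y)) -` (- K))"
    using assms(1) by (auto intro!: open_vimage continuous_intros)
  note op = this
  have "((\<lambda>s. h (s, x)) has_real_derivative 0) (at t)"
    by (rule has_field_derivative_transform_within_open[OF DERIV_const op(1)])
      (use assms(2,3) in \<open>simp_all add: z\<close>)
  moreover have "((\<lambda>y. h (t, y)) has_real_derivative 0) (at x)"
    by (rule has_field_derivative_transform_within_open[OF DERIV_const op(2)])
      (use assms(2,3) in \<open>simp_all add: z\<close>)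
  ultimately show "Dt h z = 0" "Dx h z = 0" by (auto simp: Dt_def Dx_def z DERIV_imp_deriv)
qed

lemma supported_in_partials:
  fixes h :: "real \<times> real \<Rightarrow> real"
  assumes "supported_in h X"
  shows "supported_in (Dt h) X" "supported_in (Dx h) X"
proof -
  obtain K where K: "compact K" "K \<subseteq> X" "\<And>z. z \<notin> K \<Longrightarrow> h z = 0"
    using assms by (auto simp: supported_in_def)
  note zero = partials_zero_outside[OF compact_imp_closed[OF K(1)] K(3)]
  show "supported_in (Dt h) X" "supported_in (Dx h) X"
    unfolding supported_in_def
    by (intro exI[of _ K] conjI K(1,2) allI impI zero; assumption)+
qed

lemma tame_test_function:
  assumes "tame u" "supported_in u X"
  shows "u \<in> test_functions X"
proof -
  obtain K where K: "compact K" "K \<subseteq> X" "\<And>z. z \<notin> K \<Longrightarrow> u z = 0"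
    using assms(2) by (auto simp: supported_in_def)
  have sub: "closure {z. u z \<noteq> 0} \<subseteq> K"
  proof (rule closure_minimal)
    show "{z. u z \<noteq> 0} \<subseteq> K" using K(3) by blast
  qed (rule compact_imp_closed[OF K(1)])
  then have "compact (closure {z. u z \<noteq> 0})"
    using K(1) by (metis bounded_subset closed_closure compact_eq_bounded_closed)
  with sub K(2) tame_Ck[OF assms(1)] show ?thesis unfolding test_functions_def by blast
qed

lemma test_functionD:
  assumes "\<phi> \<in> test_functions X"
  shows "\<phi> differentiable_on UNIV" "continuous_on UNIV \<phi>" "continuous_on UNIV (Dt \<phi>)"
    "continuous_on UNIV (Dx \<phi>)" "supported_in \<phi> X"
proof -
  have Ck: "Ck n \<phi>" for n using assms unfolding test_functions_def by blast
  from Ck[of 0] show "continuous_on UNIV \<phi>" by simp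
  from Ck[of "Suc 0"] show "\<phi> differentiable_on UNIV" "continuous_on UNIV (Dt \<phi>)" "continuous_on UNIV (Dx \<phi>)"
    by auto
  show "supported_in \<phi> X"
    unfolding supported_in_def
  proof (intro exI conjI allI impI)
    show "compact (closure {z. \<phi> z \<noteq> 0})" "closure {z. \<phi> z \<noteq> 0} \<subseteq> X"
      using assms unfolding test_functions_def by blast+
    show "\<phi> z = 0" if "z \<notin> closure {z. \<phi> z \<noteq> 0}" for z
      by (rule ccontr, rule notE[OF that], rule subsetD[OF closure_subset]) simp
  qed
qed

lemma supported_continuous_bounded:
  assumes "continuous_on UNIV f" "supported_in f X"
  obtains C where "0 < C" "\<And>z. \<bar>f z\<bar> \<le> C"
proof -
  obtain K where K: "compact K" "\<And>x. x \<notin> K \<Longrightarrow> f x = 0" using assms(2) by (auto simp: supported_in_def)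
  have "compact (f ` K)" by (intro compact_continuous_image K(1) continuous_on_subset[OF assms(1)]) auto
  then obtain M where M: "0 < M" "\<And>x. x \<in> K \<Longrightarrow> \<bar>f x\<bar> \<le> M"
    using bounded_pos[of "f ` K"] compact_imp_bounded by (auto simp: real_norm_def)
  have "\<bar>f x\<bar> \<le> M" for x
    by (cases "x \<in> K") (use M in \<open>simp_all add: K(2)\<close>)
  from that[OF M(1) this] show ?thesis .
qed

section \<open>Integration by parts and weak derivatives\<close>

lemma integrable_supported_continuous:
  fixes f :: "real \<times> real \<Rightarrow> real"
  assumes "continuous_on UNIV f" "supported_in f X"
  shows "integrable lborel f"
proof -
  obtain K where K: "compact K" "\<And>x. x \<notin> K \<Longrightarrow> f x = 0" using assms(2) by (auto simp: supported_in_def)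
  have "integrable lborel (\<lambda>x. indicator K x *\<^sub>R f x)"
    by (rule borel_integrable_compact[OF K(1)]) (use assms(1) continuous_on_subset in blast)
  moreover have "(\<lambda>x. indicator K x *\<^sub>R f x) = f"
  proof
    show "indicator K x *\<^sub>R f x = f x" for x by (cases "x \<in> K") (simp_all add: K(2))
  qed
  ultimately show ?thesis by simp
qed

lemma integral_deriv_eq_zero:
  fixes f :: "real \<Rightarrow> real"
  assumes "\<And>x. (f has_real_derivative f' x) (at x)" "continuous_on UNIV f'"
    and R: "\<And>x. R < \<bar>x\<bar> \<Longrightarrow> f x = 0"
  shows "(\<integral>x. f' x \<partial>lborel) = 0"
proof -
  define r where "r = \<bar>R\<bar> + 1"
  have zero: "f' x = 0" if "x \<notin> {-r..r}" for x
  proof -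
    have "deriv f x = 0"
      by (rule deriv_zero_outside[of "{-r..r}"]) (use that R in \<open>auto simp: r_def\<close>)
    then show ?thesis using DERIV_imp_deriv[OF assms(1)] by simp
  qed
  have "f' x = f' x * indicator {-r..r} x" for x
    by (cases "x \<in> {-r..r}") (simp_all only: zero indicator_simps mult_zero_left mult_1_right not_False_eq_True)
  then have "(\<integral>x. f' x \<partial>lborel) = (\<integral>x. f' x * indicator {-r..r} x \<partial>lborel)" by presburger
  also have "\<dots> = f r - f (- r)"
    by (rule integral_FTC_Icc_real)
      (use assms in \<open>auto simp: r_def continuous_on_eq_continuous_at\<close>)
  also have "\<dots> = 0" using R[of r] R[of "-r"] by (simp add: r_def)
  finally show ?thesis .
qed

text \<open>By Fubini, integrate first in the direction of the derivative: each slice is the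
  derivative of a function vanishing near infinity, so the inner integral is 0.\<close>

lemma integral_partials_eq_zero:
  assumes "h differentiable_on UNIV" "supported_in h X"
  shows "continuous_on UNIV (Dt h) \<Longrightarrow> (\<integral>z. Dt h z \<partial>lborel) = 0"
    and "continuous_on UNIV (Dx h) \<Longrightarrow> (\<integral>z. Dx h z \<partial>lborel) = 0"
proof -
  obtain K where K: "compact K" "\<And>z. z \<notin> K \<Longrightarrow> h z = 0" using assms(2) by (auto simp: supported_in_def)
  obtain R where R: "\<And>z. z \<in> K \<Longrightarrow> norm z \<le> R" using K(1) compact_imp_bounded bounded_iff by metis
  have far: "h (t, x) = 0" if "R < \<bar>t\<bar> \<or> R < \<bar>x\<bar>" for t x
  proof -
    have "R < norm (t, x)" using that norm_fst_le[of t x] norm_snd_le[of x t] by auto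
    then have "(t, x) \<notin> K" using R[of "(t, x)"] by linarith
    then show ?thesis by (rule K(2))
  qed
  have slice: "continuous_on UNIV (\<lambda>y. g (t, y))" "continuous_on UNIV (\<lambda>s. g (s, x))"
    if "continuous_on UNIV g" for g :: "real \<times> real \<Rightarrow> real" and t x
    by (rule continuous_on_compose2[OF that]; auto intro!: continuous_intros)+
  show "(\<integral>z. Dx h z \<partial>lborel) = 0" if c: "continuous_on UNIV (Dx h)"
  proof -
    have "integrable (lborel \<Otimes>\<^sub>M lborel) (Dx h)" unfolding lborel_prod
      by (rule integrable_supported_continuous[OF c supported_in_partials(2)[OF assms(2)]])
    moreover have "(\<integral>x. Dx h (t, x) \<partial>lborel) = 0" for t
      by (rule integral_deriv_eq_zero[where R = R, OF differentiable_slices(2)[OF assms(1)] slice(1)[OF c]])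
        (rule far, simp)
    ultimately show ?thesis
      using lborel_pair.integral_fst'[of "Dx h"] by (simp add: lborel_prod)
  qed
  show "(\<integral>z. Dt h z \<partial>lborel) = 0" if c: "continuous_on UNIV (Dt h)"
  proof -
    have "integrable (lborel \<Otimes>\<^sub>M lborel) (case_prod (\<lambda>t x. Dt h (t, x)))" unfolding lborel_prod
      using integrable_supported_continuous[OF c supported_in_partials(1)[OF assms(2)]] by simp
    moreover have "(\<integral>t. Dt h (t, x) \<partial>lborel) = 0" for x
      by (rule integral_deriv_eq_zero[where R = R, OF differentiable_slices(1)[OF assms(1)] slice(2)[OF c]])
        (rule far, simp)
    ultimately show ?thesis
      using lborel_pair.integral_snd[of "\<lambda>t x. Dt h (t, x)"] by (simp add: lborel_prod)
  qed
qed

text \<open>A bridge between the Lebesgue measure on \<Omega>, in which weak derivatives are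
  formulated, and Borel-Lebesgue measure on the whole plane, where Fubini and the fundamental
  theorem are applied.\<close>

lemma integral_lebesgue_on_supported:
  fixes f :: "real \<times> real \<Rightarrow> real"
  assumes "f \<in> borel_measurable borel" "supported_in f \<Omega>" "open \<Omega>"
  shows "(\<integral>z. f z \<partial>lebesgue_on \<Omega>) = (\<integral>z. f z \<partial>lborel)"
proof -
  have "(\<integral>z. f z \<partial>lebesgue_on \<Omega>) = (\<integral>z. indicator \<Omega> z *\<^sub>R f z \<partial>lebesgue)"
    by (rule integral_restrict_space) (use assms(3) in simp)
  also have "(\<lambda>z. indicator \<Omega> z *\<^sub>R f z) = f"
  proof
    show "indicator \<Omega> z *\<^sub>R f z = f z" for z
      by (cases "z \<in> \<Omega>") (simp_all add: supported_in_zero[OF assms(2)])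
  qed
  also have "integral\<^sup>L lebesgue f = integral\<^sup>L lborel f"
    by (rule integral_completion) (use assms(1) in simp)
  finally show ?thesis .
qed

lemma supported_in_mult:
  "supported_in g X \<Longrightarrow> supported_in (\<lambda>z. f z * g z) X"
  unfolding supported_in_def by (erule ex_forward) simp

text \<open>The product of u with a test function inherits the compact support, so the integrals of
  its partial derivatives vanish; the product rule splits them.\<close>

lemma integration_by_parts:
  assumes u: "tame u" and \<phi>: "\<phi> \<in> test_functions \<Omega>" and \<Omega>: "open \<Omega>"
  shows "(\<integral>z. u z * Dt \<phi> z \<partial>lebesgue_on \<Omega>) = - (\<integral>z. Dt u z * \<phi> z \<partial>lebesgue_on \<Omega>)"
    and "(\<integral>z. u z * Dx \<phi> z \<partial>lebesgue_on \<Omega>) = - (\<integral>z. Dx u z * \<phi> z \<partial>lebesgue_on \<Omega>)"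
proof -
  note \<phi>' = test_functionD[OF \<phi>] and du = tame_differentiable[OF u]
  note cu = tame_continuous_on[OF u] tame_continuous_on[OF tame_Dt[OF u]] tame_continuous_on[OF tame_Dx[OF u]]
  note sup = supported_in_mult[OF \<phi>'(5)] supported_in_mult[OF supported_in_partials(1)[OF \<phi>'(5)]]
    supported_in_mult[OF supported_in_partials(2)[OF \<phi>'(5)]]
  have conv: "(\<integral>z. f z \<partial>lebesgue_on \<Omega>) = (\<integral>z. f z \<partial>lborel)"
    if "continuous_on UNIV f" "supported_in f \<Omega>" for f
    by (rule integral_lebesgue_on_supported[OF borel_measurable_continuous_onI[OF that(1)] that(2) \<Omega>])
  have dh: "(\<lambda>z. u z * \<phi> z) differentiable_on UNIV"
    using du \<phi>'(1) by (rule differentiable_on_mult)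
  have Dt: "Dt (\<lambda>z. u z * \<phi> z) = (\<lambda>z. Dt u z * \<phi> z + u z * Dt \<phi> z)"
    by (rule Dt_eqI, rule DERIV_mult[OF differentiable_slices(1)[OF du]
          differentiable_slices(1)[OF \<phi>'(1)], THEN DERIV_cong]) (simp add: mult.commute)
  have Dx: "Dx (\<lambda>z. u z * \<phi> z) = (\<lambda>z. Dx u z * \<phi> z + u z * Dx \<phi> z)"
    by (rule Dx_eqI, rule DERIV_mult[OF differentiable_slices(2)[OF du]
          differentiable_slices(2)[OF \<phi>'(1)], THEN DERIV_cong]) (simp add: mult.commute)
  have c: "continuous_on UNIV (\<lambda>z. Dt u z * \<phi> z)" "continuous_on UNIV (\<lambda>z. u z * Dt \<phi> z)"
    "continuous_on UNIV (\<lambda>z. Dx u z * \<phi> z)" "continuous_on UNIV (\<lambda>z. u z * Dx \<phi> z)"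
    by (intro continuous_intros cu \<phi>')+
  have "0 = (\<integral>z. Dt u z * \<phi> z + u z * Dt \<phi> z \<partial>lborel)"
    using integral_partials_eq_zero(1)[OF dh sup(1)] c unfolding Dt by (simp add: continuous_on_add)
  also have "\<dots> = (\<integral>z. Dt u z * \<phi> z \<partial>lborel) + (\<integral>z. u z * Dt \<phi> z \<partial>lborel)"
    by (intro Bochner_Integration.integral_add integrable_supported_continuous[OF _ sup(1)]
        integrable_supported_continuous[OF _ sup(2)] c)
  finally show "(\<integral>z. u z * Dt \<phi> z \<partial>lebesgue_on \<Omega>) = - (\<integral>z. Dt u z * \<phi> z \<partial>lebesgue_on \<Omega>)"
    by (simp add: conv[OF c(1) sup(1)] conv[OF c(2) sup(2)])
  have "0 = (\<integral>z. Dx u z * \<phi> z + u z * Dx \<phi> z \<partial>lborel)"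
    using integral_partials_eq_zero(2)[OF dh sup(1)] c unfolding Dx by (simp add: continuous_on_add)
  also have "\<dots> = (\<integral>z. Dx u z * \<phi> z \<partial>lborel) + (\<integral>z. u z * Dx \<phi> z \<partial>lborel)"
    by (intro Bochner_Integration.integral_add integrable_supported_continuous[OF _ sup(1)]
        integrable_supported_continuous[OF _ sup(3)] c)
  finally show "(\<integral>z. u z * Dx \<phi> z \<partial>lebesgue_on \<Omega>) = - (\<integral>z. Dx u z * \<phi> z \<partial>lebesgue_on \<Omega>)"
    by (simp add: conv[OF c(3) sup(1)] conv[OF c(4) sup(3)])
qed

lemma integrable_imp_loc_integrable:
  assumes "integrable (lebesgue_on \<Omega>) f" "open \<Omega>"
  shows "loc_integrable \<Omega> f"
  unfolding loc_integrable_def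
proof (intro allI impI)
  fix K assume K: "compact K \<and> K \<subseteq> \<Omega>"
  then have KL: "K \<in> sets lebesgue" by (simp add: compact_imp_closed)
  have "set_integrable lebesgue \<Omega> f"
    using assms integrable_restrict_space[of \<Omega> lebesgue f] by (simp add: set_integrable_def)
  then have "set_integrable lebesgue K f"
    by (rule set_integrable_subset) (use K KL in auto)
  then show "integrable (lebesgue_on K) f"
    using integrable_restrict_space[of K lebesgue f] KL by (simp add: set_integrable_def)
qed

lemma integrable_lebesgue_on_bounded:
  fixes f :: "real \<times> real \<Rightarrow> real"
  assumes "f \<in> borel_measurable (lebesgue_on \<Omega>)" "\<Omega> \<in> lmeasurable" "\<And>z. z \<in> \<Omega> \<Longrightarrow> \<bar>f z\<bar> \<le> C"
  shows "integrable (lebesgue_on \<Omega>) f"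
proof -
  interpret finite_measure "lebesgue_on \<Omega>" by (rule finite_measure_lebesgue_on[OF assms(2)])
  show ?thesis by (rule integrable_const_bound[of _ C]) (use assms in \<open>auto intro!: AE_I2\<close>)
qed

lemma borel_measurable_lebesgue_on:
  fixes f :: "real \<times> real \<Rightarrow> real"
  shows "f \<in> borel_measurable borel \<Longrightarrow> f \<in> borel_measurable (lebesgue_on \<Omega>)"
  by (simp add: measurable_completion measurable_restrict_space1)

lemma tame_borel_measurable: "tame u \<Longrightarrow> u \<in> borel_measurable borel"
  by (rule borel_measurable_continuous_onI[OF tame_continuous_on])

lemma integrable_mult_bounded:
  fixes f :: "real \<times> real \<Rightarrow> real"
  assumes "integrable M f" "\<psi> \<in> borel_measurable M" "\<And>z. \<bar>\<psi> z\<bar> \<le> C"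
  shows "integrable M (\<lambda>z. f z * \<psi> z)"
proof (rule Bochner_Integration.integrable_bound)
  show "integrable M (\<lambda>z. f z * C)" using assms(1) by simp
  show "AE z in M. norm (f z * \<psi> z) \<le> norm (f z * C)"
    using assms(3) by (intro AE_I2) (auto simp: abs_mult intro!: mult_left_mono order_trans[OF assms(3)])
qed (use assms in auto)

lemma integral_mult_limit:
  fixes f :: "nat \<Rightarrow> real \<times> real \<Rightarrow> real"
  assumes "\<And>m. f m \<in> borel_measurable M" "g \<in> borel_measurable M" "integrable M w"
    and "AE z in M. (\<lambda>m. f m z) \<longlonglongrightarrow> g z" "\<And>m. AE z in M. \<bar>f m z\<bar> \<le> w z"
    and "\<psi> \<in> borel_measurable M" "\<And>z. \<bar>\<psi> z\<bar> \<le> C"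
  shows "(\<lambda>m. \<integral>z. f m z * \<psi> z \<partial>M) \<longlonglongrightarrow> (\<integral>z. g z * \<psi> z \<partial>M)"
proof (rule integral_dominated_convergence)
  show "integrable M (\<lambda>z. w z * C)" using assms(3) by simp
  show "AE z in M. (\<lambda>m. f m z * \<psi> z) \<longlonglongrightarrow> g z * \<psi> z"
    using assms(4) by eventually_elim (auto intro: tendsto_intros)
  show "AE z in M. norm (f m z * \<psi> z) \<le> w z * C" for m
    using assms(5)[of m] by eventually_elim (auto simp: abs_mult intro!: mult_mono assms(7))
qed (use assms in auto)

section \<open>One step of the staircase\<close>

text \<open>The last two inequalities are the ellipticity of s / r. The others record that a point
  which leaves the construction at level l keeps values comparable to l, the source of all size
  estimates.\<close>

definition in_wedge :: "real \<Rightarrow> real \<Rightarrow> real \<Rightarrow> real \<Rightarrow> bool" where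
  "in_wedge \<kappa> l s r \<longleftrightarrow> \<kappa> * l \<le> s \<and> s \<le> l + 2 \<and> \<kappa> * l \<le> r \<and> r \<le> l + 2 \<and> \<kappa> * r \<le> s \<and> \<kappa> * s \<le> r"

text \<open>A step passes from values \<open>(l, l)\<close> on \<open>fst S \<times> snd S\<close> to \<open>(l + 1, l + 1)\<close> on \<open>fst S' \<times> snd S'\<close>. The
  number \<open>b\<close> is the fraction kept by each of the two oscillations.\<close>

definition stair_step ::
  "real \<Rightarrow> real \<Rightarrow> real \<Rightarrow> real \<Rightarrow> real set \<times> real set \<Rightarrow> (real \<times> real \<Rightarrow> real) \<Rightarrow> real set \<times> real set \<Rightarrow> bool"
  where
  "stair_step \<kappa> l b \<epsilon> S W S' \<longleftrightarrow>
    interval_union (fst S') \<and> interval_union (snd S') \<and> fst S' \<subseteq> fst S \<and> snd S' \<subseteq> snd S \<and>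
    tame W \<and> supported_in W (fst S \<times> snd S) \<and> (\<forall>z. \<bar>W z\<bar> \<le> \<epsilon>) \<and> (\<forall>z. \<bar>Dx W z\<bar> \<le> \<epsilon>) \<and>
    (\<forall>z. in_wedge \<kappa> l (l + Dt W z) (l + Dx (Dx W) z)) \<and>
    (\<forall>z\<in>fst S' \<times> snd S'. Dt W z = 1 \<and> Dx (Dx W) z = 1) \<and>
    (\<exists>\<theta>. (1 - \<epsilon>) * b\<^sup>2 \<le> \<theta> \<and> \<theta> \<le> b\<^sup>2 \<and>
       measure lborel (fst S') * measure lborel (snd S')
         = \<theta> * (measure lborel (fst S) * measure lborel (snd S)))"

lemma supported_in_tensor:
  fixes f g :: "real \<Rightarrow> real"
  assumes "supported_in f T" "supported_in g X"
  shows "supported_in (\<lambda>z. f (fst z) * g (snd z)) (T \<times> X)"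
proof -
  obtain K where K: "compact K" "K \<subseteq> T" "\<And>x. x \<notin> K \<Longrightarrow> f x = 0"
    using assms(1) unfolding supported_in_def by blast
  obtain L where L: "compact L" "L \<subseteq> X" "\<And>x. x \<notin> L \<Longrightarrow> g x = 0"
    using assms(2) unfolding supported_in_def by blast
  show ?thesis unfolding supported_in_def
  proof (intro exI conjI allI impI)
    show "compact (K \<times> L)" "K \<times> L \<subseteq> T \<times> X" using K L by (auto intro: compact_Times)
    fix z assume "z \<notin> K \<times> L"
    then have "fst z \<notin> K \<or> snd z \<notin> L" by (simp add: mem_Times_iff)
    then show "f (fst z) * g (snd z) = 0" using K(3) L(3) mult_eq_0_iff by blast
  qed
qed

lemma supported_in_add:
  fixes f g :: "'a::t2_space \<Rightarrow> real"
  assumes "supported_in f X" "supported_in g X"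
  shows "supported_in (\<lambda>z. f z + g z) X"
proof -
  obtain K where K: "compact K" "K \<subseteq> X" "\<And>x. x \<notin> K \<Longrightarrow> f x = 0"
    using assms(1) unfolding supported_in_def by blast
  obtain L where L: "compact L" "L \<subseteq> X" "\<And>x. x \<notin> L \<Longrightarrow> g x = 0"
    using assms(2) unfolding supported_in_def by blast
  show ?thesis unfolding supported_in_def
  proof (intro exI conjI allI impI)
    show "compact (K \<union> L)" "K \<union> L \<subseteq> X" using K L by (auto intro: compact_Un)
    fix z assume "z \<notin> K \<union> L"
    then have "f z = 0" "g z = 0" using K(3) L(3) by blast+
    then show "f z + g z = 0" by simp
  qed
qed

lemma deriv_const_on_open:
  assumes "open S" "\<And>x. x \<in> S \<Longrightarrow> f x = c" "x \<in> S"
  shows "deriv f x = (0::real)"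
proof -
  have "(f has_real_derivative 0) (at x)"
    by (rule has_field_derivative_transform_within_open[OF DERIV_const assms(1,3)])
      (simp add: assms(2))
  then show ?thesis by (rule DERIV_imp_deriv)
qed

lemma abs_mult_le:
  fixes a b :: real
  assumes "\<bar>a\<bar> \<le> A" "\<bar>b\<bar> \<le> B"
  shows "\<bar>a * b\<bar> \<le> A * B"
  unfolding abs_mult using assms by (intro mult_mono) auto

text \<open>The interval [-B, 1] contains 0, hence is stable under multiplication by cutoff values
  in [0, 1].\<close>

lemma mult_unit_interval:
  fixes c x :: real
  assumes "0 \<le> c" "c \<le> 1" "- B \<le> x" "x \<le> 1" "0 \<le> B"
  shows "- B \<le> c * x \<and> c * x \<le> 1"
proof -
  have "c * x \<le> c * 1" by (rule mult_left_mono[OF assms(4,1)])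
  moreover have "c * (- B) \<le> c * x" by (rule mult_left_mono[OF assms(3,1)])
  moreover have "c * B \<le> 1 * B" using assms by (intro mult_right_mono) auto
  ultimately show ?thesis using assms by simp
qed

text \<open>The oscillations stop at \<open>l - B = \<kappa> l + 2\<close> rather than at \<open>\<kappa> l\<close>: the margin 2 absorbs the error \<open>e\<close>
  made in the other variable.\<close>

lemma in_wedge_oscillation:
  assumes "0 < \<kappa>" "\<kappa> < 1" "0 < B" "(1 - \<kappa>) * l = B + 2" "- B \<le> d" "d \<le> 1" "\<bar>e\<bar> \<le> 1 / 2"
  shows "in_wedge \<kappa> l (l + e) (l + d)" and "in_wedge \<kappa> l (l + d) (l + (1 + e))"
proof -
  have l: "\<kappa> * l = l - B - 2" using assms(4) by (simp add: algebra_simps)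
  have k: "\<kappa> * (l + e) \<le> \<kappa> * l + 1 / 2" "\<kappa> * (l + d) \<le> \<kappa> * l + 1"
    "\<kappa> * (l + (1 + e)) \<le> \<kappa> * l + 2"
  proof -
    have "e \<le> 1 / 2" using assms(7) by linarith
    then have "\<kappa> * e \<le> \<kappa> * (1 / 2)" "\<kappa> * d \<le> \<kappa> * 1"
      using assms(1,6) by (simp_all only: mult_le_cancel_left_pos)
    then have "\<kappa> * e \<le> 1 / 2" "\<kappa> * d \<le> 1" using assms(2) by linarith+
    then show "\<kappa> * (l + e) \<le> \<kappa> * l + 1 / 2" "\<kappa> * (l + d) \<le> \<kappa> * l + 1"
      "\<kappa> * (l + (1 + e)) \<le> \<kappa> * l + 2"
      using assms(2) unfolding distrib_left by linarith+
  qed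
  have e: "- (1 / 2) \<le> e" "e \<le> 1 / 2" using assms(7) by linarith+
  show "in_wedge \<kappa> l (l + e) (l + d)" "in_wedge \<kappa> l (l + d) (l + (1 + e))"
    unfolding in_wedge_def using k l e assms(3,5,6) by (intro conjI; linarith)+
qed

text \<open>The correction is W = h(t) \<xi>(x) + \<omega>'(t) \<rho>(x). The first term moves u_xx
  by h \<xi>'' and disturbs u_t by h' \<xi>. The second is supported where h = 1 and \<xi>'' = 1
  already hold; it moves u_t by \<omega>'' \<rho> and disturbs u_xx by \<omega>' \<rho>''. Writing
  the time factor as a derivative lets both oscillations come from
  \<open>oscillation_profile\<close>, which makes \<omega>' small while \<omega>'' oscillates
  between -B and 1.\<close>

lemma stair_step_exists:
  assumes \<kappa>: "0 < \<kappa>" "\<kappa> < 1" and B: "0 < B" "(1 - \<kappa>) * l = B + 2" and \<epsilon>: "0 < \<epsilon>" "\<epsilon> < 1"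
    and T: "interval_union T" and X: "interval_union X"
  obtains W S' where "stair_step \<kappa> l (B / (1 + B)) \<epsilon> (T, X) W S'"
proof -
  \<comment> \<open>Measure is lost four times, in two cutoffs and two oscillations, and (1 -
    \<epsilon> / 4)^4 \<ge> 1 - \<epsilon> by Bernoulli's inequality.\<close>
  define \<eta> where "\<eta> = \<epsilon> / 4"
  have \<eta>: "0 < \<eta>" "\<eta> < 1" using \<epsilon> by (auto simp: \<eta>_def)
  obtain h T1 where h: "smooth h" "supported_in h T" "\<And>t. 0 \<le> h t" "\<And>t. h t \<le> 1"
    and T1: "interval_union T1" "T1 \<subseteq> T" "\<And>t. t \<in> T1 \<Longrightarrow> h t = 1"
    "measure lborel T1 = (1 - \<eta>) * measure lborel T"
    by (rule cutoff_profile[OF T \<eta>]) blast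
  obtain M where M: "0 < M" "\<And>t. \<bar>deriv h t\<bar> \<le> M"
    by (rule smooth_supported_bounded[OF smooth_deriv[OF h(1)] supported_in_deriv[OF h(2)]]) blast
  \<comment> \<open>Fixed after h: \<xi>, \<xi>' and the error h' \<xi> in u_t all stay below
    \<epsilon> / 2.\<close>
  define \<delta>1 where "\<delta>1 = \<epsilon> / (2 * (1 + M))"
  have \<delta>1: "0 < \<delta>1" "\<delta>1 * (1 + M) = \<epsilon> / 2" using M(1) \<epsilon> by (auto simp: \<delta>1_def field_simps)
  obtain \<xi> X1 c1 where \<xi>: "smooth \<xi>" "supported_in \<xi> X" "\<And>x. \<bar>\<xi> x\<bar> \<le> \<delta>1" "\<And>x. \<bar>deriv \<xi> x\<bar> \<le> \<delta>1"
      "\<And>x. - B \<le> deriv (deriv \<xi>) x" "\<And>x. deriv (deriv \<xi>) x \<le> 1"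
    and X1: "interval_union X1" "X1 \<subseteq> X" "\<And>x. x \<in> X1 \<Longrightarrow> deriv (deriv \<xi>) x = 1"
      "measure lborel X1 = c1 * measure lborel X"
      "(1 - \<eta>) * (B / (1 + B)) \<le> c1" "c1 \<le> B / (1 + B)"
    by (rule oscillation_profile[OF X B(1) \<eta> \<delta>1(1)]) blast
  obtain \<rho> X' where \<rho>: "smooth \<rho>" "supported_in \<rho> X1" "\<And>x. 0 \<le> \<rho> x" "\<And>x. \<rho> x \<le> 1"
    and X': "interval_union X'" "X' \<subseteq> X1" "\<And>x. x \<in> X' \<Longrightarrow> \<rho> x = 1"
    "measure lborel X' = (1 - \<eta>) * measure lborel X1"
    by (rule cutoff_profile[OF X1(1) \<eta>]) blast
  note \<rho>' = smooth_deriv[OF \<rho>(1)] supported_in_deriv[OF \<rho>(2)]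
  obtain M1 where M1: "0 < M1" "\<And>x. \<bar>deriv \<rho> x\<bar> \<le> M1"
    by (rule smooth_supported_bounded[OF \<rho>']) blast
  obtain M2 where M2: "0 < M2" "\<And>x. \<bar>deriv (deriv \<rho>) x\<bar> \<le> M2"
    by (rule smooth_supported_bounded[OF smooth_deriv[OF \<rho>'(1)] supported_in_deriv[OF \<rho>'(2)]]) blast
  \<comment> \<open>Fixed after \<rho>: the summands 1, \<open>M1\<close> and \<open>M2\<close>
    bring the contributions of \<omega>' to W, to W_x and to the error in u_xx below \<epsilon> /
    2.\<close>
  define \<delta>2 where "\<delta>2 = \<epsilon> / (2 * (1 + M1 + M2))"
  have \<delta>2: "0 < \<delta>2" "\<delta>2 * (1 + M1 + M2) = \<epsilon> / 2"
    using M1(1) M2(1) \<epsilon> by (auto simp: \<delta>2_def field_simps)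
  obtain \<omega> T' c2 where \<omega>: "smooth \<omega>" "supported_in \<omega> T1" "\<And>t. \<bar>\<omega> t\<bar> \<le> \<delta>2" "\<And>t. \<bar>deriv \<omega> t\<bar> \<le> \<delta>2"
      "\<And>t. - B \<le> deriv (deriv \<omega>) t" "\<And>t. deriv (deriv \<omega>) t \<le> 1"
    and T': "interval_union T'" "T' \<subseteq> T1" "\<And>t. t \<in> T' \<Longrightarrow> deriv (deriv \<omega>) t = 1"
      "measure lborel T' = c2 * measure lborel T1"
      "(1 - \<eta>) * (B / (1 + B)) \<le> c2" "c2 \<le> B / (1 + B)"
    by (rule oscillation_profile[OF T1(1) B(1) \<eta> \<delta>2(1)]) blast
  define \<zeta> where "\<zeta> = deriv \<omega>"
  have \<zeta>: "smooth \<zeta>" "supported_in \<zeta> T1" unfolding \<zeta>_def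
    by (rule smooth_deriv[OF \<omega>(1)] supported_in_deriv[OF \<omega>(2)])+
  define W where "W z = h (fst z) * \<xi> (snd z) + \<zeta> (fst z) * \<rho> (snd z)" for z :: "real \<times> real"
  have W: "tame W" unfolding W_def
    by (intro tame.add tame.tensor h \<xi> \<zeta> \<rho>)
  have DtW: "Dt W = (\<lambda>z. deriv h (fst z) * \<xi> (snd z) + deriv \<zeta> (fst z) * \<rho> (snd z))"
    unfolding W_def
    by (simp add: tame_add_partials tame.tensor h(1) \<xi>(1) \<zeta>(1) \<rho>(1) Dt_tensor)
  have DxW: "Dx W = (\<lambda>z. h (fst z) * deriv \<xi> (snd z) + \<zeta> (fst z) * deriv \<rho> (snd z))"
    unfolding W_def
    by (simp add: tame_add_partials tame.tensor h(1) \<xi>(1) \<zeta>(1) \<rho>(1) Dx_tensor)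
  have DxxW: "Dx (Dx W) = (\<lambda>z. h (fst z) * deriv (deriv \<xi>) (snd z) + \<zeta> (fst z) * deriv (deriv \<rho>) (snd z))"
    unfolding DxW
    by (simp add: tame_add_partials tame.tensor smooth_deriv h(1) \<xi>(1) \<zeta>(1) \<rho>(1) Dx_tensor)
  have h_abs: "\<bar>h t\<bar> \<le> 1" for t using h(3,4)[of t] by simp
  have \<rho>_abs: "\<bar>\<rho> x\<bar> \<le> 1" for x using \<rho>(3,4)[of x] by simp
  have \<delta>: "\<delta>1 \<le> \<epsilon> / 2" "M * \<delta>1 \<le> \<epsilon> / 2" "\<delta>2 \<le> \<epsilon> / 2" "\<delta>2 * M1 \<le> \<epsilon> / 2" "\<delta>2 * M2 \<le> \<epsilon> / 2"
  proof -
    have "0 < M * \<delta>1" "0 < \<delta>2 * M1" "0 < \<delta>2 * M2" using M(1) M1(1) M2(1) \<delta>1(1) \<delta>2(1) by auto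
    then show "\<delta>1 \<le> \<epsilon> / 2" "M * \<delta>1 \<le> \<epsilon> / 2" "\<delta>2 \<le> \<epsilon> / 2" "\<delta>2 * M1 \<le> \<epsilon> / 2" "\<delta>2 * M2 \<le> \<epsilon> / 2"
      using \<delta>1 \<delta>2 by (simp_all add: distrib_left distrib_right mult.commute)
  qed
  have small: "\<bar>W z\<bar> \<le> \<epsilon>" "\<bar>Dx W z\<bar> \<le> \<epsilon>" for z
  proof -
    have "\<bar>h (fst z) * \<xi> (snd z)\<bar> \<le> 1 * \<delta>1" "\<bar>\<zeta> (fst z) * \<rho> (snd z)\<bar> \<le> \<delta>2 * 1"
      "\<bar>h (fst z) * deriv \<xi> (snd z)\<bar> \<le> 1 * \<delta>1" "\<bar>\<zeta> (fst z) * deriv \<rho> (snd z)\<bar> \<le> \<delta>2 * M1"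
      unfolding \<zeta>_def by (intro abs_mult_le h_abs \<rho>_abs \<xi> \<omega> M1)+
    then show "\<bar>W z\<bar> \<le> \<epsilon>" "\<bar>Dx W z\<bar> \<le> \<epsilon>" unfolding W_def DxW using \<delta> by linarith+
  qed
  have inside: "Dt W z = deriv \<zeta> (fst z) * \<rho> (snd z)" "Dx (Dx W) z = 1 + \<zeta> (fst z) * deriv (deriv \<rho>) (snd z)"
    if z: "z \<in> T1 \<times> X1" for z
  proof -
    have "fst z \<in> T1" "snd z \<in> X1" using z by auto
    moreover have "deriv h (fst z) = 0"
      by (rule deriv_const_on_open[OF interval_union_open[OF T1(1)]], erule T1(3)) fact
    ultimately show "Dt W z = deriv \<zeta> (fst z) * \<rho> (snd z)"
      "Dx (Dx W) z = 1 + \<zeta> (fst z) * deriv (deriv \<rho>) (snd z)"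
      by (simp_all add: DtW DxxW T1(3) X1(3))
  qed
  \<comment> \<open>On \<open>T1 \<times> X1\<close> the pair is (l + \<omega>'' \<rho>, l + 1 +
    error), elsewhere it is (l + error, l + h \<xi>''). These are the two conclusions of
    \<open>in_wedge_oscillation\<close>.\<close>
  have wedge: "in_wedge \<kappa> l (l + Dt W z) (l + Dx (Dx W) z)" for z
  proof (cases "z \<in> T1 \<times> X1")
    case True
    have "- B \<le> \<rho> (snd z) * deriv \<zeta> (fst z) \<and> \<rho> (snd z) * deriv \<zeta> (fst z) \<le> 1"
      unfolding \<zeta>_def by (rule mult_unit_interval) (use \<rho> \<omega> B in auto)
    moreover have "\<bar>\<zeta> (fst z) * deriv (deriv \<rho>) (snd z)\<bar> \<le> \<delta>2 * M2"
      unfolding \<zeta>_def by (intro abs_mult_le \<omega> M2)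
    ultimately show ?thesis unfolding inside[OF True]
      using \<delta> \<epsilon> by (intro in_wedge_oscillation[OF \<kappa> B]) (auto simp: mult.commute)
  next
    case False
    have "\<zeta> (fst z) = 0 \<and> deriv \<zeta> (fst z) = 0 \<or> \<rho> (snd z) = 0 \<and> deriv (deriv \<rho>) (snd z) = 0"
    proof (cases "fst z \<in> T1")
      case True
      then have "snd z \<notin> X1" using False by (simp add: mem_Times_iff)
      then show ?thesis
        using supported_in_zero[OF \<rho>(2)] supported_in_zero[OF supported_in_deriv[OF \<rho>'(2)]] by simp
    next
      case False
      then show ?thesis
        using supported_in_zero[OF \<zeta>(2)] supported_in_zero[OF supported_in_deriv[OF \<zeta>(2)]] by simp
    qed
    then have "Dt W z = deriv h (fst z) * \<xi> (snd z)" "Dx (Dx W) z = h (fst z) * deriv (deriv \<xi>) (snd z)"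
      by (auto simp: DtW DxxW)
    moreover have "- B \<le> h (fst z) * deriv (deriv \<xi>) (snd z) \<and> h (fst z) * deriv (deriv \<xi>) (snd z) \<le> 1"
      by (rule mult_unit_interval) (use h \<xi> B in auto)
    moreover have "\<bar>deriv h (fst z) * \<xi> (snd z)\<bar> \<le> M * \<delta>1"
      by (intro abs_mult_le \<xi> M)
    ultimately show ?thesis
      using \<delta> \<epsilon> by (simp only:) (intro in_wedge_oscillation[OF \<kappa> B]; linarith)
  qed
  have top: "Dt W z = 1 \<and> Dx (Dx W) z = 1" if "z \<in> T' \<times> X'" for z
  proof -
    have z: "fst z \<in> T'" "snd z \<in> X'" using that by auto
    have "deriv \<rho> x = 0" if "x \<in> X'" for x
      by (rule deriv_const_on_open[OF interval_union_open[OF X'(1)] X'(3) that])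
    then have "deriv (deriv \<rho>) (snd z) = 0"
      by (rule deriv_const_on_open[OF interval_union_open[OF X'(1)] _ z(2)])
    moreover have "z \<in> T1 \<times> X1" using z T'(2) X'(2) by (auto simp: mem_Times_iff)
    ultimately show ?thesis using inside[of z] z T'(3) X'(3) by (simp add: \<zeta>_def)
  qed
  have supp: "supported_in W (T \<times> X)" unfolding W_def
    by (intro supported_in_add supported_in_tensor h \<xi> supported_in_mono[OF \<zeta>(2) T1(2)]
        supported_in_mono[OF \<rho>(2) X1(2)])
  define b where "b = B / (1 + B)"
  have b: "0 \<le> b" using B(1) by (simp add: b_def)
  define \<theta> where "\<theta> = (1 - \<eta>)\<^sup>2 * (c1 * c2)"
  have "\<theta> \<le> 1 * (b * b)" unfolding \<theta>_def
  proof (intro mult_mono)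
    show "(1 - \<eta>)\<^sup>2 \<le> 1" using \<eta> by (intro power_le_one) auto
    have "0 \<le> (1 - \<eta>) * b" using \<eta> b by simp
    then have c: "0 \<le> c1" "0 \<le> c2" using X1(5) T'(5) unfolding b_def[symmetric] by linarith+
    then show "0 \<le> c2" "0 \<le> c1 * c2" by simp_all
    show "c1 \<le> b" "c2 \<le> b" using X1(6) T'(6) unfolding b_def .
  qed (use b in auto)
  then have \<theta>_le: "\<theta> \<le> b\<^sup>2" by (simp add: power2_eq_square)
  have "1 - \<epsilon> \<le> (1 - \<eta>) ^ 4"
    using Bernoulli_inequality[of "- \<eta>" 4] \<eta> by (simp add: \<eta>_def)
  then have "(1 - \<epsilon>) * b\<^sup>2 \<le> (1 - \<eta>) ^ 4 * b\<^sup>2" by (intro mult_right_mono) auto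
  also have "\<dots> = (1 - \<eta>)\<^sup>2 * (((1 - \<eta>) * b) * ((1 - \<eta>) * b))"
    by (simp add: power2_eq_square power4_eq_xxxx)
  also have "\<dots> \<le> \<theta>" unfolding \<theta>_def
    using X1(5) T'(5) b \<eta> unfolding b_def[symmetric]
    by (intro mult_left_mono mult_mono) (auto intro: order_trans[rotated])
  finally have \<theta>_ge: "(1 - \<epsilon>) * b\<^sup>2 \<le> \<theta>" .
  have "measure lborel T' * measure lborel X' = \<theta> * (measure lborel T * measure lborel X)"
    by (simp add: T'(4) X'(4) T1(4) X1(4) \<theta>_def power2_eq_square)
  then have "stair_step \<kappa> l b \<epsilon> (T, X) W (T', X')"
    unfolding stair_step_def fst_conv snd_conv
    using T'(1) X'(1) W supp small wedge top \<theta>_le \<theta>_ge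
      order_trans[OF T'(2) T1(2)] order_trans[OF X'(2) X1(2)] by blast
  then show ?thesis using that unfolding b_def by blast
qed

section \<open>The infinite staircase\<close>

text \<open>The accuracy \<open>(1 / 2) ^ (k + 2)\<close> serves twice: it makes the corrections and
  their x-derivatives summable, and it keeps the product of the losses of measure away from
  0.\<close>

lemma staircase_exists:
  fixes \<kappa> p :: real
  assumes \<kappa>: "0 < \<kappa>" "\<kappa> < 1" and p: "p = 2 / (1 - \<kappa>)"
    and T: "interval_union T0" and X: "interval_union X0"
  obtains S W where "S 0 = (T0, X0)"
    "\<And>k. stair_step \<kappa> (real (Suc k) + p) (real (Suc k) / (real (Suc k) + p / 2)) ((1 / 2) ^ (k + 2))
       (S k) (W k) (S (Suc k))"
proof -
  let ?P = "\<lambda>k. stair_step \<kappa> (real (Suc k) + p) (real (Suc k) / (real (Suc k) + p / 2)) ((1 / 2) ^ (k + 2))"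
  let ?Q = "\<lambda>S. interval_union (fst S) \<and> interval_union (snd S)"
  have step: "\<exists>S'. ?Q S' \<and> (\<exists>W. ?P k S W S')" if Q: "?Q S" for S k
  proof -
    define B where "B = (1 - \<kappa>) * real (Suc k)"
    have B: "0 < B" using \<kappa> by (simp add: B_def)
    \<comment> \<open>\<open>(1 - \<kappa>) p = 2\<close> turns the margin 2 in \<open>B = (1 - \<kappa>) l - 2\<close> into the shift by \<open>p\<close> of \<open>l\<close>.\<close>
    have kp: "(1 - \<kappa>) * p = 2" using \<kappa> by (simp add: p field_simps)
    have l: "(1 - \<kappa>) * (real (Suc k) + p) = B + 2" unfolding distrib_left kp B_def ..
    have "1 + B = (1 - \<kappa>) * (real (Suc k) + p / 2)" unfolding distrib_left B_def using kp by simp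
    then have b: "B / (1 + B) = real (Suc k) / (real (Suc k) + p / 2)"
      using \<kappa> by (simp only: B_def) simp
    have "(1 / 2 :: real) ^ (k + 2) < 1" by (rule power_less_one_iff[THEN iffD2]) auto
    then obtain W S' where "?P k (fst S, snd S) W S'"
      using stair_step_exists[OF \<kappa> B l, of "(1 / 2) ^ (k + 2)" "fst S" "snd S"] Q
      unfolding b by auto
    then show ?thesis unfolding stair_step_def by auto
  qed
  have "\<exists>f. \<forall>n. (?Q (f n) \<and> (n = 0 \<longrightarrow> f n = (T0, X0))) \<and> (\<exists>W. ?P n (f n) W (f (Suc n)))"
  proof (rule dependent_nat_choice)
    show "\<exists>x. ?Q x \<and> (0 = (0::nat) \<longrightarrow> x = (T0, X0))" using T X by auto
    show "\<exists>y. (?Q y \<and> (Suc n = 0 \<longrightarrow> y = (T0, X0))) \<and> (\<exists>W. ?P n x W y)"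
      if "?Q x \<and> (n = 0 \<longrightarrow> x = (T0, X0))" for x n
      using step[of x n] that by auto
  qed
  then obtain f where f: "f 0 = (T0, X0)" "\<And>n. \<exists>W. ?P n (f n) W (f (Suc n))" by auto
  then obtain W where "\<And>n. ?P n (f n) (W n) (f (Suc n))" by metis
  with f(1) that show ?thesis by blast
qed

section \<open>Polynomial decay of the measures of the good sets\<close>

lemma Bernoulli_powr:
  fixes x q :: real
  assumes "0 \<le> x" "1 \<le> q"
  shows "1 + q * x \<le> (1 + x) powr q"
proof -
  have "(1 + 0) powr q - q * 0 \<le> (1 + x) powr q - q * x"
  proof (rule DERIV_nonneg_imp_nondecreasing[OF assms(1)])
    fix u :: real assume u: "0 \<le> u" "u \<le> x"
    have "((\<lambda>u. 1 + u) has_real_derivative 1) (at u)" by (auto intro!: derivative_eq_intros)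
    from DERIV_fun_powr[OF this, of q] u
    have "((\<lambda>u. (1 + u) powr q - q * u) has_real_derivative q * (1 + u) powr (q - 1) - q) (at u)"
      by (auto intro!: derivative_eq_intros)
    moreover have "q * 1 \<le> q * (1 + u) powr (q - 1)"
      using u assms(2) by (intro mult_left_mono ge_one_powr_ge_zero) auto
    ultimately show "\<exists>y. ((\<lambda>u. (1 + u) powr q - q * u) has_real_derivative y) (at u) \<and> 0 \<le> y"
      by (intro exI[of _ "q * (1 + u) powr (q - 1) - q"]) simp
  qed
  then show ?thesis by simp
qed

text \<open>Both bounds have the form of a quotient of consecutive terms, so products over
  \<open>y = 1, 2, \<dots>\<close> telescope.\<close>

lemma powr_ratio_bounds:
  fixes y q :: real
  assumes y: "0 < y" and q: "1 \<le> q"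
  shows "(y / (y + 1)) powr q \<le> y / (y + q)" and "y / (y + q) \<le> ((y + q) / (y + q + 1)) powr q"
proof -
  have "1 + q * (1 / y) \<le> (1 + 1 / y) powr q"
    using y q by (intro Bernoulli_powr) auto
  then have "1 / (1 + 1 / y) powr q \<le> 1 / (1 + q * (1 / y))"
  proof (intro divide_left_mono mult_pos_pos)
    have "0 < 1 + 1 / y" "0 < 1 + q * (1 / y)" using y q by (simp_all add: add_pos_pos)
    then show "0 < (1 + 1 / y) powr q" "0 < 1 + q * (1 / y)" by simp_all
  qed auto
  also have "1 / (1 + q * (1 / y)) = y / (y + q)" using y q by (simp add: field_simps)
  also have "1 / (1 + 1 / y) powr q = (1 / (1 + 1 / y)) powr q"
    using y by (subst powr_divide) auto
  also have "1 / (1 + 1 / y) = y / (y + 1)" using y by (simp add: field_simps)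
  finally show "(y / (y + 1)) powr q \<le> y / (y + q)" .
  have yq: "0 < y + q" using y q by simp
  have "1 - q / (y + q) \<le> exp (- (q / (y + q)))"
    using exp_ge_add_one_self[of "- (q / (y + q))"] by simp
  moreover have "1 - q / (y + q) = y / (y + q)" using yq by (simp add: field_simps)
  moreover have "exp (- (q / (y + q))) \<le> ((y + q) / (y + q + 1)) powr q"
  proof -
    have "ln ((y + q + 1) / (y + q)) \<le> (y + q + 1) / (y + q) - 1"
      using yq by (intro ln_le_minus_one) simp
    also have "\<dots> = 1 / (y + q)" using yq by (simp add: field_simps)
    finally have "- (1 / (y + q)) \<le> ln ((y + q) / (y + q + 1))"
      using yq by (simp add: ln_div)
    then have "q * (- (1 / (y + q))) \<le> q * ln ((y + q) / (y + q + 1))"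
      using q by (intro mult_left_mono) auto
    then show ?thesis using yq by (simp add: powr_def)
  qed
  ultimately show "y / (y + q) \<le> ((y + q) / (y + q + 1)) powr q" by linarith
qed

text \<open>Two inductions compare m with powers that decay at the rates of
  \<open>powr_ratio_bounds\<close>. The upper comparison uses the power shifted by q = p / 2; the
  lower one carries a prefactor that falls towards 1/2 and pays for the losses 1 - 2^-(k+2).\<close>

lemma staircase_mass:
  fixes m :: "nat \<Rightarrow> real" and p :: real
  assumes m0: "0 < m 0" and p: "2 \<le> p"
    and step: "\<And>k. \<exists>\<theta>. (1 - (1 / 2) ^ (k + 2)) * (real (Suc k) / (real (Suc k) + p / 2))\<^sup>2 \<le> \<theta>
      \<and> \<theta> \<le> (real (Suc k) / (real (Suc k) + p / 2))\<^sup>2 \<and> m (Suc k) = \<theta> * m k"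
  obtains c N where "0 < c" "0 < N"
    "\<And>k. c * real (Suc k) powr - p \<le> m k" "\<And>k. m k \<le> N * real (Suc k) powr - p"
proof -
  define q where "q = p / 2"
  have q: "1 \<le> q" using p by (simp add: q_def)
  define b where "b k = real (Suc k) / (real (Suc k) + q)" for k :: nat
  have b0: "0 \<le> b k" for k using q by (simp add: b_def)
  have sq: "(x powr q)\<^sup>2 = x powr p" for x :: real
    by (simp add: q_def power2_eq_square flip: powr_add)
  have b_lower: "(real (Suc k) / real (Suc (Suc k))) powr p \<le> (b k)\<^sup>2" for k
  proof -
    have "(real (Suc k) / (real (Suc k) + 1)) powr q \<le> b k"
      unfolding b_def by (rule powr_ratio_bounds(1)) (use q in auto)
    then have "((real (Suc k) / (real (Suc k) + 1)) powr q)\<^sup>2 \<le> (b k)\<^sup>2" by (intro power_mono) auto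
    then show ?thesis unfolding sq by (simp add: add.commute)
  qed
  have b_upper: "(b k)\<^sup>2 \<le> ((real (Suc k) + q) / (real (Suc (Suc k)) + q)) powr p" for k
  proof -
    have "b k \<le> ((real (Suc k) + q) / (real (Suc k) + q + 1)) powr q"
      unfolding b_def by (rule powr_ratio_bounds(2)) (use q in auto)
    then have "(b k)\<^sup>2 \<le> (((real (Suc k) + q) / (real (Suc k) + q + 1)) powr q)\<^sup>2"
      using b0 by (intro power_mono) auto
    then show ?thesis unfolding sq by (simp add: add_ac)
  qed
  have half: "(1 / 2 :: real) ^ n \<le> 1" for n by (simp add: power_le_one)
  \<comment> \<open>The prefactor 1/2 + 2^-(k+1) equals 1 at k = 0, so the induction starts with
    equality.\<close>
  have lower: "m 0 * (1 / 2 + (1 / 2) ^ Suc k) * real (Suc k) powr - p \<le> m k" for k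
  proof (induction k)
    case (Suc k)
    obtain \<theta> where \<theta>: "(1 - (1 / 2) ^ (k + 2)) * (b k)\<^sup>2 \<le> \<theta>" "m (Suc k) = \<theta> * m k"
      using step[of k] unfolding b_def q_def by blast
    let ?x = "(1 / 2 :: real) ^ Suc k"
    have x: "0 < ?x" "?x \<le> 1 / 2" using half[of k] by auto
    have "?x * ?x \<le> ?x * (1 / 2)" using x by (intro mult_left_mono) auto
    \<comment> \<open>With x = 2^-(k+1) the next loss is 1 - x/2 and the next prefactor 1/2 + x/2;
      the inequality amounts to x \<le> 1/2.\<close>
    then have ineq: "1 / 2 + ?x / 2 \<le> (1 / 2 + ?x) * (1 - ?x / 2)" by (simp add: algebra_simps)
    have "real (Suc (Suc k)) powr - p
        = (real (Suc k) / real (Suc (Suc k))) powr p * real (Suc k) powr - p"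
      by (simp add: powr_divide powr_minus field_simps)
    also have "\<dots> \<le> (b k)\<^sup>2 * real (Suc k) powr - p"
      by (intro mult_right_mono b_lower) simp
    finally have y: "real (Suc (Suc k)) powr - p \<le> (b k)\<^sup>2 * real (Suc k) powr - p" .
    have "m 0 * (1 / 2 + ?x / 2) * real (Suc (Suc k)) powr - p
      \<le> m 0 * ((1 / 2 + ?x) * (1 - ?x / 2)) * ((b k)\<^sup>2 * real (Suc k) powr - p)"
      using y ineq x m0 by (intro mult_mono mult_left_mono) (auto intro!: mult_nonneg_nonneg)
    also have "\<dots> = ((1 - ?x / 2) * (b k)\<^sup>2) * (m 0 * (1 / 2 + ?x) * real (Suc k) powr - p)"
      by (simp add: mult_ac)
    also have "\<dots> \<le> \<theta> * m k"
      using \<theta>(1) Suc x m0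
      by (intro mult_mono) (auto intro!: mult_nonneg_nonneg order_trans[OF mult_nonneg_nonneg \<theta>(1)])
    finally show ?case unfolding \<theta>(2) by simp
  qed simp
  have upper: "m k \<le> m 0 * (1 + q) powr p * (real (Suc k) + q) powr - p \<and> 0 \<le> m k" for k
  proof (induction k)
    case (Suc k)
    obtain \<theta> where \<theta>: "(1 - (1 / 2) ^ (k + 2)) * (b k)\<^sup>2 \<le> \<theta>" "\<theta> \<le> (b k)\<^sup>2" "m (Suc k) = \<theta> * m k"
      using step[of k] unfolding b_def q_def by blast
    have \<theta>0: "0 \<le> \<theta>"
      by (rule order_trans[OF mult_nonneg_nonneg \<theta>(1)]) (use half[of "k + 2"] in auto)
    have "\<theta> * m k \<le> ((real (Suc k) + q) / (real (Suc (Suc k)) + q)) powr p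
        * (m 0 * (1 + q) powr p * (real (Suc k) + q) powr - p)"
      using Suc \<theta>0 \<theta>(2) b_upper[of k] by (intro mult_mono) auto
    also have "\<dots> = m 0 * (1 + q) powr p * (real (Suc (Suc k)) + q) powr - p"
      using q by (simp add: powr_divide powr_minus field_simps)
    finally show ?case using \<theta>(3) \<theta>0 Suc by simp
  qed (use m0 q in \<open>simp add: powr_minus\<close>)
  show ?thesis
  proof
    show "0 < m 0 / 2" "0 < m 0 * (1 + q) powr p" using m0 q by auto
    show "m 0 / 2 * real (Suc k) powr - p \<le> m k" for k
    proof (rule order_trans[OF mult_right_mono lower])
      have "m 0 * (1 / 2) \<le> m 0 * (1 / 2 + (1 / 2) ^ Suc k)" using m0 by (intro mult_left_mono) auto
      then show "m 0 / 2 \<le> m 0 * (1 / 2 + (1 / 2) ^ Suc k)" by simp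
    qed simp
    show "m k \<le> m 0 * (1 + q) powr p * real (Suc k) powr - p" for k
    proof (rule order_trans[OF conjunct1[OF upper] mult_left_mono])
      show "(real (Suc k) + q) powr - p \<le> real (Suc k) powr - p"
        using q p by (intro powr_mono2') auto
    qed (use m0 in auto)
  qed
qed

section \<open>The staircase and its exceptional null set\<close>

locale staircase =
  fixes \<kappa> p t0 t1 x0 x1 :: real
    and S :: "nat \<Rightarrow> real set \<times> real set" and W :: "nat \<Rightarrow> real \<times> real \<Rightarrow> real"
  assumes kappa: "0 < \<kappa>" "\<kappa> < 1" and p_eq: "p = 2 / (1 - \<kappa>)"
    and box: "t0 < t1" "x0 < x1" "- 1 / 4 < t0" "t1 < 0" "- 1 / 2 < x0" "x1 < 1 / 2"
    and S_0: "S 0 = ({t0<..<t1}, {x0<..<x1})"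
    and step: "\<And>k. stair_step \<kappa> (real (Suc k) + p) (real (Suc k) / (real (Suc k) + p / 2))
      ((1 / 2) ^ (k + 2)) (S k) (W k) (S (Suc k))"
begin

definition Q :: "(real \<times> real) set" where "Q = {-1<..<0} \<times> {-1<..<1}"
definition D :: "(real \<times> real) set" where "D = {t0<..<t1} \<times> {x0<..<x1}"
definition l :: "nat \<Rightarrow> real" where "l k = real (Suc k) + p"
definition B :: "nat \<Rightarrow> (real \<times> real) set" where "B k = fst (S k) \<times> snd (S k)"
text \<open>The points at which the staircase never stops. Every other point leaves the nested sets
  \<open>B k\<close> after finitely many steps, so only finitely many corrections alter its
  derivatives.\<close>

definition N :: "(real \<times> real) set" where "N = (\<Inter>k. B k)"

lemma p_gt: "2 < p"
  using kappa by (simp add: p_eq field_simps)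

lemma l_pos: "0 < l k" and l_mono: "j \<le> k \<Longrightarrow> l j \<le> l k" and l_Suc: "l (Suc k) = l k + 1"
  using p_gt by (auto simp: l_def)

lemma W_tame: "tame (W k)"
  and W_supported: "supported_in (W k) (B k)"
  and W_small: "\<bar>W k z\<bar> \<le> (1 / 2) ^ (k + 2)" "\<bar>Dx (W k) z\<bar> \<le> (1 / 2) ^ (k + 2)"
  and W_wedge: "in_wedge \<kappa> (l k) (l k + Dt (W k) z) (l k + Dx (Dx (W k)) z)"
  and W_top: "z \<in> B (Suc k) \<Longrightarrow> Dt (W k) z = 1" "z \<in> B (Suc k) \<Longrightarrow> Dx (Dx (W k)) z = 1"
  using step[of k] unfolding stair_step_def B_def l_def by blast+

lemma W_zero:
  assumes "z \<notin> B k"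
  shows "W k z = 0" "Dt (W k) z = 0" "Dx (W k) z = 0" "Dx (Dx (W k)) z = 0"
  using assms supported_in_zero[OF W_supported]
    supported_in_zero[OF supported_in_partials(1)[OF W_supported]]
    supported_in_zero[OF supported_in_partials(2)[OF W_supported]]
    supported_in_zero[OF supported_in_partials(2)[OF supported_in_partials(2)[OF W_supported]]]
  by blast+

lemma B_0: "B 0 = D"
  by (simp add: B_def D_def S_0)

lemma B_Suc: "B (Suc k) \<subseteq> B k"
  using step[of k] unfolding stair_step_def B_def by blast

lemma B_mono: "j \<le> k \<Longrightarrow> B k \<subseteq> B j"
  by (rule lift_Suc_antimono_le[of B, OF B_Suc])

lemma S_interval_union: "interval_union (fst (S k))" "interval_union (snd (S k))"
proof -
  have "interval_union (fst (S k)) \<and> interval_union (snd (S k))"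
  proof (cases k)
    case 0
    then show ?thesis using S_0 box by (simp add: interval_union.interval)
  next
    case (Suc j)
    then show ?thesis using step[of j] unfolding stair_step_def by blast
  qed
  then show "interval_union (fst (S k))" "interval_union (snd (S k))" by auto
qed

lemma B_open: "open (B k)"
  unfolding B_def by (intro open_Times interval_union_open S_interval_union)

lemma B_borel: "B k \<in> sets borel" by (rule borel_open[OF B_open])
lemma N_borel: "N \<in> sets borel" unfolding N_def using B_borel by (intro sets.countable_INT) auto
lemma N_subset: "N \<subseteq> B k" by (auto simp: N_def)
lemma D_open: "open D" unfolding D_def by (intro open_Times) auto
lemma Q_open: "open Q" unfolding Q_def by (intro open_Times) auto

lemma D_subset_Q: "D \<subseteq> Q"
  using box by (auto simp: D_def Q_def)

lemma B_subset: "B k \<subseteq> D" "B k \<subseteq> Q"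
  using B_mono[of 0 k] D_subset_Q by (auto simp: B_0)

lemma emeasure_Times_lborel:
  fixes A C :: "real set"
  assumes A: "A \<in> fmeasurable lborel" and C: "C \<in> fmeasurable lborel"
  shows "emeasure lborel (A \<times> C) = ennreal (measure lborel A * measure lborel C)"
proof -
  have "emeasure lborel (A \<times> C) = emeasure (lborel \<Otimes>\<^sub>M lborel) (A \<times> C)" unfolding lborel_prod ..
  also have "\<dots> = emeasure lborel A * emeasure lborel C"
    by (rule lborel.emeasure_pair_measure_Times[OF fmeasurableD[OF A] fmeasurableD[OF C]])
  also have "\<dots> = ennreal (measure lborel A * measure lborel C)"
    unfolding emeasure_eq_measure2[OF A] emeasure_eq_measure2[OF C] by (simp add: ennreal_mult)
  finally show ?thesis .
qed

lemma emeasure_lebesgue_Q: "emeasure lebesgue Q = 2"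
proof -
  have "emeasure lborel Q = ennreal (1 * 2)"
    unfolding Q_def by (subst emeasure_Times_lborel) (simp_all add: fmeasurable_def)
  then show ?thesis using Q_open by simp
qed

lemma Q_lmeasurable: "Q \<in> lmeasurable"
  using emeasure_lebesgue_Q Q_open by (intro fmeasurableI) auto

lemma lmeasurable_subset_Q: "A \<in> sets borel \<Longrightarrow> A \<subseteq> Q \<Longrightarrow> A \<in> lmeasurable"
  by (rule fmeasurableI2[OF Q_lmeasurable]) simp_all

lemmas D_lmeasurable = lmeasurable_subset_Q[OF borel_open[OF D_open] D_subset_Q]
lemmas B_lmeasurable = lmeasurable_subset_Q[OF B_borel B_subset(2)]
lemmas N_lmeasurable = lmeasurable_subset_Q[OF N_borel order_trans[OF N_subset B_subset(2)]]

lemma measure_B: "measure lebesgue (B k) = measure lborel (fst (S k)) * measure lborel (snd (S k))"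
proof -
  have "emeasure lebesgue (B k) = emeasure lborel (B k)" using B_borel by simp
  also have "\<dots> = ennreal (measure lborel (fst (S k)) * measure lborel (snd (S k)))"
    unfolding B_def by (intro emeasure_Times_lborel interval_union_fmeasurable S_interval_union)
  finally show ?thesis by (simp add: measure_def)
qed

lemma measure_B_bounds:
  obtains c C where "0 < c" "0 < C" "\<And>k. c * real (Suc k) powr - p \<le> measure lebesgue (B k)"
    "\<And>k. measure lebesgue (B k) \<le> C * real (Suc k) powr - p"
proof (rule staircase_mass[of "\<lambda>k. measure lebesgue (B k)" p])
  show "2 \<le> p" using p_gt by simp
  show "0 < measure lebesgue (B 0)"
    unfolding measure_B by (intro mult_pos_pos interval_union_measure_pos S_interval_union)
  show "\<exists>\<theta>. (1 - (1 / 2) ^ (k + 2)) * (real (Suc k) / (real (Suc k) + p / 2))\<^sup>2 \<le> \<theta>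
      \<and> \<theta> \<le> (real (Suc k) / (real (Suc k) + p / 2))\<^sup>2
      \<and> measure lebesgue (B (Suc k)) = \<theta> * measure lebesgue (B k)" for k
    using step[of k] unfolding stair_step_def measure_B by blast
qed (rule that)

lemma N_null: "emeasure lebesgue N = 0"
proof -
  obtain c C where C: "0 < C" "\<And>k. measure lebesgue (B k) \<le> C * real (Suc k) powr - p"
    by (rule measure_B_bounds) blast
  have "measure lebesgue N \<le> C * real (Suc k) powr - p" for k
    using measure_mono_fmeasurable[OF N_subset[of k] fmeasurableD[OF N_lmeasurable] B_lmeasurable] C(2)[of k] by linarith
  moreover have "(\<lambda>k. C * real (Suc k) powr - p) \<longlonglongrightarrow> C * 0"
    using p_gt by (intro tendsto_intros tendsto_neg_powr filterlim_compose[OF filterlim_real_sequentially filterlim_Suc]) auto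
  ultimately have "measure lebesgue N \<le> 0"
    using LIMSEQ_le_const[of "\<lambda>k. C * real (Suc k) powr - p" 0 "measure lebesgue N"] by auto
  then have "measure lebesgue N = 0" using measure_nonneg[of lebesgue N] by linarith
  then show ?thesis using N_lmeasurable by (simp add: emeasure_eq_measure2)
qed

lemma AE_not_N: "A \<in> sets lebesgue \<Longrightarrow> AE z in lebesgue_on A. z \<notin> N"
proof -
  assume A: "A \<in> sets lebesgue"
  have "N \<in> null_sets lebesgue" using N_null N_borel by auto
  then have "AE z in lebesgue. z \<notin> N" by (rule AE_not_in)
  then have "AE z in lebesgue. z \<in> A \<longrightarrow> z \<notin> N" by eventually_elim simp
  then show ?thesis using A by (subst AE_restrict_space_iff) auto
qed

text \<open>The polynomial l (t + x^2 / 2) with l = \<open>l 0\<close>, for which u_t = u_xx = l.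
  The factors 1 exhibit it as a sum of two tensor products.\<close>

definition u0 :: "real \<times> real \<Rightarrow> real" where
  "u0 z = l 0 * fst z * 1 + 1 * (l 0 / 2 * (snd z * snd z))"

lemma u0_tensors: "smooth (\<lambda>t. l 0 * t)" "smooth (\<lambda>x. l 0 / 2 * (x * x))"
  by (intro smooth_cmult smooth_mult smooth_id)+

lemma u0_tame: "tame u0"
  unfolding u0_def[abs_def]
  using tame.add[OF tame.tensor[OF u0_tensors(1) smooth_const[of 1]] tame.tensor[OF smooth_const[of 1] u0_tensors(2)]]
  by simp

lemma u0_partials: "Dt u0 = (\<lambda>z. l 0)" "Dx u0 = (\<lambda>z. l 0 * snd z)" "Dx (Dx u0) = (\<lambda>z. l 0)"
proof -
  show "Dt u0 = (\<lambda>z. l 0)" by (rule Dt_eqI) (auto simp: u0_def intro!: derivative_eq_intros)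
  show *: "Dx u0 = (\<lambda>z. l 0 * snd z)"
    by (rule Dx_eqI) (auto simp: u0_def intro!: derivative_eq_intros)
  show "Dx (Dx u0) = (\<lambda>z. l 0)"
    unfolding * by (rule Dx_eqI) (auto intro!: derivative_eq_intros)
qed

section \<open>Partial sums, pointwise limits of the derivatives, and the coefficient\<close>

definition U :: "nat \<Rightarrow> real \<times> real \<Rightarrow> real" where "U m z = u0 z + (\<Sum>k<m. W k z)"

lemma U_tame: "tame (U m)"
  unfolding U_def[abs_def] by (intro tame_sum u0_tame W_tame)

lemma Dt_U: "Dt (U m) z = l 0 + (\<Sum>k<m. Dt (W k) z)"
  and Dx_U: "Dx (U m) z = l 0 * snd z + (\<Sum>k<m. Dx (W k) z)"
  and Dxx_U: "Dx (Dx (U m)) z = l 0 + (\<Sum>k<m. Dx (Dx (W k)) z)"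
proof -
  have U_eq: "U m = (\<lambda>z. u0 z + (\<Sum>k<m. W k z))" by (rule ext) (simp add: U_def)
  note U = tame_sum_partials[where u = u0 and w = W and m = m, OF u0_tame W_tame, folded U_eq]
  show "Dt (U m) z = l 0 + (\<Sum>k<m. Dt (W k) z)"
    "Dx (U m) z = l 0 * snd z + (\<Sum>k<m. Dx (W k) z)"
    unfolding U u0_partials by (rule refl)+
  show "Dx (Dx (U m)) z = l 0 + (\<Sum>k<m. Dx (Dx (W k)) z)"
    unfolding U tame_sum_partials(2)[where u = "Dx u0" and w = "\<lambda>k. Dx (W k)", OF tame_Dx[OF u0_tame] tame_Dx[OF W_tame]] u0_partials(3) ..
qed

lemmas U_partials = Dt_U Dxx_U

lemma U_on_B: "z \<in> B m \<Longrightarrow> Dt (U m) z = l m \<and> Dx (Dx (U m)) z = l m"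
proof (induction m)
  case (Suc m)
  then have "z \<in> B m" using B_Suc by blast
  then show ?case using Suc W_top[of z m] by (simp add: U_partials l_Suc)
qed (simp add: U_partials)

lemma U_off_B:
  assumes "z \<notin> B m" "m \<le> n"
  shows "Dt (U n) z = Dt (U m) z" "Dx (Dx (U n)) z = Dx (Dx (U m)) z"
proof -
  have zero: "Dt (W k) z = 0" "Dx (Dx (W k)) z = 0" if "k \<in> {..<n} - {..<m}" for k
  proof -
    have "z \<notin> B k" using that assms B_mono[of m k] by auto
    then show "Dt (W k) z = 0" "Dx (Dx (W k)) z = 0" by (rule W_zero)+
  qed
  have sub: "{..<m} \<subseteq> {..<n}" using assms(2) by auto
  have "(\<Sum>k<n. Dt (W k) z) = (\<Sum>k<m. Dt (W k) z)"
    by (rule sum.mono_neutral_right[OF _ sub]) (use zero in auto)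
  moreover have "(\<Sum>k<n. Dx (Dx (W k)) z) = (\<Sum>k<m. Dx (Dx (W k)) z)"
    by (rule sum.mono_neutral_right[OF _ sub]) (use zero in auto)
  ultimately show "Dt (U n) z = Dt (U m) z" "Dx (Dx (U n)) z = Dx (Dx (U m)) z"
    by (simp_all add: U_partials)
qed

text \<open>Off the null set \<open>N\<close> the sequences below are eventually constant.\<close>

definition ut :: "real \<times> real \<Rightarrow> real" where
  "ut z = (if z \<in> N then 0 else lim (\<lambda>n. Dt (U n) z))"
definition uxx :: "real \<times> real \<Rightarrow> real" where
  "uxx z = (if z \<in> N then 0 else lim (\<lambda>n. Dx (Dx (U n)) z))"

lemma U_eventually:
  assumes "z \<notin> B m"
  shows "(\<lambda>n. Dt (U n) z) \<longlonglongrightarrow> Dt (U m) z" "(\<lambda>n. Dx (Dx (U n)) z) \<longlonglongrightarrow> Dx (Dx (U m)) z"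
  by (rule tendsto_eventually, rule eventually_sequentiallyI[of m], rule U_off_B[OF assms], assumption)+

lemma limit_off_B:
  assumes "z \<notin> B m"
  shows "ut z = Dt (U m) z" "uxx z = Dx (Dx (U m)) z"
proof -
  have "z \<notin> N" using assms N_subset[of m] by blast
  then show "ut z = Dt (U m) z" "uxx z = Dx (Dx (U m)) z"
    unfolding ut_def uxx_def limI[OF U_eventually(1)[OF assms]] limI[OF U_eventually(2)[OF assms]]
    by simp_all
qed

lemma U_limits:
  assumes "z \<notin> N"
  shows "(\<lambda>n. Dt (U n) z) \<longlonglongrightarrow> ut z" "(\<lambda>n. Dx (Dx (U n)) z) \<longlonglongrightarrow> uxx z"
proof -
  obtain m where m: "z \<notin> B m" using assms unfolding N_def by blast
  show "(\<lambda>n. Dt (U n) z) \<longlonglongrightarrow> ut z" "(\<lambda>n. Dx (Dx (U n)) z) \<longlonglongrightarrow> uxx z"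
    unfolding limit_off_B[OF m] by (rule U_eventually[OF m])+
qed

lemma exit_level:
  assumes "z \<notin> N" "z \<in> B k"
  obtains m where "k \<le> m" "z \<in> B m" "z \<notin> B (Suc m)"
proof -
  obtain n where n: "z \<notin> B n" using assms(1) unfolding N_def by blast
  define m where "m = (LEAST n. z \<notin> B n)"
  have m: "z \<notin> B m" unfolding m_def by (rule LeastI[of _ n]) (rule n)
  have "k < m" by (rule ccontr) (use m assms(2) B_mono[of m k] in auto)
  then obtain i where i: "m = Suc i" by (cases m) auto
  have "z \<in> B i" using not_less_Least[of i "\<lambda>n. z \<notin> B n"] i unfolding m_def by auto
  moreover have "k \<le> i" "z \<notin> B (Suc i)" using \<open>k < m\<close> m i by auto
  ultimately show ?thesis by (intro that)
qed

text \<open>On arrival in \<open>B m\<close> both derivatives equal \<open>l m\<close>, and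
  \<open>W m\<close> is the last correction that acts at the point. The wedge condition of that
  single step is therefore the final one.\<close>

lemma exit_wedge:
  assumes "z \<in> B m" "z \<notin> B (Suc m)"
  shows "in_wedge \<kappa> (l m) (ut z) (uxx z)"
proof -
  have "Dt (U (Suc m)) z = Dt (U m) z + Dt (W m) z" "Dx (Dx (U (Suc m))) z = Dx (Dx (U m)) z + Dx (Dx (W m)) z"
    by (simp_all add: U_partials)
  then show ?thesis
    using W_wedge[of m z] U_on_B[OF assms(1)] unfolding limit_off_B[OF assms(2)] by simp
qed

lemma outside_values:
  assumes "z \<notin> D"
  shows "ut z = l 0" "uxx z = l 0"
  using limit_off_B[of z 0] assms by (simp_all add: B_0 U_partials)

lemma values_lower:
  assumes "z \<notin> N" "z \<in> B k"
  shows "\<kappa> * l k \<le> ut z" "\<kappa> * l k \<le> uxx z"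
proof -
  obtain m where m: "k \<le> m" "z \<in> B m" "z \<notin> B (Suc m)" by (rule exit_level[OF assms])
  have "\<kappa> * l k \<le> \<kappa> * l m" using l_mono[OF m(1)] kappa by (intro mult_left_mono) auto
  with exit_wedge[OF m(2,3)] show "\<kappa> * l k \<le> ut z" "\<kappa> * l k \<le> uxx z"
    by (auto simp: in_wedge_def)
qed

lemma values_upper:
  assumes "z \<notin> B (Suc k)"
  shows "ut z \<le> l k + 2" "uxx z \<le> l k + 2"
proof -
  have "ut z \<le> l k + 2 \<and> uxx z \<le> l k + 2"
  proof (cases "z \<in> B 0")
    case True
    have "z \<notin> N" using assms N_subset[of "Suc k"] by blast
    then obtain m where m: "z \<in> B m" "z \<notin> B (Suc m)" by (rule exit_level[OF _ True])
    have "m \<le> k" by (rule ccontr) (use assms m(1) B_mono[of "Suc k" m] in auto)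
    then show ?thesis using exit_wedge[OF m] l_mono[of m k] by (auto simp: in_wedge_def)
  next
    case False
    then show ?thesis using outside_values[of z] l_mono[of 0 k] by (simp add: B_0)
  qed
  then show "ut z \<le> l k + 2" "uxx z \<le> l k + 2" by auto
qed

lemma values_wedge:
  assumes "z \<notin> N"
  shows "\<kappa> * uxx z \<le> ut z" "\<kappa> * ut z \<le> uxx z" "\<kappa> * l 0 \<le> ut z" "\<kappa> * l 0 \<le> uxx z"
proof -
  have "\<kappa> * uxx z \<le> ut z \<and> \<kappa> * ut z \<le> uxx z \<and> \<kappa> * l 0 \<le> ut z \<and> \<kappa> * l 0 \<le> uxx z"
  proof (cases "z \<in> B 0")
    case True
    then obtain m where m: "z \<in> B m" "z \<notin> B (Suc m)" by (rule exit_level[OF assms])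
    then show ?thesis using exit_wedge[OF m] values_lower[OF assms True] by (auto simp: in_wedge_def)
  next
    case False
    have "\<kappa> * l 0 \<le> 1 * l 0" using kappa l_pos[of 0] by (intro mult_right_mono) auto
    then show ?thesis using outside_values[of z] False by (simp add: B_0)
  qed
  then show "\<kappa> * uxx z \<le> ut z" "\<kappa> * ut z \<le> uxx z" "\<kappa> * l 0 \<le> ut z" "\<kappa> * l 0 \<le> uxx z" by auto
qed

lemma values_nonneg: "0 \<le> ut z" "0 \<le> uxx z"
proof -
  have "0 \<le> ut z \<and> 0 \<le> uxx z"
  proof (cases "z \<in> N")
    case False
    have "0 < \<kappa> * l 0" using kappa l_pos by simp
    then show ?thesis using values_wedge(3,4)[OF False] by linarith
  qed (simp add: ut_def uxx_def)
  then show "0 \<le> ut z" "0 \<le> uxx z" by auto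
qed

text \<open>This provides the majorant for dominated convergence. A point outside \<open>B n\<close>
  already has its final values; inside, the partial sum has the value \<open>l n\<close>, whereas
  the final value is at least \<open>\<kappa> * l n\<close> whatever happens later.\<close>

lemma U_dominated:
  assumes "z \<notin> N"
  shows "\<bar>Dt (U n) z\<bar> \<le> ut z / \<kappa>" "\<bar>Dx (Dx (U n)) z\<bar> \<le> uxx z / \<kappa>"
proof -
  have "\<bar>Dt (U n) z\<bar> \<le> ut z / \<kappa> \<and> \<bar>Dx (Dx (U n)) z\<bar> \<le> uxx z / \<kappa>"
  proof (cases "z \<in> B n")
    case True
    then show ?thesis using values_lower[OF assms True] U_on_B[OF True] l_pos[of n] kappa
      by (simp add: pos_le_divide_eq mult.commute)
  next
    case False
    have "x \<le> x / \<kappa>" if "0 \<le> x" for x using kappa that by (simp add: pos_le_divide_eq mult_left_le)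
    then show ?thesis using limit_off_B[OF False] values_nonneg[of z] by simp
  qed
  then show "\<bar>Dt (U n) z\<bar> \<le> ut z / \<kappa>" "\<bar>Dx (Dx (U n)) z\<bar> \<le> uxx z / \<kappa>" by auto
qed

text \<open>The default 1 lies between \<kappa> and 1 / \<kappa>, so the ellipticity bounds hold at
  every point.\<close>

definition a :: "real \<times> real \<Rightarrow> real" where "a z = (if z \<in> N then 1 else ut z / uxx z)"

lemma a_bounds: "\<kappa> \<le> a z" "a z \<le> inverse \<kappa>"
proof -
  have "\<kappa> \<le> a z \<and> a z \<le> inverse \<kappa>"
  proof (cases "z \<in> N")
    case True
    then show ?thesis using kappa by (simp add: a_def one_le_inverse)
  next
    case False
    have "0 < \<kappa> * l 0" using kappa l_pos by simp
    then have "0 < uxx z" using values_wedge(4)[OF False] by linarith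
    then show ?thesis using values_wedge(1,2)[OF False] False kappa
      by (simp add: a_def field_simps)
  qed
  then show "\<kappa> \<le> a z" "a z \<le> inverse \<kappa>" by auto
qed

text \<open>On \<open>N\<close> both sides are 0 by the default values of \<open>ut\<close> and
  \<open>uxx\<close>, so the equation holds everywhere and can be rewritten under integrals without
  almost-everywhere arguments.\<close>

lemma a_times_uxx: "a z * uxx z = ut z"
proof (cases "z \<in> N")
  case False
  have "0 < \<kappa> * l 0" using kappa l_pos by simp
  then have "0 < uxx z" using values_wedge(4)[OF False] by linarith
  then show ?thesis using False by (simp add: a_def)
qed (simp add: ut_def uxx_def)

lemma values_measurable: "ut \<in> borel_measurable borel" "uxx \<in> borel_measurable borel"
proof -
  have m: "(\<lambda>z. if z \<in> N then 0 else f z) \<in> borel_measurable borel"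
    if "f \<in> borel_measurable borel" for f :: "real \<times> real \<Rightarrow> real"
    using that N_borel by (intro measurable_If_set) auto
  have lim: "(\<lambda>n. if z \<in> N then 0 else Dt (U n) z) \<longlonglongrightarrow> ut z"
    "(\<lambda>n. if z \<in> N then 0 else Dx (Dx (U n)) z) \<longlonglongrightarrow> uxx z" for z
    using U_limits[of z] by (cases "z \<in> N"; simp add: ut_def uxx_def)+
  show "ut \<in> borel_measurable borel"
    by (rule borel_measurable_LIMSEQ_real[OF lim(1)], intro m tame_borel_measurable tame_Dt U_tame)
  show "uxx \<in> borel_measurable borel"
    by (rule borel_measurable_LIMSEQ_real[OF lim(2)], intro m tame_borel_measurable tame_Dx U_tame)
qed

lemma a_measurable: "a \<in> borel_measurable borel"
proof -
  have "(\<lambda>z. if z \<in> N then 1 else ut z / uxx z) \<in> borel_measurable borel"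
    using values_measurable N_borel by (intro measurable_If_set) auto
  then show ?thesis by (simp add: a_def[abs_def])
qed

subsection \<open>Level sets and integrability\<close>

text \<open>The common features of \<open>ut\<close> and \<open>uxx\<close> from which all integrability properties follow.\<close>

definition singular :: "(real \<times> real \<Rightarrow> real) \<Rightarrow> bool" where
  "singular g \<longleftrightarrow> g \<in> borel_measurable borel \<and> (\<forall>z. 0 \<le> g z) \<and>
     (\<forall>z k. z \<notin> N \<longrightarrow> z \<in> B k \<longrightarrow> \<kappa> * l k \<le> g z) \<and>
     (\<forall>z k. z \<notin> B (Suc k) \<longrightarrow> g z \<le> l k + 2) \<and> (\<forall>z\<in>N. g z = 0)"

lemma singular_values: "singular ut" "singular uxx"
  unfolding singular_def
  using values_measurable values_nonneg values_lower values_upper by (auto simp: ut_def uxx_def)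

lemma singularD:
  assumes "singular g"
  shows "g \<in> borel_measurable borel" "0 \<le> g z" "z \<notin> N \<Longrightarrow> z \<in> B k \<Longrightarrow> \<kappa> * l k \<le> g z"
    "z \<notin> B (Suc k) \<Longrightarrow> g z \<le> l k + 2" "z \<in> N \<Longrightarrow> g z = 0"
  using assms unfolding singular_def by blast+

lemma superlevel_measurable:
  assumes "singular g" "open A"
  shows "{z \<in> A. \<tau> < g z} \<in> sets lebesgue" "A \<subseteq> Q \<Longrightarrow> {z \<in> A. \<tau> < g z} \<in> lmeasurable"
proof -
  have "{z. \<tau> < g z} \<in> sets borel"
    using singularD(1)[OF assms(1)] by (simp add: borel_measurable_iff_greater)
  then have "A \<inter> {z. \<tau> < g z} \<in> sets borel" using assms(2) by auto
  then show 1: "{z \<in> A. \<tau> < g z} \<in> sets lebesgue" by (simp add: Int_def)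
  show "{z \<in> A. \<tau> < g z} \<in> lmeasurable" if "A \<subseteq> Q"
    by (rule fmeasurableI2[OF Q_lmeasurable _ 1]) (use that in auto)
qed

text \<open>A value above \<open>l m + 2\<close> can occur only inside \<open>B (Suc m)\<close>,
  whose measure is at most a multiple of (m + 2) powr - p. Small \<tau> are covered by the measure 2
  of Q.\<close>

lemma superlevel_upper:
  assumes g: "singular g"
  obtains C where "0 < C" "\<And>\<tau>. 0 < \<tau> \<Longrightarrow> measure lebesgue {z \<in> Q. \<tau> < g z} \<le> C * \<tau> powr - p"
proof -
  obtain c C where C: "0 < C" "\<And>k. measure lebesgue (B k) \<le> C * real (Suc k) powr - p"
    by (rule measure_B_bounds) blast
  have bound: "measure lebesgue {z \<in> Q. \<tau> < g z} \<le> (2 * (p + 3) powr p + C * (p + 4) powr p) * \<tau> powr - p"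
    if \<tau>: "0 < \<tau>" for \<tau>
  proof (cases "\<tau> < p + 3")
    case True
    have "measure lebesgue {z \<in> Q. \<tau> < g z} \<le> measure lebesgue Q"
      by (rule measure_mono_fmeasurable[OF _ superlevel_measurable(1)[OF g Q_open] Q_lmeasurable]) auto
    also have "\<dots> = 2" using emeasure_lebesgue_Q by (simp add: measure_def)
    also have "2 * 1 \<le> 2 * ((p + 3) powr p * \<tau> powr - p)"
    proof (intro mult_left_mono)
      have "1 \<le> ((p + 3) / \<tau>) powr p" using True \<tau> p_gt by (intro ge_one_powr_ge_zero) auto
      also have "((p + 3) / \<tau>) powr p = (p + 3) powr p / \<tau> powr p"
        by (rule powr_divide)
      finally show "1 \<le> (p + 3) powr p * \<tau> powr - p" by (simp add: powr_minus_divide)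
    qed simp
    finally show ?thesis using C(1) by (simp add: distrib_right mult.assoc add_increasing2)
  next
    case False
    \<comment> \<open>The largest m with \<open>l m + 2\<close> \<le> \<tau>, because
      \<open>l m + 2\<close> is m + p + 3.\<close>
    define m where "m = nat \<lfloor>\<tau> - p - 3\<rfloor>"
    have "real m = of_int \<lfloor>\<tau> - p - 3\<rfloor>" using False by (simp add: m_def)
    then have m: "real m \<le> \<tau> - p - 3" "\<tau> - p - 3 < real m + 1"
      using floor_correct[of "\<tau> - p - 3"] by linarith+
    have "{z \<in> Q. \<tau> < g z} \<subseteq> B (Suc m)"
    proof
      fix z assume "z \<in> {z \<in> Q. \<tau> < g z}"
      then have "\<not> g z \<le> l m + 2" using m(1) by (simp add: l_def)
      then show "z \<in> B (Suc m)" using g unfolding singular_def by blast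
    qed
    then have "measure lebesgue {z \<in> Q. \<tau> < g z} \<le> measure lebesgue (B (Suc m))"
      by (rule measure_mono_fmeasurable[OF _ superlevel_measurable(1)[OF g Q_open] B_lmeasurable])
    also have "\<dots> \<le> C * real (Suc (Suc m)) powr - p" by (rule C(2))
    also have "\<dots> \<le> C * (\<tau> / (p + 4)) powr - p"
    proof (intro mult_left_mono powr_mono2')
      have "0 \<le> p * real m" using p_gt by simp
      moreover have "real (Suc (Suc m)) * (p + 4) = p * real m + 2 * p + 4 * real m + 8"
        by (simp add: algebra_simps)
      ultimately have "\<tau> \<le> real (Suc (Suc m)) * (p + 4)" using m(2) p_gt by linarith
      then show "\<tau> / (p + 4) \<le> real (Suc (Suc m))" using p_gt by (simp only: pos_divide_le_eq)
    qed (use p_gt \<tau> C in auto)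
    also have "\<dots> = C * (p + 4) powr p * \<tau> powr - p"
      using \<tau> p_gt by (simp add: powr_divide powr_minus field_simps)
    finally show ?thesis by (simp add: distrib_right add_increasing)
  qed
  have "0 < 2 * (p + 3) powr p + C * (p + 4) powr p" using p_gt C by (intro add_pos_pos) auto
  with bound that show ?thesis by blast
qed

text \<open>Off \<open>N\<close> the set \<open>B m\<close> lies in the superlevel set as soon as
  \<open>\<kappa> * l m\<close> exceeds \<tau>; m = \<lfloor>\<tau> / \<kappa>\<rfloor> achieves
  this and is comparable to \<tau>.\<close>

lemma superlevel_lower:
  assumes g: "singular g"
  obtains c where "0 < c" "\<And>\<tau>. 1 \<le> \<tau> \<Longrightarrow> c * \<tau> powr - p \<le> measure lebesgue {z \<in> D. \<tau> < g z}"
proof -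
  obtain c where c: "0 < c" "\<And>k. c * real (Suc k) powr - p \<le> measure lebesgue (B k)"
    by (rule measure_B_bounds) blast
  have bound: "c * (2 / \<kappa>) powr - p * \<tau> powr - p \<le> measure lebesgue {z \<in> D. \<tau> < g z}" if \<tau>: "1 \<le> \<tau>" for \<tau>
  proof -
    define m where "m = nat \<lfloor>\<tau> / \<kappa>\<rfloor>"
    have \<tau>\<kappa>: "1 \<le> \<tau> / \<kappa>" using \<tau> kappa by (simp add: pos_le_divide_eq)
    then have m: "real m \<le> \<tau> / \<kappa>" "\<tau> / \<kappa> < real m + 1" by (auto simp: m_def)
    have "\<tau> / \<kappa> < l m" using m(2) p_gt by (simp add: l_def)
    then have "\<tau> < \<kappa> * l m" using kappa by (simp add: pos_divide_less_eq mult.commute)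
    then have "B m - N \<subseteq> {z \<in> D. \<tau> < g z}"
      using g B_subset(1)[of m] unfolding singular_def by fastforce
    moreover have "B m - N \<in> sets lebesgue" using B_borel N_borel by (intro sets.Diff) auto
    ultimately have le: "measure lebesgue (B m - N) \<le> measure lebesgue {z \<in> D. \<tau> < g z}"
      by (rule measure_mono_fmeasurable[OF _ _ superlevel_measurable(2)[OF g D_open D_subset_Q]])
    have "emeasure lebesgue (B m - N) = emeasure lebesgue (B m)"
      by (rule emeasure_Diff_null_set) (use N_null N_borel B_borel in auto)
    then have eq: "measure lebesgue (B m - N) = measure lebesgue (B m)" by (simp add: measure_def)
    have "c * (2 / \<kappa>) powr - p * \<tau> powr - p = c * (2 / \<kappa> * \<tau>) powr - p"
      by (subst powr_mult) (use kappa \<tau> in auto)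
    also have "\<dots> \<le> c * real (Suc m) powr - p"
    proof (intro mult_left_mono powr_mono2')
      show "real (Suc m) \<le> 2 / \<kappa> * \<tau>" using m(1) \<tau>\<kappa> by simp
    qed (use p_gt c in auto)
    also have "\<dots> \<le> measure lebesgue (B m)" by (rule c(2))
    finally show ?thesis using le eq by simp
  qed
  have "0 < c * (2 / \<kappa>) powr - p" using c kappa by simp
  with bound that show ?thesis by blast
qed

lemma singular_weak_Lp:
  assumes g: "singular g" and A: "open A" "A \<subseteq> Q"
  shows "g \<in> weak_Lp p A"
proof -
  obtain C where C: "0 < C" "\<And>\<tau>. 0 < \<tau> \<Longrightarrow> measure lebesgue {z \<in> Q. \<tau> < g z} \<le> C * \<tau> powr - p"
    by (rule superlevel_upper[OF g]) blast
  have "emeasure lebesgue {z \<in> A. \<tau> < \<bar>g z\<bar>} \<le> ennreal (C * \<tau> powr - p)" if \<tau>: "0 < \<tau>" for \<tau>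
  proof -
    have "emeasure lebesgue {z \<in> A. \<tau> < \<bar>g z\<bar>} \<le> emeasure lebesgue {z \<in> Q. \<tau> < g z}"
      using g A superlevel_measurable(1)[OF g Q_open]
      by (intro emeasure_mono) (auto simp: singular_def)
    also have "\<dots> = ennreal (measure lebesgue {z \<in> Q. \<tau> < g z})"
      by (rule emeasure_eq_measure2) (rule superlevel_measurable(2)[OF g Q_open order_refl])
    also have "\<dots> \<le> ennreal (C * \<tau> powr - p)" by (intro ennreal_leI C(2) \<tau>)
    finally show ?thesis .
  qed
  then show ?thesis using borel_measurable_lebesgue_on g
    unfolding weak_Lp_def singular_def by blast
qed

text \<open>A layer-cake majorant: the square of g is at most a constant plus a sum of increments
  \<open>d k\<close> on \<open>B (Suc k)\<close>. The increments grow like k and the measures decay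
  like k powr - p, and the sum of k powr (1 - p) converges because p > 2.\<close>

lemma singular_square_integrable:
  assumes g: "singular g"
  shows "integrable (lebesgue_on Q) (\<lambda>z. (g z)\<^sup>2)"
proof -
  obtain c C where C: "0 < C" "\<And>k. measure lebesgue (B k) \<le> C * real (Suc k) powr - p"
    by (rule measure_B_bounds) blast
  \<comment> \<open>The increment of (l + 2)^2 from \<open>l k\<close> to
    \<open>l (Suc k) = l k + 1\<close>.\<close>
  define d where "d k = 2 * l k + 5" for k
  have d0: "0 \<le> d k" for k using l_pos[of k] by (simp add: d_def)
  have tele: "(l m + 2)\<^sup>2 = (l 0 + 2)\<^sup>2 + (\<Sum>k<m. d k)" for m
    by (induction m) (auto simp: d_def l_Suc power2_eq_square algebra_simps)
  define G where "G z = ennreal ((l 0 + 2)\<^sup>2) + (\<Sum>k. ennreal (d k) * indicator (B (Suc k)) z)" for z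
  have G_ge: "ennreal ((g z)\<^sup>2) \<le> G z" for z
  proof (cases "z \<in> N")
    case True
    then show ?thesis using g by (simp add: singular_def)
  next
    case zN: False
    have "\<exists>m. (\<forall>k<m. z \<in> B (Suc k)) \<and> z \<notin> B (Suc m)"
    proof (cases "z \<in> B 0")
      case True
      then obtain m where "z \<in> B m" "z \<notin> B (Suc m)" by (rule exit_level[OF zN])
      moreover have "z \<in> B (Suc k)" if "k < m" for k
        using B_mono[of "Suc k" m] \<open>z \<in> B m\<close> that by auto
      ultimately show ?thesis by blast
    next
      case False
      then show ?thesis using B_mono[of 0 "Suc 0"] by blast
    qed
    then obtain m where m: "\<forall>k<m. z \<in> B (Suc k)" "z \<notin> B (Suc m)" by blast
    have "g z \<le> l m + 2" "0 \<le> g z" using g m(2) unfolding singular_def by blast+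
    then have "(g z)\<^sup>2 \<le> (l 0 + 2)\<^sup>2 + (\<Sum>k<m. d k)" unfolding tele[symmetric] by (intro power_mono) auto
    then have "ennreal ((g z)\<^sup>2) \<le> ennreal ((l 0 + 2)\<^sup>2 + (\<Sum>k<m. d k))" by (rule ennreal_leI)
    also have "\<dots> = ennreal ((l 0 + 2)\<^sup>2) + ennreal (\<Sum>k<m. d k)"
      by (rule ennreal_plus) (simp_all add: sum_nonneg d0)
    also have "ennreal (\<Sum>k<m. d k) = (\<Sum>k<m. ennreal (d k))" by (rule sum_ennreal[symmetric]) (rule d0)
    also have "\<dots> = (\<Sum>k<m. ennreal (d k) * indicator (B (Suc k)) z)"
      by (rule sum.cong) (use m(1) in simp_all)
    also have "ennreal ((l 0 + 2)\<^sup>2) + (\<Sum>k<m. ennreal (d k) * indicator (B (Suc k)) z) \<le> G z"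
      unfolding G_def by (intro add_left_mono sum_le_suminf) auto
    finally show ?thesis .
  qed
  have meas: "B k \<in> sets (lebesgue_on Q)" for k
    using B_subset(2)[of k] B_borel[of k] Q_open by (auto simp: sets_restrict_space_iff)
  have em: "emeasure (lebesgue_on Q) (B k) = ennreal (measure lebesgue (B k))" for k
    using B_subset(2)[of k] B_lmeasurable[of k] Q_open
    by (simp add: emeasure_restrict_space emeasure_eq_measure2)
  have coeff: "d k * measure lebesgue (B (Suc k)) \<le> (2 * p + 7) * C * real (Suc k) powr (1 - p)" for k
  proof -
    have "measure lebesgue (B (Suc k)) \<le> C * real (Suc (Suc k)) powr - p" by (rule C(2))
    also have "\<dots> \<le> C * real (Suc k) powr - p"
      using C(1) p_gt by (intro mult_left_mono powr_mono2') auto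
    finally have m: "measure lebesgue (B (Suc k)) \<le> C * real (Suc k) powr - p" .
    have "0 \<le> (2 * p + 5) * real k" using p_gt by simp
    then have "d k \<le> (2 * p + 7) * real (Suc k)" by (simp add: d_def l_def algebra_simps)
    then have "d k * measure lebesgue (B (Suc k)) \<le> (2 * p + 7) * real (Suc k) * (C * real (Suc k) powr - p)"
      using m p_gt by (intro mult_mono) auto
    also have "\<dots> = (2 * p + 7) * C * (real (Suc k) powr 1 * real (Suc k) powr - p)" by simp
    also have "\<dots> = (2 * p + 7) * C * real (Suc k) powr (1 - p)"
      unfolding powr_add[symmetric] by simp
    finally show ?thesis .
  qed
  have "summable (\<lambda>k. real (Suc k) powr (1 - p))"
    using p_gt summable_real_powr_iff[of "1 - p"] by (subst summable_Suc_iff) auto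
  then have "summable (\<lambda>k. (2 * p + 7) * C * real (Suc k) powr (1 - p))" by (rule summable_mult)
  then have sum: "summable (\<lambda>k. d k * measure lebesgue (B (Suc k)))"
    by (rule summable_comparison_test'[of _ 0]) (use coeff d0 in \<open>simp add: abs_mult\<close>)
  have "(\<integral>\<^sup>+z. G z \<partial>lebesgue_on Q) = ennreal ((l 0 + 2)\<^sup>2) * emeasure (lebesgue_on Q) Q
      + (\<Sum>k. ennreal (d k) * emeasure (lebesgue_on Q) (B (Suc k)))"
    unfolding G_def using meas Q_open
    by (subst nn_integral_add) (auto simp: nn_integral_suminf nn_integral_cmult_indicator nn_integral_cmult)
  also have "(\<Sum>k. ennreal (d k) * emeasure (lebesgue_on Q) (B (Suc k))) = ennreal (\<Sum>k. d k * measure lebesgue (B (Suc k)))"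
    using sum d0 by (simp add: em ennreal_mult[symmetric] suminf_ennreal2)
  also have "emeasure (lebesgue_on Q) Q = 2"
    using emeasure_lebesgue_Q Q_open by (simp add: emeasure_restrict_space)
  finally have fin: "(\<integral>\<^sup>+z. G z \<partial>lebesgue_on Q) < \<infinity>"
    by (simp add: ennreal_mult_eq_top_iff less_top[symmetric])
  have "(\<integral>\<^sup>+z. ennreal (norm ((g z)\<^sup>2)) \<partial>lebesgue_on Q) \<le> (\<integral>\<^sup>+z. G z \<partial>lebesgue_on Q)"
    by (rule nn_integral_mono) (use G_ge in simp)
  with fin have "(\<integral>\<^sup>+z. ennreal (norm ((g z)\<^sup>2)) \<partial>lebesgue_on Q) < \<infinity>" by (rule le_less_trans[rotated])
  moreover have "(\<lambda>z. (g z)\<^sup>2) \<in> borel_measurable (lebesgue_on Q)"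
    using g by (intro borel_measurable_lebesgue_on borel_measurable_power) (simp add: singular_def)
  ultimately show ?thesis by (intro integrableI_bounded)
qed

text \<open>Summation by levels: on \<open>B (Suc k)\<close> the function gains an increment of
  order k powr (p - 1), the measure is at least of order k powr - p, and the products sum to a
  harmonic series. Requiring the lower bound only for levels up to j, with c independent of f and j,
  lets one statement serve both the limit and its approximations.\<close>

lemma log_lower_bound:
  obtains c where "0 < c"
    "\<And>f j. \<lbrakk>integrable (lebesgue_on D) (\<lambda>z. \<bar>f z\<bar> powr p);
        \<And>z k. z \<notin> N \<Longrightarrow> k \<le> j \<Longrightarrow> z \<in> B k \<Longrightarrow> \<kappa> * l k \<le> f z; 1 \<le> j\<rbrakk>
      \<Longrightarrow> c * ln (real j) \<le> (\<integral>z. \<bar>f z\<bar> powr p \<partial>lebesgue_on D)"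
proof -
  obtain c where c: "0 < c" "\<And>k. c * real (Suc k) powr - p \<le> measure lebesgue (B k)"
    by (rule measure_B_bounds) blast
  \<comment> \<open>The increments of (\<kappa> l) powr p between consecutive levels; Bernoulli's
    inequality bounds them below by a multiple of (k + 1) powr (p - 1).\<close>
  define e where "e k = \<kappa> powr p * (l (Suc k) powr p - l k powr p)" for k
  have e0: "0 \<le> e k" for k
    unfolding e_def using l_pos[of k] p_gt l_Suc[of k] by (intro mult_nonneg_nonneg) (auto intro!: powr_mono2)
  have tele: "(\<Sum>k<m. e k) = \<kappa> powr p * (l m powr p - l 0 powr p)" for m
    by (induction m) (auto simp: e_def algebra_simps)
  have e_ge: "\<kappa> powr p * p * real (Suc k) powr (p - 1) \<le> e k" for k
  proof -
    have "1 + p * (1 / l k) \<le> (1 + 1 / l k) powr p" using l_pos[of k] p_gt by (intro Bernoulli_powr) auto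
    then have "l k powr p * (1 + p * (1 / l k)) \<le> l k powr p * (1 + 1 / l k) powr p" by (intro mult_left_mono) auto
    also have "\<dots> = (l k * (1 + 1 / l k)) powr p" using l_pos[of k] by (simp add: powr_mult)
    also have "l k * (1 + 1 / l k) = l (Suc k)" using l_pos[of k] by (simp add: l_Suc field_simps)
    finally have "p * (l k powr p / l k) \<le> l (Suc k) powr p - l k powr p" by (simp add: algebra_simps)
    also have "l k powr p / l k = l k powr (p - 1)" using l_pos[of k] by (simp add: powr_diff)
    finally have "p * l k powr (p - 1) \<le> l (Suc k) powr p - l k powr p" .
    moreover have "p * real (Suc k) powr (p - 1) \<le> p * l k powr (p - 1)"
      using p_gt by (intro mult_left_mono powr_mono2) (auto simp: l_def)
    ultimately have "p * real (Suc k) powr (p - 1) \<le> l (Suc k) powr p - l k powr p" by linarith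
    then have "\<kappa> powr p * (p * real (Suc k) powr (p - 1)) \<le> e k" unfolding e_def by (rule mult_left_mono) simp
    then show ?thesis by (simp add: mult.assoc)
  qed
  define c' where "c' = \<kappa> powr p * p * c * 2 powr - p"
  have "0 < c'" using c kappa p_gt by (simp add: c'_def)
  moreover have "c' * ln (real j) \<le> (\<integral>z. \<bar>f z\<bar> powr p \<partial>lebesgue_on D)"
    if int: "integrable (lebesgue_on D) (\<lambda>z. \<bar>f z\<bar> powr p)"
      and low: "\<And>z k. z \<notin> N \<Longrightarrow> k \<le> j \<Longrightarrow> z \<in> B k \<Longrightarrow> \<kappa> * l k \<le> f z" and j: "1 \<le> j" for f j
  proof -
    have "c' * ln (real j) \<le> c' * harm j"
      using \<open>0 < c'\<close> ln_le_harm[of j] j by (intro mult_left_mono) (auto intro: order_trans[rotated])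
    also have "\<dots> = (\<Sum>k<j. c' * inverse (real (Suc k)))"
      by (simp add: harm_def sum_distrib_left lessThan_atLeast0 sum.atLeast1_atMost_eq del: of_nat_Suc)
    also have "\<dots> \<le> (\<Sum>k<j. e k * measure lebesgue (B (Suc k)))"
    proof (rule sum_mono)
      fix k
      have "(2 * real (Suc k)) powr - p \<le> real (Suc (Suc k)) powr - p"
        using p_gt by (intro powr_mono2') auto
      also have "(2 * real (Suc k)) powr - p = 2 powr - p * real (Suc k) powr - p"
        by (subst powr_mult) simp_all
      finally have "c * (2 powr - p * real (Suc k) powr - p) \<le> c * real (Suc (Suc k)) powr - p"
        using c(1) by (intro mult_left_mono) auto
      then have m: "c * (2 powr - p * real (Suc k) powr - p) \<le> measure lebesgue (B (Suc k))"
        using c(2)[of "Suc k"] by linarith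
      have "c' * inverse (real (Suc k)) = c' * (real (Suc k) powr (p - 1) * real (Suc k) powr - p)"
        unfolding powr_add[symmetric] by (simp add: powr_minus)
      also have "\<dots> = (\<kappa> powr p * p * real (Suc k) powr (p - 1)) * (c * (2 powr - p * real (Suc k) powr - p))"
        by (simp add: c'_def mult_ac)
      also have "\<dots> \<le> e k * measure lebesgue (B (Suc k))"
        using e_ge m e0 c(1) by (intro mult_mono) auto
      finally show "c' * inverse (real (Suc k)) \<le> e k * measure lebesgue (B (Suc k))" .
    qed
    also have "\<dots> = (\<integral>z. (\<Sum>k<j. e k * indicator (B (Suc k)) z) \<partial>lebesgue_on D)"
    proof (subst Bochner_Integration.integral_sum)
      have meas: "B (Suc k) \<in> sets (lebesgue_on D)" for k
        using B_subset(1)[of "Suc k"] B_borel[of "Suc k"] D_open by (auto simp: sets_restrict_space_iff)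
      have m: "measure (lebesgue_on D) (B (Suc k)) = measure lebesgue (B (Suc k))" for k
        using B_subset(1)[of "Suc k"] D_open by (simp add: measure_restrict_space)
      show "integrable (lebesgue_on D) (\<lambda>z. e k * indicator (B (Suc k)) z)" if "k \<in> {..<j}" for k
        using B_subset(1)[of "Suc k"] B_lmeasurable[of "Suc k"] D_open meas[of k]
        by (intro integrable_mult_right integrable_real_indicator)
          (auto simp: emeasure_restrict_space fmeasurable_def)
      show "(\<Sum>k<j. e k * measure lebesgue (B (Suc k))) =
          (\<Sum>k<j. \<integral>z. e k * indicator (B (Suc k)) z \<partial>lebesgue_on D)"
        using meas by (simp add: m Int_absorb2[OF B_subset(1)])
    qed
    also have "\<dots> \<le> (\<integral>z. \<bar>f z\<bar> powr p \<partial>lebesgue_on D)"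
    proof (rule integral_mono_AE[OF _ int])
      show "integrable (lebesgue_on D) (\<lambda>z. \<Sum>k<j. e k * indicator (B (Suc k)) z)"
      proof (intro Bochner_Integration.integrable_sum integrable_mult_right integrable_real_indicator)
        fix k
        show "B (Suc k) \<in> sets (lebesgue_on D)" "emeasure (lebesgue_on D) (B (Suc k)) < \<infinity>"
          using B_subset(1)[of "Suc k"] B_lmeasurable[of "Suc k"] B_borel[of "Suc k"] D_open
          by (auto simp: sets_restrict_space_iff emeasure_restrict_space fmeasurable_def)
      qed
      have "AE z in lebesgue_on D. z \<notin> N" using AE_not_N D_open by simp
      moreover have "AE z in lebesgue_on D. z \<in> D" using AE_space[of "lebesgue_on D"] by (simp add: space_restrict_space)
      ultimately show "AE z in lebesgue_on D. (\<Sum>k<j. e k * indicator (B (Suc k)) z) \<le> \<bar>f z\<bar> powr p"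
      proof eventually_elim
        case (elim z)
        then obtain m where m: "z \<in> B m" "z \<notin> B (Suc m)"
          using exit_level[of z 0] by (auto simp: B_0)
        \<comment> \<open>The point may go deeper than j, but the hypothesis on f reaches only to
          level j; the indicators with k < j see no more than that either.\<close>
        define n where "n = min m j"
        have n: "z \<in> B n" "n \<le> j" using m(1) B_mono[of n m] by (auto simp: n_def)
        have "(\<Sum>k<j. e k * indicator (B (Suc k)) z) = (\<Sum>k<n. e k * indicator (B (Suc k)) z)"
        proof (rule sum.mono_neutral_right)
          show "\<forall>k\<in>{..<j} - {..<n}. e k * indicator (B (Suc k)) z = 0"
          proof
            fix k assume "k \<in> {..<j} - {..<n}"
            then have "m \<le> k" by (auto simp: n_def)
            then have "z \<notin> B (Suc k)" using m(2) B_mono[of "Suc m" "Suc k"] by auto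
            then show "e k * indicator (B (Suc k)) z = 0" by simp
          qed
        qed (auto simp: n_def)
        also have "\<dots> \<le> (\<Sum>k<n. e k)" by (rule sum_mono) (use e0 in \<open>auto simp: indicator_def\<close>)
        also have "\<dots> \<le> \<kappa> powr p * l n powr p" by (simp add: tele algebra_simps)
        also have "\<dots> = (\<kappa> * l n) powr p" using kappa l_pos[of n] by (simp add: powr_mult)
        also have "\<dots> \<le> \<bar>f z\<bar> powr p"
          using low[OF elim(1) n(2,1)] kappa l_pos[of n] p_gt by (intro powr_mono2) auto
        finally show ?case .
      qed
    qed
    finally show ?thesis .
  qed
  ultimately show ?thesis using that by blast
qed

text \<open>A finite integral would bound c ln j for every j, since the lower bound on g holds at
  all levels.\<close>

lemma singular_not_Lp:
  assumes g: "singular g"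
  shows "g \<notin> Lp p D"
proof
  assume "g \<in> Lp p D"
  then have int: "integrable (lebesgue_on D) (\<lambda>z. \<bar>g z\<bar> powr p)" by (simp add: Lp_def)
  obtain c where c: "0 < c"
    "\<And>f j. \<lbrakk>integrable (lebesgue_on D) (\<lambda>z. \<bar>f z\<bar> powr p);
        \<And>z k. z \<notin> N \<Longrightarrow> k \<le> j \<Longrightarrow> z \<in> B k \<Longrightarrow> \<kappa> * l k \<le> f z; 1 \<le> j\<rbrakk>
      \<Longrightarrow> c * ln (real j) \<le> (\<integral>z. \<bar>f z\<bar> powr p \<partial>lebesgue_on D)"
    by (rule log_lower_bound) blast
  define I where "I = (\<integral>z. \<bar>g z\<bar> powr p \<partial>lebesgue_on D)"
  have le: "c * ln (real j) \<le> I" if "1 \<le> j" for j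
    unfolding I_def by (rule c(2)[OF int _ that]) (use g in \<open>auto simp: singular_def\<close>)
  obtain j :: nat where j: "exp (I / c + 1) < real j" using reals_Archimedean2 by blast
  then have "1 \<le> j" using exp_gt_zero[of "I / c + 1"] by (cases j) auto
  have "I / c + 1 < ln (real j)" using j ln_less_cancel_iff[of "exp (I / c + 1)" "real j"] \<open>1 \<le> j\<close> by simp
  then have "c * (I / c + 1) < c * ln (real j)" using c(1) by (intro mult_strict_left_mono)
  moreover have "c * (I / c + 1) = I + c" using c(1) by (simp add: field_simps)
  ultimately show False using le[OF \<open>1 \<le> j\<close>] c(1) by linarith
qed

end

section \<open>Bounds for test functions and cutoffs of intervals\<close>

lemma abs_powr_2: "\<bar>x\<bar> powr 2 = x\<^sup>2" for x :: real
  by (cases "x = 0") (simp_all add: powr_numeral)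

lemma test_function_bounded:
  assumes "\<phi> \<in> test_functions \<Omega>"
  obtains C where "\<And>z. \<bar>\<phi> z\<bar> \<le> C" "\<And>z. \<bar>Dt \<phi> z\<bar> \<le> C" "\<And>z. \<bar>Dx \<phi> z\<bar> \<le> C"
proof -
  note \<phi> = test_functionD[OF assms]
  obtain C0 where C0: "\<And>z. \<bar>\<phi> z\<bar> \<le> C0"
    by (rule supported_continuous_bounded[OF \<phi>(2,5)]) blast
  obtain C1 where C1: "\<And>z. \<bar>Dt \<phi> z\<bar> \<le> C1"
    by (rule supported_continuous_bounded[OF \<phi>(3) supported_in_partials(1)[OF \<phi>(5)]]) blast
  obtain C2 where C2: "\<And>z. \<bar>Dx \<phi> z\<bar> \<le> C2"
    by (rule supported_continuous_bounded[OF \<phi>(4) supported_in_partials(2)[OF \<phi>(5)]]) blast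
  show ?thesis
  proof
    show "\<bar>\<phi> z\<bar> \<le> max C0 (max C1 C2)" "\<bar>Dt \<phi> z\<bar> \<le> max C0 (max C1 C2)"
      "\<bar>Dx \<phi> z\<bar> \<le> max C0 (max C1 C2)" for z
      using C0[of z] C1[of z] C2[of z] by linarith+
  qed
qed

lemma test_function_measurable:
  assumes "\<phi> \<in> test_functions \<Omega>"
  shows "\<phi> \<in> borel_measurable (lebesgue_on A)" "Dt \<phi> \<in> borel_measurable (lebesgue_on A)"
    "Dx \<phi> \<in> borel_measurable (lebesgue_on A)"
  by (intro borel_measurable_lebesgue_on borel_measurable_continuous_onI test_functionD[OF assms])+

lemma partials_cong_open:
  fixes f g :: "real \<times> real \<Rightarrow> real"
  assumes "open A" "\<And>z. z \<in> A \<Longrightarrow> f z = g z" "z \<in> A"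
  shows "Dt f z = Dt g z" "Dx f z = Dx g z"
proof -
  have op: "open ((\<lambda>s. (s, snd z)) -` A)" "open ((\<lambda>y. (fst z, y)) -` A)"
    using assms(1) by (auto intro!: open_vimage continuous_intros)
  have "eventually (\<lambda>s. f (s, snd z) = g (s, snd z)) (nhds (fst z))"
    unfolding eventually_nhds
    by (intro exI[of _ "(\<lambda>s. (s, snd z)) -` A"] conjI op) (simp_all add: assms(2,3))
  from deriv_cong_ev[OF this refl] show "Dt f z = Dt g z" unfolding Dt_def .
  have "eventually (\<lambda>y. f (fst z, y) = g (fst z, y)) (nhds (snd z))"
    unfolding eventually_nhds
    by (intro exI[of _ "(\<lambda>y. (fst z, y)) -` A"] conjI op) (simp_all add: assms(2,3))
  from deriv_cong_ev[OF this refl] show "Dx f z = Dx g z" unfolding Dx_def .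
qed

lemma interval_cutoff_exists:
  fixes s t \<delta> :: real
  assumes "s \<le> t" "0 < \<delta>"
  obtains f where "smooth f" "supported_in f {s - 2 * \<delta><..<t + 2 * \<delta>}"
    "\<And>x. s \<le> x \<Longrightarrow> x \<le> t \<Longrightarrow> f x = 1"
proof -
  obtain b :: "real \<Rightarrow> real" where b: "smooth b" "\<And>x. \<bar>x\<bar> \<le> (t - s) / 2 \<Longrightarrow> b x = 1"
    "\<And>x. (t - s) / 2 + \<delta> \<le> \<bar>x\<bar> \<Longrightarrow> b x = 0"
    by (rule smooth_bump_exists[of "(t - s) / 2" "(t - s) / 2 + \<delta>"]) (use assms in auto)
  define f where "f x = b (1 * x + (- ((s + t) / 2)))" for x
  show ?thesis
  proof
    show "smooth f" unfolding f_def by (rule smooth_affine[OF b(1)])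
    show "supported_in f {s - 2 * \<delta><..<t + 2 * \<delta>}" unfolding supported_in_def
    proof (intro exI[of _ "{s - \<delta>..t + \<delta>}"] conjI allI impI)
      fix x assume "x \<notin> {s - \<delta>..t + \<delta>}"
      then show "f x = 0" unfolding f_def by (intro b(3)) (auto simp: abs_if field_simps)
    qed (use assms in auto)
    show "f x = 1" if "s \<le> x" "x \<le> t" for x
      unfolding f_def by (rule b(2)) (use that in \<open>auto simp: abs_if field_simps\<close>)
  qed
qed

section \<open>The limit function and its weak derivatives\<close>

context staircase
begin

lemma geometric_sum: "(\<Sum>k<n. (1 / 2 :: real) ^ (k + 2)) \<le> 1"
proof -
  have "(\<Sum>k<n. (1 / 2 :: real) ^ (k + 2)) = 1 / 2 - (1 / 2) ^ (n + 1)"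
    by (induction n) (auto simp: field_simps)
  moreover have "(0 :: real) \<le> (1 / 2) ^ (n + 1)" by simp
  ultimately show ?thesis by linarith
qed

lemma geometric_summable: "summable (\<lambda>k. (1 / 2 :: real) ^ (k + 2))"
  using summable_ignore_initial_segment[OF summable_geometric[of "1 / 2 :: real"], of 2] by simp

lemma W_sums: "\<bar>\<Sum>k<n. W k z\<bar> \<le> 1" "\<bar>\<Sum>k<n. Dx (W k) z\<bar> \<le> 1"
proof -
  have "\<bar>\<Sum>k<n. W k z\<bar> \<le> (\<Sum>k<n. (1 / 2) ^ (k + 2))" "\<bar>\<Sum>k<n. Dx (W k) z\<bar> \<le> (\<Sum>k<n. (1 / 2) ^ (k + 2))"
    by (rule order_trans[OF sum_abs sum_mono]; rule W_small)+
  then show "\<bar>\<Sum>k<n. W k z\<bar> \<le> 1" "\<bar>\<Sum>k<n. Dx (W k) z\<bar> \<le> 1"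
    using geometric_sum[of n] by linarith+
qed

definition u :: "real \<times> real \<Rightarrow> real" where "u z = u0 z + (\<Sum>k. W k z)"
definition ux :: "real \<times> real \<Rightarrow> real" where "ux z = l 0 * snd z + (\<Sum>k. Dx (W k) z)"

text \<open>Weierstrass' test applies to the corrections and to their x-derivatives, both bounded by
  2^-(k+2). The second derivatives have no such bound and are treated by domination instead.\<close>

lemma u_continuous: "continuous_on A u" and ux_continuous: "continuous_on A ux"
proof -
  have "uniform_limit A (\<lambda>n z. \<Sum>k<n. W k z) (\<lambda>z. \<Sum>k. W k z) sequentially"
    "uniform_limit A (\<lambda>n z. \<Sum>k<n. Dx (W k) z) (\<lambda>z. \<Sum>k. Dx (W k) z) sequentially"
    by (rule Weierstrass_m_test[OF _ geometric_summable]; simp only: real_norm_def W_small)+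
  note ul = this
  have "continuous_on A (\<lambda>z. \<Sum>k. W k z)"
    by (rule uniform_limit_theorem[OF _ ul(1)], rule always_eventually, rule allI,
        rule continuous_on_sum, rule tame_continuous_on[OF W_tame]) simp
  from continuous_on_add[OF tame_continuous_on[OF u0_tame] this] show "continuous_on A u"
    unfolding u_def[abs_def] .
  have "continuous_on A (\<lambda>z. \<Sum>k. Dx (W k) z)"
    by (rule uniform_limit_theorem[OF _ ul(2)], rule always_eventually, rule allI,
        rule continuous_on_sum, rule tame_continuous_on[OF tame_Dx[OF W_tame]]) simp
  then show "continuous_on A ux" unfolding ux_def[abs_def]
    by (intro continuous_on_add continuous_intros)
qed

lemma U_pointwise_limits: "(\<lambda>m. U m z) \<longlonglongrightarrow> u z" "(\<lambda>m. Dx (U m) z) \<longlonglongrightarrow> ux z"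
proof -
  have "summable (\<lambda>k. W k z)" "summable (\<lambda>k. Dx (W k) z)"
    by (rule summable_comparison_test'[OF geometric_summable, of 0]; simp only: real_norm_def W_small)+
  note s = this
  show "(\<lambda>m. U m z) \<longlonglongrightarrow> u z" "(\<lambda>m. Dx (U m) z) \<longlonglongrightarrow> ux z"
    unfolding U_def u_def Dx_U ux_def
    by (rule tendsto_add[OF tendsto_const summable_LIMSEQ[OF s(1)]]
        tendsto_add[OF tendsto_const summable_LIMSEQ[OF s(2)]])+
qed

lemma u0_bounded_Q:
  assumes "z \<in> Q"
  shows "\<bar>u0 z\<bar> \<le> 2 * l 0" "\<bar>l 0 * snd z\<bar> \<le> l 0"
proof -
  have z: "\<bar>fst z\<bar> \<le> 1" "\<bar>snd z\<bar> \<le> 1" using assms by (auto simp: Q_def)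
  have "\<bar>l 0 * fst z\<bar> \<le> l 0 * 1" "\<bar>l 0 * snd z\<bar> \<le> l 0 * 1" "\<bar>snd z * snd z\<bar> \<le> 1 * 1"
    by (rule abs_mult_le; use z l_pos[of 0] in simp)+
  moreover from this(3) have "\<bar>l 0 / 2 * (snd z * snd z)\<bar> \<le> l 0 / 2 * 1"
    using l_pos[of 0] by (intro abs_mult_le) auto
  ultimately show "\<bar>u0 z\<bar> \<le> 2 * l 0" "\<bar>l 0 * snd z\<bar> \<le> l 0"
    unfolding u0_def using l_pos[of 0] by (simp_all only: mult_1_right mult_1_left; linarith)+
qed

lemma U_bounded_Q:
  assumes "z \<in> Q"
  shows "\<bar>U m z\<bar> \<le> 2 * l 0 + 1" "\<bar>Dx (U m) z\<bar> \<le> 2 * l 0 + 1"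
  unfolding U_def Dx_U
  using u0_bounded_Q[OF assms] W_sums[where n = m and z = z] l_pos[of 0] by linarith+

lemma u_bounded_Q:
  assumes "z \<in> Q"
  shows "\<bar>u z\<bar> \<le> 2 * l 0 + 1" "\<bar>ux z\<bar> \<le> 2 * l 0 + 1"
  by (rule Lim_bounded[OF tendsto_rabs[OF U_pointwise_limits(1)], of 0], rule allI, rule impI, rule U_bounded_Q[OF assms])
    (rule Lim_bounded[OF tendsto_rabs[OF U_pointwise_limits(2)], of 0], rule allI, rule impI, rule U_bounded_Q[OF assms])

lemma singular_integrable:
  assumes g: "singular g"
  shows "integrable (lebesgue_on Q) g"
proof (rule Bochner_Integration.integrable_bound)
  show "integrable (lebesgue_on Q) (\<lambda>z. 1 + (g z)\<^sup>2)"
    by (intro Bochner_Integration.integrable_add singular_square_integrable[OF g]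
        integrable_lebesgue_on_bounded[OF _ Q_lmeasurable]) auto
  show "g \<in> borel_measurable (lebesgue_on Q)" by (rule borel_measurable_lebesgue_on[OF singularD(1)[OF g]])
  have "x \<le> 1 + x\<^sup>2" for x :: real using zero_le_power2[of "x - 1/2"] by (simp add: power2_eq_square algebra_simps)
  then show "AE z in lebesgue_on Q. norm (g z) \<le> norm (1 + (g z)\<^sup>2)"
    using singularD(2)[OF g] by (intro AE_I2) simp
qed

lemma integrable_continuous_Q:
  fixes f :: "real \<times> real \<Rightarrow> real"
  assumes "continuous_on UNIV f" "\<And>z. z \<in> Q \<Longrightarrow> \<bar>f z\<bar> \<le> C"
  shows "integrable (lebesgue_on Q) f"
  by (rule integrable_lebesgue_on_bounded[OF borel_measurable_lebesgue_on[OF borel_measurable_continuous_onI[OF assms(1)]]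
        Q_lmeasurable assms(2)])

lemma tame_integrable_Q:
  assumes "tame w"
  shows "integrable (lebesgue_on Q) w"
proof -
  have "compact (w ` ({-1..0} \<times> {-1..1}))"
    by (intro compact_continuous_image tame_continuous_on[OF assms] compact_Times compact_Icc)
  then obtain C where C: "\<And>y. y \<in> w ` ({-1..0} \<times> {-1..1}) \<Longrightarrow> \<bar>y\<bar> \<le> C"
    using compact_imp_bounded bounded_iff real_norm_def by metis
  have "\<bar>w z\<bar> \<le> C" if "z \<in> Q" for z
    by (rule C[OF imageI]) (use that in \<open>auto simp: Q_def\<close>)
  then show ?thesis by (rule integrable_continuous_Q[OF tame_continuous_on[OF assms]])
qed

text \<open>Dominated convergence: constants dominate the partial sums and their x-derivatives on Q,
  and \<open>ut / \<kappa>\<close> and \<open>uxx / \<kappa>\<close> dominate the derivatives that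
  blow up.\<close>

lemma limit_integrals:
  assumes "\<psi> \<in> borel_measurable (lebesgue_on Q)" "\<And>z. \<bar>\<psi> z\<bar> \<le> C"
  shows "(\<lambda>m. \<integral>z. U m z * \<psi> z \<partial>lebesgue_on Q) \<longlonglongrightarrow> (\<integral>z. u z * \<psi> z \<partial>lebesgue_on Q)"
    and "(\<lambda>m. \<integral>z. Dx (U m) z * \<psi> z \<partial>lebesgue_on Q) \<longlonglongrightarrow> (\<integral>z. ux z * \<psi> z \<partial>lebesgue_on Q)"
    and "(\<lambda>m. \<integral>z. Dt (U m) z * \<psi> z \<partial>lebesgue_on Q) \<longlonglongrightarrow> (\<integral>z. ut z * \<psi> z \<partial>lebesgue_on Q)"
    and "(\<lambda>m. \<integral>z. Dx (Dx (U m)) z * \<psi> z \<partial>lebesgue_on Q) \<longlonglongrightarrow> (\<integral>z. uxx z * \<psi> z \<partial>lebesgue_on Q)"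
proof -
  have meas: "f \<in> borel_measurable (lebesgue_on Q)" if "tame f" for f
    by (rule borel_measurable_lebesgue_on[OF tame_borel_measurable[OF that]])
  have meas': "f \<in> borel_measurable (lebesgue_on Q)" if "continuous_on UNIV f" for f :: "real \<times> real \<Rightarrow> real"
    by (rule borel_measurable_lebesgue_on[OF borel_measurable_continuous_onI[OF that]])
  have const: "integrable (lebesgue_on Q) (\<lambda>z. 2 * l 0 + 1)"
    by (rule integrable_lebesgue_on_bounded[OF _ Q_lmeasurable]) auto
  have Q: "AE z in lebesgue_on Q. z \<in> Q"
    using AE_space[of "lebesgue_on Q"] by (simp add: space_restrict_space)
  have notN: "AE z in lebesgue_on Q. z \<notin> N" using AE_not_N Q_open by simp
  show "(\<lambda>m. \<integral>z. U m z * \<psi> z \<partial>lebesgue_on Q) \<longlonglongrightarrow> (\<integral>z. u z * \<psi> z \<partial>lebesgue_on Q)"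
  proof (rule integral_mult_limit[OF meas[OF U_tame] meas'[OF u_continuous] const _ _ assms])
    show "AE z in lebesgue_on Q. \<bar>U m z\<bar> \<le> 2 * l 0 + 1" for m
      using Q by eventually_elim (rule U_bounded_Q)
  qed (intro AE_I2 U_pointwise_limits)
  show "(\<lambda>m. \<integral>z. Dx (U m) z * \<psi> z \<partial>lebesgue_on Q) \<longlonglongrightarrow> (\<integral>z. ux z * \<psi> z \<partial>lebesgue_on Q)"
  proof (rule integral_mult_limit[OF meas[OF tame_Dx[OF U_tame]] meas'[OF ux_continuous] const _ _ assms])
    show "AE z in lebesgue_on Q. \<bar>Dx (U m) z\<bar> \<le> 2 * l 0 + 1" for m
      using Q by eventually_elim (rule U_bounded_Q)
  qed (intro AE_I2 U_pointwise_limits)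
  show "(\<lambda>m. \<integral>z. Dt (U m) z * \<psi> z \<partial>lebesgue_on Q) \<longlonglongrightarrow> (\<integral>z. ut z * \<psi> z \<partial>lebesgue_on Q)"
  proof (rule integral_mult_limit[OF meas[OF tame_Dt[OF U_tame]]
        borel_measurable_lebesgue_on[OF values_measurable(1)] _ _ _ assms])
    show "integrable (lebesgue_on Q) (\<lambda>z. ut z / \<kappa>)"
      using singular_integrable[OF singular_values(1)] by simp
    show "AE z in lebesgue_on Q. (\<lambda>m. Dt (U m) z) \<longlonglongrightarrow> ut z"
      using notN by eventually_elim (rule U_limits)
    show "AE z in lebesgue_on Q. \<bar>Dt (U m) z\<bar> \<le> ut z / \<kappa>" for m
      using notN by eventually_elim (rule U_dominated)
  qed
  show "(\<lambda>m. \<integral>z. Dx (Dx (U m)) z * \<psi> z \<partial>lebesgue_on Q) \<longlonglongrightarrow> (\<integral>z. uxx z * \<psi> z \<partial>lebesgue_on Q)"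
  proof (rule integral_mult_limit[OF meas[OF tame_Dx[OF tame_Dx[OF U_tame]]]
        borel_measurable_lebesgue_on[OF values_measurable(2)] _ _ _ assms])
    show "integrable (lebesgue_on Q) (\<lambda>z. uxx z / \<kappa>)"
      using singular_integrable[OF singular_values(2)] by simp
    show "AE z in lebesgue_on Q. (\<lambda>m. Dx (Dx (U m)) z) \<longlonglongrightarrow> uxx z"
      using notN by eventually_elim (rule U_limits)
    show "AE z in lebesgue_on Q. \<bar>Dx (Dx (U m)) z\<bar> \<le> uxx z / \<kappa>" for m
      using notN by eventually_elim (rule U_dominated)
  qed
qed

lemma integrable_limits:
  "integrable (lebesgue_on Q) u" "integrable (lebesgue_on Q) ux"
  "integrable (lebesgue_on Q) ut" "integrable (lebesgue_on Q) uxx"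
  by (rule integrable_continuous_Q[OF u_continuous u_bounded_Q(1)], assumption)
    (rule integrable_continuous_Q[OF ux_continuous u_bounded_Q(2)] singular_integrable
      singular_values | assumption)+

lemmas loc_integrable_Q = integrable_imp_loc_integrable[OF _ Q_open]

text \<open>Integration by parts is exact for each smooth partial sum, and both sides converge by
  \<open>limit_integrals\<close>. In particular the null set \<open>N\<close> carries no singular
  part of the derivatives.\<close>

lemma limit_weak_derivatives: "has_weak_dx Q u ux" "has_weak_dt Q u ut" "has_weak_dx Q ux uxx"
proof -
  show "has_weak_dx Q u ux" unfolding has_weak_dx_def
  proof (intro conjI ballI loc_integrable_Q integrable_limits)
    fix \<phi> assume \<phi>: "\<phi> \<in> test_functions Q"
    note m = test_function_measurable[OF \<phi>, of Q]
    obtain C where C: "\<And>z. \<bar>\<phi> z\<bar> \<le> C" "\<And>z. \<bar>Dt \<phi> z\<bar> \<le> C" "\<And>z. \<bar>Dx \<phi> z\<bar> \<le> C"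
      by (rule test_function_bounded[OF \<phi>]) blast
    have "(\<lambda>m. \<integral>z. U m z * Dx \<phi> z \<partial>lebesgue_on Q) \<longlonglongrightarrow> - (\<integral>z. ux z * \<phi> z \<partial>lebesgue_on Q)"
      unfolding integration_by_parts(2)[OF U_tame \<phi> Q_open]
      by (intro tendsto_minus limit_integrals(2)[OF m(1) C(1)])
    then show "(\<integral>z. u z * Dx \<phi> z \<partial>lebesgue_on Q) = - (\<integral>z. ux z * \<phi> z \<partial>lebesgue_on Q)"
      by (rule LIMSEQ_unique[OF limit_integrals(1)[OF m(3) C(3)]])
  qed
  show "has_weak_dt Q u ut" unfolding has_weak_dt_def
  proof (intro conjI ballI loc_integrable_Q integrable_limits)
    fix \<phi> assume \<phi>: "\<phi> \<in> test_functions Q"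
    note m = test_function_measurable[OF \<phi>, of Q]
    obtain C where C: "\<And>z. \<bar>\<phi> z\<bar> \<le> C" "\<And>z. \<bar>Dt \<phi> z\<bar> \<le> C" "\<And>z. \<bar>Dx \<phi> z\<bar> \<le> C"
      by (rule test_function_bounded[OF \<phi>]) blast
    have "(\<lambda>m. \<integral>z. U m z * Dt \<phi> z \<partial>lebesgue_on Q) \<longlonglongrightarrow> - (\<integral>z. ut z * \<phi> z \<partial>lebesgue_on Q)"
      unfolding integration_by_parts(1)[OF U_tame \<phi> Q_open]
      by (intro tendsto_minus limit_integrals(3)[OF m(1) C(1)])
    then show "(\<integral>z. u z * Dt \<phi> z \<partial>lebesgue_on Q) = - (\<integral>z. ut z * \<phi> z \<partial>lebesgue_on Q)"
      by (rule LIMSEQ_unique[OF limit_integrals(1)[OF m(2) C(2)]])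
  qed
  show "has_weak_dx Q ux uxx" unfolding has_weak_dx_def
  proof (intro conjI ballI loc_integrable_Q integrable_limits)
    fix \<phi> assume \<phi>: "\<phi> \<in> test_functions Q"
    note m = test_function_measurable[OF \<phi>, of Q]
    obtain C where C: "\<And>z. \<bar>\<phi> z\<bar> \<le> C" "\<And>z. \<bar>Dt \<phi> z\<bar> \<le> C" "\<And>z. \<bar>Dx \<phi> z\<bar> \<le> C"
      by (rule test_function_bounded[OF \<phi>]) blast
    have "(\<lambda>m. \<integral>z. Dx (U m) z * Dx \<phi> z \<partial>lebesgue_on Q) \<longlonglongrightarrow> - (\<integral>z. uxx z * \<phi> z \<partial>lebesgue_on Q)"
      unfolding integration_by_parts(2)[OF tame_Dx[OF U_tame] \<phi> Q_open]
      by (intro tendsto_minus limit_integrals(4)[OF m(1) C(1)])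
    then show "(\<integral>z. ux z * Dx \<phi> z \<partial>lebesgue_on Q) = - (\<integral>z. uxx z * \<phi> z \<partial>lebesgue_on Q)"
      by (rule LIMSEQ_unique[OF limit_integrals(2)[OF m(3) C(3)]])
  qed
qed

text \<open>Both integrals equal minus the integral of \<phi> times the mixed derivative of w. Only
  first derivatives of w remain in the identity, so it is stable under the limit; it is the weak
  form of differentiating w_t in x.\<close>

lemma tame_cross_derivatives:
  assumes w: "tame w" and \<phi>: "\<phi> \<in> test_functions Q"
  shows "(\<integral>z. Dx w z * Dt \<phi> z \<partial>lebesgue_on Q) = (\<integral>z. Dt w z * Dx \<phi> z \<partial>lebesgue_on Q)"
  unfolding integration_by_parts(1)[OF tame_Dx[OF w] \<phi> Q_open]
    integration_by_parts(2)[OF tame_Dt[OF w] \<phi> Q_open] tame_Dt_Dx[OF w] ..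

text \<open>With v = u_x the flux a v_x is u_t itself, so the equation is the limit of the identity
  in \<open>tame_cross_derivatives\<close>.\<close>

lemma ux_weak_div_solution: "weak_div_solution Q a (\<lambda>_. 0) ux"
  unfolding weak_div_solution_def
proof (intro conjI exI[of _ uxx] ballI limit_weak_derivatives loc_integrable_Q)
  show "integrable (lebesgue_on Q) (\<lambda>z. a z * uxx z)" unfolding a_times_uxx by (rule integrable_limits)
  fix \<phi> assume \<phi>: "\<phi> \<in> test_functions Q"
  note m = test_function_measurable[OF \<phi>, of Q]
  obtain C where C: "\<And>z. \<bar>\<phi> z\<bar> \<le> C" "\<And>z. \<bar>Dt \<phi> z\<bar> \<le> C" "\<And>z. \<bar>Dx \<phi> z\<bar> \<le> C"
    by (rule test_function_bounded[OF \<phi>]) blast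
  have "(\<lambda>m. \<integral>z. Dx (U m) z * Dt \<phi> z \<partial>lebesgue_on Q) \<longlonglongrightarrow> (\<integral>z. ut z * Dx \<phi> z \<partial>lebesgue_on Q)"
    unfolding tame_cross_derivatives[OF U_tame \<phi>] by (rule limit_integrals(3)[OF m(3) C(3)])
  then have "(\<integral>z. ux z * Dt \<phi> z \<partial>lebesgue_on Q) = (\<integral>z. ut z * Dx \<phi> z \<partial>lebesgue_on Q)"
    by (rule LIMSEQ_unique[OF limit_integrals(2)[OF m(2) C(2)]])
  moreover have "(\<integral>z. (ux z * Dt \<phi> z - a z * uxx z * Dx \<phi> z) \<partial>lebesgue_on Q)
    = (\<integral>z. ux z * Dt \<phi> z \<partial>lebesgue_on Q) - (\<integral>z. ut z * Dx \<phi> z \<partial>lebesgue_on Q)"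
    unfolding a_times_uxx
    by (intro Bochner_Integration.integral_diff integrable_mult_bounded[OF integrable_limits(2) m(2) C(2)]
        integrable_mult_bounded[OF integrable_limits(3) m(3) C(3)])
  ultimately show "(\<integral>z. (ux z * Dt \<phi> z - a z * uxx z * Dx \<phi> z) \<partial>lebesgue_on Q)
    = (\<integral>z. 0 * Dx \<phi> z \<partial>lebesgue_on Q)" by simp
qed simp

text \<open>Meant for errors of size \<open>A2\<close> on a small set E and of bounded size
  elsewhere; the factor 2 is the measure of Q. The bound stays finite as \<open>A2\<close> grows,
  provided that the measure of E decays accordingly.\<close>

lemma Lp_step_bound:
  assumes f: "f \<in> borel_measurable (lebesgue_on Q)" and E: "E \<in> sets borel" "E \<subseteq> Q" and A: "0 \<le> A1" "0 \<le> A2" "0 < q"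
    and le: "\<And>z. z \<in> Q \<Longrightarrow> z \<notin> E \<Longrightarrow> \<bar>f z\<bar> \<le> A1" "\<And>z. z \<in> E \<Longrightarrow> \<bar>f z\<bar> \<le> A2"
  shows "f \<in> Lp q Q" "Lp_norm q Q f \<le> (2 * A1 powr q + A2 powr q * measure lebesgue E) powr (1 / q)"
proof -
  have EQ: "E \<in> sets (lebesgue_on Q)" using E Q_open by (simp add: sets_restrict_space_iff)
  have h1: "integrable (lebesgue_on Q) (\<lambda>z. A1 powr q)"
    by (rule integrable_lebesgue_on_bounded[OF _ Q_lmeasurable, where C = "A1 powr q"]) auto
  have h2: "integrable (lebesgue_on Q) (\<lambda>z. A2 powr q * indicator E z)"
    by (rule integrable_lebesgue_on_bounded[OF _ Q_lmeasurable, where C = "A2 powr q"])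
      (use EQ in \<open>auto simp: indicator_def\<close>)
  have bound: "\<bar>f z\<bar> powr q \<le> A1 powr q + A2 powr q * indicator E z" if "z \<in> Q" for z
  proof (cases "z \<in> E")
    case True
    have "\<bar>f z\<bar> powr q \<le> A2 powr q" using le(2)[OF True] A by (intro powr_mono2) auto
    then show ?thesis using True by (simp add: add_increasing)
  next
    case False
    have "\<bar>f z\<bar> powr q \<le> A1 powr q" using le(1)[OF that False] A by (intro powr_mono2) auto
    then show ?thesis using False by simp
  qed
  have AE: "AE z in lebesgue_on Q. z \<in> Q"
    using AE_space[of "lebesgue_on Q"] by (simp add: space_restrict_space)
  have fq: "(\<lambda>z. \<bar>f z\<bar> powr q) \<in> borel_measurable (lebesgue_on Q)"
    by (rule measurable_abs_powr[OF f])
  have int: "integrable (lebesgue_on Q) (\<lambda>z. \<bar>f z\<bar> powr q)"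
  proof (rule Bochner_Integration.integrable_bound[OF Bochner_Integration.integrable_add[OF h1 h2] fq])
    show "AE z in lebesgue_on Q. norm (\<bar>f z\<bar> powr q) \<le> norm (A1 powr q + A2 powr q * indicator E z)"
      using AE
    proof eventually_elim
      case (elim z)
      then show ?case using order_trans[OF bound[OF elim] abs_ge_self] by simp
    qed
  qed
  then show "f \<in> Lp q Q" using f by (simp add: Lp_def)
  have "(\<integral>z. \<bar>f z\<bar> powr q \<partial>lebesgue_on Q) \<le> (\<integral>z. A1 powr q + A2 powr q * indicator E z \<partial>lebesgue_on Q)"
  proof (rule integral_mono_AE[OF int Bochner_Integration.integrable_add[OF h1 h2]])
    show "AE z in lebesgue_on Q. \<bar>f z\<bar> powr q \<le> A1 powr q + A2 powr q * indicator E z"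
      using AE by eventually_elim (rule bound)
  qed
  also have "\<dots> = (\<integral>z. A1 powr q \<partial>lebesgue_on Q) + (\<integral>z. A2 powr q * indicator E z \<partial>lebesgue_on Q)"
    by (rule Bochner_Integration.integral_add[OF h1 h2])
  also have "(\<integral>z. A1 powr q \<partial>lebesgue_on Q) = 2 * A1 powr q"
    using emeasure_lebesgue_Q Q_open
    by (simp add: measure_def emeasure_restrict_space space_restrict_space)
  also have "(\<integral>z. A2 powr q * indicator E z \<partial>lebesgue_on Q) = A2 powr q * measure lebesgue E"
    using EQ E Q_open by (simp add: Int_absorb2 measure_restrict_space)
  finally show "Lp_norm q Q f \<le> (2 * A1 powr q + A2 powr q * measure lebesgue E) powr (1 / q)"
    unfolding Lp_norm_def using A(3) by (intro powr_mono2) (auto intro: integral_nonneg_AE)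
qed

section \<open>Property (i) and the solution of the divergence-form equation\<close>

lemma Linf_norm_le:
  assumes "f \<in> borel_measurable (lebesgue_on Q)" "\<And>z. \<bar>f z\<bar> \<le> C"
  shows "Linf_norm Q f \<le> ereal C"
  unfolding Linf_norm_def by (rule esssup_I) (use assms in \<open>auto intro!: AE_I2\<close>)

lemma bounded_Lp:
  assumes "f \<in> borel_measurable borel" "\<And>z. z \<in> Q \<Longrightarrow> \<bar>f z\<bar> \<le> C" "0 \<le> C" "0 < q"
  shows "f \<in> Lp q Q"
  by (rule Lp_step_bound(1)[OF borel_measurable_lebesgue_on[OF assms(1)], of "{}" C 0]) (use assms in auto)

lemma singular_Lp_2: "singular g \<Longrightarrow> g \<in> Lp 2 Q"
  unfolding Lp_def using singular_square_integrable borel_measurable_lebesgue_on[OF singularD(1)]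
  by (simp add: abs_powr_2)

lemma coefficient_property_i: "property_i Q D p a"
  unfolding property_i_def
proof (rule exI[of _ u], rule exI[of _ ux], rule exI[of _ ut], rule exI[of _ uxx], intro conjI)
  have u_L2: "u \<in> Lp 2 Q" "ux \<in> Lp 2 Q"
    by (rule bounded_Lp[OF borel_measurable_continuous_onI[OF u_continuous] u_bounded_Q(1)]
        bounded_Lp[OF borel_measurable_continuous_onI[OF ux_continuous] u_bounded_Q(2)];
        use l_pos[of 0] in simp)+
  show "u \<in> W122 Q" unfolding W122_def
    using u_L2 limit_weak_derivatives singular_Lp_2[OF singular_values(1)] singular_Lp_2[OF singular_values(2)]
    by blast
  show "has_weak_dx Q u ux" "has_weak_dt Q u ut" "has_weak_dx Q ux uxx" by (rule limit_weak_derivatives)+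
  show "AE z in lebesgue_on Q. ut z - a z * uxx z = 0" by (simp add: a_times_uxx)
  show "bounded (u ` Q)"
    by (rule boundedI[where B = "2 * l 0 + 1"], erule imageE, hypsubst, unfold real_norm_def, erule u_bounded_Q)
  show "bounded (ux ` Q)"
    by (rule boundedI[where B = "2 * l 0 + 1"], erule imageE, hypsubst, unfold real_norm_def, erule u_bounded_Q)
  show "continuous_on Q u" "continuous_on Q ux" by (rule u_continuous ux_continuous)+
  obtain C where C: "0 < C" "\<And>\<tau>. 0 < \<tau> \<Longrightarrow> measure lebesgue {z \<in> Q. \<tau> < uxx z} \<le> C * \<tau> powr - p"
    by (rule superlevel_upper[OF singular_values(2)]) blast
  obtain c where c: "0 < c" "\<And>\<tau>. 1 \<le> \<tau> \<Longrightarrow> c * \<tau> powr - p \<le> measure lebesgue {z \<in> D. \<tau> < uxx z}"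
    by (rule superlevel_lower[OF singular_values(2)]) blast
  have le: "measure lebesgue {z \<in> D. \<tau> < uxx z} \<le> measure lebesgue {z \<in> Q. \<tau> < uxx z}" for \<tau>
    using D_subset_Q superlevel_measurable(1)[OF singular_values(2) D_open]
      superlevel_measurable(2)[OF singular_values(2) Q_open order_refl]
    by (intro measure_mono_fmeasurable) auto
  have "c * \<tau> powr - p \<le> measure lebesgue {z \<in> D. \<tau> < uxx z} \<and>
      measure lebesgue {z \<in> D. \<tau> < uxx z} \<le> C * \<tau> powr - p" if "1 \<le> \<tau>" for \<tau>
    by (intro conjI c(2)[OF that] order_trans[OF le C(2)]) (use that in simp)
  then have "\<forall>\<^sub>F \<tau> in at_top. c * \<tau> powr - p \<le> measure lebesgue {z \<in> D. \<tau> < uxx z} \<and>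
      measure lebesgue {z \<in> D. \<tau> < uxx z} \<le> C * \<tau> powr - p"
    using eventually_ge_at_top[of 1] by (rule eventually_mono[rotated])
  then show "\<exists>c>0. \<exists>N>0. \<forall>\<^sub>F \<tau> in at_top. c * \<tau> powr - p \<le> measure lebesgue {z \<in> D. \<tau> < uxx z} \<and>
      measure lebesgue {z \<in> D. \<tau> < uxx z} \<le> N * \<tau> powr - p"
    using c(1) C(1) by blast
  show "ut \<in> weak_Lp p D - Lp p D" "uxx \<in> weak_Lp p D - Lp p D"
    using singular_weak_Lp[OF _ D_open D_subset_Q] singular_not_Lp singular_values by blast+
qed

lemma divergence_solution:
  "\<exists>v vx. bounded (v ` Q) \<and> continuous_on Q v \<and> weak_div_solution Q a (\<lambda>_. 0) v \<and>
     has_weak_dx Q v vx \<and> vx \<in> Lp 2 Q \<inter> weak_Lp p Q \<and> vx \<notin> Lp p D"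
proof (intro exI conjI)
  show "bounded (ux ` Q)"
    by (rule boundedI[where B = "2 * l 0 + 1"], erule imageE, hypsubst, unfold real_norm_def, erule u_bounded_Q)
  show "uxx \<in> Lp 2 Q \<inter> weak_Lp p Q"
    using singular_Lp_2[OF singular_values(2)] singular_weak_Lp[OF singular_values(2) Q_open order_refl] by blast
qed (rule ux_continuous ux_weak_div_solution limit_weak_derivatives singular_not_Lp[OF singular_values(2)])+

subsection \<open>Smooth compactly supported approximations\<close>

text \<open>The polynomial \<open>u0\<close> lacks compact support in Q. It is cut off outside D,
  where no correction acts; this is where room between D and the boundary of Q is used.\<close>

lemma base_exists:
  obtains g where "tame g" "supported_in g Q" "\<And>z. z \<in> D \<Longrightarrow> g z = u0 z"
proof -
  \<comment> \<open>The time margin is proportional to the distance from t1 to 0: the cutoff ends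
    before t1 / 2 < 0.\<close>
  obtain \<alpha> where \<alpha>: "smooth \<alpha>" "supported_in \<alpha> {t0 - 2 * (- t1 / 4)<..<t1 + 2 * (- t1 / 4)}"
    "\<And>t. t0 \<le> t \<Longrightarrow> t \<le> t1 \<Longrightarrow> \<alpha> t = 1"
    by (rule interval_cutoff_exists[of t0 t1 "- t1 / 4"]) (use box in auto)
  obtain \<beta> where \<beta>: "smooth \<beta>" "supported_in \<beta> {x0 - 2 * (1 / 8)<..<x1 + 2 * (1 / 8)}"
    "\<And>x. x0 \<le> x \<Longrightarrow> x \<le> x1 \<Longrightarrow> \<beta> x = 1"
    by (rule interval_cutoff_exists[of x0 x1 "1 / 8"]) (use box in auto)
  have \<alpha>': "supported_in \<alpha> {-1<..<0}" by (rule supported_in_mono[OF \<alpha>(2)]) (use box in auto)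
  have \<beta>': "supported_in \<beta> {-1<..<1}" by (rule supported_in_mono[OF \<beta>(2)]) (use box in auto)
  define g where "g z = ((l 0 * fst z) * \<alpha> (fst z)) * \<beta> (snd z)
      + \<alpha> (fst z) * ((l 0 / 2 * (snd z * snd z)) * \<beta> (snd z))" for z :: "real \<times> real"
  note pieces = smooth_mult[OF u0_tensors(1) \<alpha>(1)] smooth_mult[OF u0_tensors(2) \<beta>(1)]
  show ?thesis
  proof
    show "tame g" unfolding g_def[abs_def]
      by (rule tame.add[OF tame.tensor[OF pieces(1) \<beta>(1)] tame.tensor[OF \<alpha>(1) pieces(2)]])
    show "supported_in g Q" unfolding g_def[abs_def] Q_def
      by (rule supported_in_add[OF supported_in_tensor[OF supported_in_mult[OF \<alpha>'] \<beta>']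
            supported_in_tensor[OF \<alpha>' supported_in_mult[OF \<beta>']]])
    fix z assume "z \<in> D"
    then have "\<alpha> (fst z) = 1" "\<beta> (snd z) = 1" by (auto simp: D_def intro!: \<alpha>(3) \<beta>(3))
    then show "g z = u0 z" by (simp add: g_def u0_def)
  qed
qed

text \<open>The corrections are supported in D. Hence on D the approximation has the derivatives of
  \<open>U j\<close>, and off D its equation error is that of the fixed cut-off base function, with
  a bound independent of j.\<close>

lemma approximations_exist:
  obtains \<phi> K where "\<And>j. tame (\<phi> j)" "\<And>j. supported_in (\<phi> j) Q" "0 < K"
    "\<And>j z. \<bar>\<phi> j z\<bar> \<le> K" "\<And>j z. \<bar>Dx (\<phi> j) z\<bar> \<le> K"
    "\<And>j z. z \<in> D \<Longrightarrow> Dt (\<phi> j) z = Dt (U j) z"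
    "\<And>j z. z \<in> D \<Longrightarrow> Dx (Dx (\<phi> j)) z = Dx (Dx (U j)) z"
    "\<And>j z. z \<notin> D \<Longrightarrow> \<bar>Dt (\<phi> j) z - a z * Dx (Dx (\<phi> j)) z\<bar> \<le> K"
proof -
  obtain g where g: "tame g" "supported_in g Q" "\<And>z. z \<in> D \<Longrightarrow> g z = u0 z" by (rule base_exists) blast
  note sg = supported_in_partials[OF g(2)]
  obtain K0 where K0: "0 < K0" "\<And>z. \<bar>g z\<bar> \<le> K0"
    by (rule supported_continuous_bounded[OF tame_continuous_on[OF g(1)] g(2)]) blast
  obtain K1 where K1: "0 < K1" "\<And>z. \<bar>Dx g z\<bar> \<le> K1"
    by (rule supported_continuous_bounded[OF tame_continuous_on[OF tame_Dx[OF g(1)]] sg(2)]) blast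
  obtain K2 where K2: "0 < K2" "\<And>z. \<bar>Dt g z\<bar> \<le> K2"
    by (rule supported_continuous_bounded[OF tame_continuous_on[OF tame_Dt[OF g(1)]] sg(1)]) blast
  obtain K3 where K3: "0 < K3" "\<And>z. \<bar>Dx (Dx g) z\<bar> \<le> K3"
    by (rule supported_continuous_bounded[OF tame_continuous_on[OF tame_Dx[OF tame_Dx[OF g(1)]]]
          supported_in_partials(2)[OF sg(2)]]) blast
  \<comment> \<open>The last 1 bounds the sums of the corrections and of their x-derivatives; the
    term with \<open>inverse \<kappa>\<close> bounds a g_xx.\<close>
  define K where "K = K0 + K1 + K2 + inverse \<kappa> * K3 + 1"
  have ik: "0 < inverse \<kappa> * K3" using kappa K3(1) by simp
  define \<phi> where "\<phi> j = (\<lambda>z. g z + (\<Sum>k<j. W k z))" for j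
  note P = tame_sum_partials[where u = g and w = W, OF g(1) W_tame]
  have Dx\<phi>: "Dx (\<phi> j) = (\<lambda>z. Dx g z + (\<Sum>k<j. Dx (W k) z))"
    and Dt\<phi>: "Dt (\<phi> j) = (\<lambda>z. Dt g z + (\<Sum>k<j. Dt (W k) z))" for j
    unfolding \<phi>_def by (rule P)+
  have Dxx\<phi>: "Dx (Dx (\<phi> j)) = (\<lambda>z. Dx (Dx g) z + (\<Sum>k<j. Dx (Dx (W k)) z))" for j
    unfolding Dx\<phi>
    by (rule tame_sum_partials(2)[where u = "Dx g" and w = "\<lambda>k. Dx (W k)", OF tame_Dx[OF g(1)] tame_Dx[OF W_tame]])
  show ?thesis
  proof
    show "tame (\<phi> j)" for j unfolding \<phi>_def by (rule tame_sum[OF g(1) W_tame])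
    show "supported_in (\<phi> j) Q" for j unfolding \<phi>_def
    proof (induction j)
      case (Suc j)
      then show ?case
        using supported_in_add[OF Suc supported_in_mono[OF W_supported[of j] B_subset(2)]] by (simp add: add.assoc)
    qed (simp add: g(2))
    show "0 < K" unfolding K_def using K0 K1 K2 ik by linarith
    show "\<bar>\<phi> j z\<bar> \<le> K" for j z
      unfolding \<phi>_def K_def using K0(2)[of z] W_sums(1)[where n = j and z = z] K1(1) K2(1) ik by linarith
    show "\<bar>Dx (\<phi> j) z\<bar> \<le> K" for j z
      unfolding Dx\<phi> K_def using K1(2)[of z] W_sums(2)[where n = j and z = z] K0(1) K2(1) ik by linarith
    have eq: "\<phi> j z = U j z" if "z \<in> D" for j z using g(3)[OF that] by (simp add: \<phi>_def U_def)
    show "Dt (\<phi> j) z = Dt (U j) z" if "z \<in> D" for j z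
      by (rule partials_cong_open(1)[OF D_open eq that])
    have eq': "Dx (\<phi> j) z = Dx (U j) z" if "z \<in> D" for j z
      by (rule partials_cong_open(2)[OF D_open eq that])
    show "Dx (Dx (\<phi> j)) z = Dx (Dx (U j)) z" if "z \<in> D" for j z
      by (rule partials_cong_open(2)[OF D_open eq' that])
    show "\<bar>Dt (\<phi> j) z - a z * Dx (Dx (\<phi> j)) z\<bar> \<le> K" if "z \<notin> D" for j z
    proof -
      have "z \<notin> B k" for k using that B_subset(1)[of k] by blast
      then have zero: "Dt (W k) z = 0" "Dx (Dx (W k)) z = 0" for k by (rule W_zero)+
      have "\<bar>a z * Dx (Dx g) z\<bar> \<le> inverse \<kappa> * K3"
        using a_bounds[of z] kappa by (intro abs_mult_le K3(2)) auto
      then show ?thesis unfolding Dt\<phi> Dxx\<phi> zero K_def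
        using K2(2)[of z] K0(1) K1(1) by simp
    qed
  qed
qed

text \<open>The functions are v = \<phi>_x with right-hand side f = \<phi>_t - a \<phi>_xx, so that
  v_x = \<phi>_xx inherits the logarithmic growth. On D outside \<open>B j\<close> the error
  vanishes because the final values have already been reached there.\<close>

lemma approximation_properties:
  "property_ii Q D p a \<and>
   (\<exists>(v :: nat \<Rightarrow> real \<times> real \<Rightarrow> real) (f :: nat \<Rightarrow> real \<times> real \<Rightarrow> real). \<exists>c>0. \<exists>N>0.
     (\<forall>j\<ge>1. v j \<in> test_functions Q \<and> v j \<in> Lp p Q \<and> f j \<in> Lp p Q \<and>
        weak_div_solution Q a (f j) (v j) \<and>
        Lp_norm p Q (f j) + Lp_norm p Q (v j) \<le> N) \<and>
     (\<forall>\<^sub>F j in sequentially.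
        (\<integral>z. \<bar>Dx (v j) z\<bar> powr p \<partial>lebesgue_on D) \<ge> c * ln (real j)))"
proof -
  obtain \<phi> K where \<phi>: "\<And>j. tame (\<phi> j)" "\<And>j. supported_in (\<phi> j) Q" and K: "0 < K"
    "\<And>j z. \<bar>\<phi> j z\<bar> \<le> K" "\<And>j z. \<bar>Dx (\<phi> j) z\<bar> \<le> K"
    and onD: "\<And>j z. z \<in> D \<Longrightarrow> Dt (\<phi> j) z = Dt (U j) z"
    "\<And>j z. z \<in> D \<Longrightarrow> Dx (Dx (\<phi> j)) z = Dx (Dx (U j)) z"
    and offD: "\<And>j z. z \<notin> D \<Longrightarrow> \<bar>Dt (\<phi> j) z - a z * Dx (Dx (\<phi> j)) z\<bar> \<le> K"
    by (rule approximations_exist) blast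
  define f where "f j z = Dt (\<phi> j) z - a z * Dx (Dx (\<phi> j)) z" for j z
  define v where "v j = Dx (\<phi> j)" for j
  have p0: "0 < p" using p_gt by simp
  have v: "tame (v j)" "supported_in (v j) Q" for j
    unfolding v_def by (rule tame_Dx[OF \<phi>(1)] supported_in_partials(2)[OF \<phi>(2)])+
  have test: "\<phi> j \<in> test_functions Q" "v j \<in> test_functions Q" for j
    by (rule tame_test_function \<phi> v)+
  note Dx\<phi> = tame_Dx[OF \<phi>(1)] and Dxx\<phi> = tame_Dx[OF tame_Dx[OF \<phi>(1)]]
  obtain C where C: "0 < C" "\<And>k. measure lebesgue (B k) \<le> C * real (Suc k) powr - p"
    by (rule measure_B_bounds) blast
  have f_meas: "f j \<in> borel_measurable borel" for j
    unfolding f_def[abs_def]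
    by (intro borel_measurable_diff borel_measurable_times a_measurable tame_borel_measurable tame_Dt tame_Dx \<phi>)
  have f_off: "\<bar>f j z\<bar> \<le> K" if "z \<notin> B j" for j z
  proof (cases "z \<in> D")
    case True
    then have "f j z = ut z - a z * uxx z" by (simp add: f_def onD limit_off_B[OF that])
    then show ?thesis using K(1) by (simp add: a_times_uxx)
  next
    case False
    then show ?thesis unfolding f_def by (rule offD)
  qed
  define A where "A j = (1 + inverse \<kappa>) * l j" for j
  have A0: "0 \<le> A j" for j using kappa l_pos[of j] by (simp add: A_def)
  have f_on: "\<bar>f j z\<bar> \<le> A j" if "z \<in> B j" for j z
  proof -
    have "z \<in> D" using that B_subset(1)[of j] by blast
    \<comment> \<open>Both second-order values are \<open>l j\<close> here, so only the mismatch 1 -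
      a of the coefficient remains.\<close>
    then have "f j z = (1 - a z) * l j" by (simp add: f_def onD U_on_B[OF that] left_diff_distrib)
    also have "\<bar>\<dots>\<bar> \<le> A j" unfolding A_def
      using a_bounds[of z] kappa l_pos[of j] by (intro abs_mult_le) auto
    finally show ?thesis .
  qed
  \<comment> \<open>From \<open>l j\<close> \<le> (1 + p) (j + 1): the power p of the error bound
    grows exactly as fast as the measure of \<open>B j\<close> decays.\<close>
  define M where "M = ((1 + inverse \<kappa>) * (1 + p)) powr p * C"
  have M0: "0 \<le> M" using C by (simp add: M_def)
  have AM: "A j powr p * measure lebesgue (B j) \<le> M" for j
  proof -
    have "0 \<le> p * real j" using p0 by simp
    then have "l j \<le> (1 + p) * real (Suc j)" by (simp add: l_def algebra_simps)
    then have "A j \<le> (1 + inverse \<kappa>) * ((1 + p) * real (Suc j))"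
      unfolding A_def using kappa by (intro mult_left_mono) auto
    then have "A j powr p \<le> ((1 + inverse \<kappa>) * (1 + p) * real (Suc j)) powr p"
      using A0[of j] p0 by (intro powr_mono2) (auto simp: mult.assoc)
    also have "\<dots> = ((1 + inverse \<kappa>) * (1 + p)) powr p * real (Suc j) powr p"
      by (rule powr_mult)
    finally have "A j powr p * measure lebesgue (B j)
        \<le> (((1 + inverse \<kappa>) * (1 + p)) powr p * real (Suc j) powr p) * (C * real (Suc j) powr - p)"
      using C(2)[of j] by (intro mult_mono) auto
    also have "\<dots> = M * (real (Suc j) powr p * real (Suc j) powr - p)" by (simp add: M_def mult_ac)
    also have "real (Suc j) powr p * real (Suc j) powr - p = 1"
      unfolding powr_add[symmetric] by simp
    finally show ?thesis by simp
  qed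
  define R where "R = (2 * K powr p + M) powr (1 / p)"
  have f_Lp: "f j \<in> Lp p Q" and f_norm: "Lp_norm p Q (f j) \<le> R" for j
  proof -
    note * = Lp_step_bound[OF borel_measurable_lebesgue_on[OF f_meas[of j]] B_borel[of j] B_subset(2) less_imp_le[OF K(1)]
        A0[of j] p0 f_off f_on]
    show "f j \<in> Lp p Q" by (rule *(1))
    have "Lp_norm p Q (f j) \<le> (2 * K powr p + A j powr p * measure lebesgue (B j)) powr (1 / p)"
      by (rule *(2))
    also have "\<dots> \<le> R" unfolding R_def using AM[of j] p0 by (intro powr_mono2) auto
    finally show "Lp_norm p Q (f j) \<le> R" .
  qed
  have v_Lp: "v j \<in> Lp p Q" and v_norm: "Lp_norm p Q (v j) \<le> R" for j
  proof -
    have vK: "\<bar>v j z\<bar> \<le> K" for z unfolding v_def by (rule K(3))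
    note * = Lp_step_bound[of "v j" "{}" K 0 p, OF borel_measurable_lebesgue_on[OF tame_borel_measurable[OF v(1)]]
        _ _ less_imp_le[OF K(1)] order_refl p0 vK]
    show "v j \<in> Lp p Q" by (rule *(1)) auto
    have "Lp_norm p Q (v j) \<le> (2 * K powr p + 0 powr p * measure lebesgue ({} :: (real \<times> real) set)) powr (1 / p)"
      by (rule *(2)) auto
    also have "\<dots> \<le> R" unfolding R_def using M0 p0 by (intro powr_mono2) auto
    finally show "Lp_norm p Q (v j) \<le> R" .
  qed
  obtain c where c: "0 < c"
    "\<And>f j. \<lbrakk>integrable (lebesgue_on D) (\<lambda>z. \<bar>f z\<bar> powr p);
        \<And>z k. z \<notin> N \<Longrightarrow> k \<le> j \<Longrightarrow> z \<in> B k \<Longrightarrow> \<kappa> * l k \<le> f z; 1 \<le> j\<rbrakk>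
      \<Longrightarrow> c * ln (real j) \<le> (\<integral>z. \<bar>f z\<bar> powr p \<partial>lebesgue_on D)"
    by (rule log_lower_bound) blast
  have log: "c * ln (real j) \<le> (\<integral>z. \<bar>Dx (Dx (\<phi> j)) z\<bar> powr p \<partial>lebesgue_on D)" if j: "1 \<le> j" for j
  proof (rule c(2)[OF _ _ j])
    obtain H where H: "\<And>z. \<bar>Dx (Dx (\<phi> j)) z\<bar> \<le> H"
      by (rule supported_continuous_bounded[OF tame_continuous_on[OF Dxx\<phi>]
            supported_in_partials(2)[OF supported_in_partials(2)[OF \<phi>(2)]]]) blast
    show "integrable (lebesgue_on D) (\<lambda>z. \<bar>Dx (Dx (\<phi> j)) z\<bar> powr p)"
    proof (rule integrable_lebesgue_on_bounded[OF _ D_lmeasurable, where C = "H powr p"])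
      show "(\<lambda>z. \<bar>Dx (Dx (\<phi> j)) z\<bar> powr p) \<in> borel_measurable (lebesgue_on D)"
        by (intro measurable_abs_powr borel_measurable_lebesgue_on tame_borel_measurable Dxx\<phi>)
      show "\<bar>\<bar>Dx (Dx (\<phi> j)) z\<bar> powr p\<bar> \<le> H powr p" for z
        using powr_mono2[OF less_imp_le[OF p0] abs_ge_zero H, of z] by simp
    qed
    show "\<kappa> * l k \<le> Dx (Dx (\<phi> j)) z" if z: "z \<notin> N" "k \<le> j" "z \<in> B k" for z k
    proof -
      have eq: "Dx (Dx (\<phi> j)) z = Dx (Dx (U j)) z" by (rule onD(2)) (use z(3) B_subset(1)[of k] in blast)
      show ?thesis
      proof (cases "z \<in> B j")
        case True
        \<comment> \<open>A point still in \<open>B j\<close> has not reached its final value; it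
          has the value \<open>l j\<close>, which exceeds \<kappa> \<open>l k\<close> for every k
          \<le> j.\<close>
        have "\<kappa> * l k \<le> 1 * l j" using kappa l_mono[OF z(2)] l_pos[of k] by (intro mult_mono) auto
        then show ?thesis unfolding eq using U_on_B[OF True] by simp
      next
        case False
        then show ?thesis unfolding eq using values_lower(2)[OF z(1,3)] limit_off_B(2)[OF False] by simp
      qed
    qed
  qed
  have solution: "weak_div_solution Q a (f j) (v j)" for j
  proof -
    have f_int: "integrable (lebesgue_on Q) (f j)"
    proof (rule integrable_lebesgue_on_bounded[OF borel_measurable_lebesgue_on[OF f_meas] Q_lmeasurable])
      show "\<bar>f j z\<bar> \<le> max K (A j)" for z using f_off[of z j] f_on[of z j] by (cases "z \<in> B j") auto
    qed
    have vxt: "integrable (lebesgue_on Q) (Dt (\<phi> j))" by (rule tame_integrable_Q[OF tame_Dt[OF \<phi>(1)]])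
    \<comment> \<open>Substituting this flux cancels f on both sides and leaves the cross-derivative
      identity for \<phi>.\<close>
    have avx_eq: "a z * Dx (v j) z = Dt (\<phi> j) z - f j z" for z by (simp add: f_def v_def)
    have avx: "integrable (lebesgue_on Q) (\<lambda>z. a z * Dx (v j) z)"
      unfolding avx_eq by (rule Bochner_Integration.integrable_diff[OF vxt f_int])
    have weak: "has_weak_dx Q (v j) (Dx (v j))" unfolding has_weak_dx_def
      by (intro conjI ballI loc_integrable_Q tame_integrable_Q tame_Dx v integration_by_parts(2)[OF v(1) _ Q_open])
    have "(\<integral>z. (v j z * Dt \<psi> z - a z * Dx (v j) z * Dx \<psi> z) \<partial>lebesgue_on Q) = (\<integral>z. f j z * Dx \<psi> z \<partial>lebesgue_on Q)"
      if \<psi>: "\<psi> \<in> test_functions Q" for \<psi>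
    proof -
      note m = test_function_measurable[OF \<psi>, of Q]
      obtain E where E: "\<And>z. \<bar>\<psi> z\<bar> \<le> E" "\<And>z. \<bar>Dt \<psi> z\<bar> \<le> E" "\<And>z. \<bar>Dx \<psi> z\<bar> \<le> E"
        by (rule test_function_bounded[OF \<psi>]) blast
      note i1 = integrable_mult_bounded[OF tame_integrable_Q[OF v(1)[of j]] m(2) E(2)]
      note i2 = integrable_mult_bounded[OF vxt m(3) E(3)]
      note i3 = integrable_mult_bounded[OF f_int m(3) E(3)]
      have "(\<integral>z. (v j z * Dt \<psi> z - a z * Dx (v j) z * Dx \<psi> z) \<partial>lebesgue_on Q)
          = (\<integral>z. v j z * Dt \<psi> z - (Dt (\<phi> j) z * Dx \<psi> z - f j z * Dx \<psi> z) \<partial>lebesgue_on Q)"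
        unfolding avx_eq by (simp add: left_diff_distrib)
      also have "\<dots> = (\<integral>z. v j z * Dt \<psi> z \<partial>lebesgue_on Q)
          - ((\<integral>z. Dt (\<phi> j) z * Dx \<psi> z \<partial>lebesgue_on Q) - (\<integral>z. f j z * Dx \<psi> z \<partial>lebesgue_on Q))"
        using i1 i2 i3 by simp
      also have "(\<integral>z. v j z * Dt \<psi> z \<partial>lebesgue_on Q) = (\<integral>z. Dt (\<phi> j) z * Dx \<psi> z \<partial>lebesgue_on Q)"
        unfolding v_def by (rule tame_cross_derivatives[OF \<phi>(1) \<psi>])
      finally show ?thesis by simp
    qed
    then show ?thesis unfolding weak_div_solution_def
      using loc_integrable_Q[OF f_int] loc_integrable_Q[OF avx] weak by blast
  qed
  have R0: "0 \<le> R" by (simp add: R_def)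
  have Linf: "Linf_norm Q (\<phi> j) + Linf_norm Q (Dx (\<phi> j)) + ereal (Lp_norm p Q (f j)) \<le> ereal (2 * K + R + 1)" for j
  proof -
    have "Linf_norm Q (\<phi> j) \<le> ereal K" "Linf_norm Q (Dx (\<phi> j)) \<le> ereal K"
      by (rule Linf_norm_le[OF borel_measurable_lebesgue_on[OF tame_borel_measurable]]; rule \<phi> Dx\<phi> K)+
    moreover have "ereal (Lp_norm p Q (f j)) \<le> ereal R" using f_norm by simp
    ultimately have "Linf_norm Q (\<phi> j) + Linf_norm Q (Dx (\<phi> j)) + ereal (Lp_norm p Q (f j)) \<le> ereal K + ereal K + ereal R"
      by (intro add_mono)
    also have "\<dots> \<le> ereal (2 * K + R + 1)" by simp
    finally show ?thesis .
  qed
  have pii: "property_ii Q D p a" unfolding property_ii_def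
  proof (intro exI conjI allI impI)
    fix j :: nat assume "1 \<le> j"
    show "\<phi> j \<in> test_functions Q" by (rule test)
    show "(\<lambda>z. Dt (\<phi> j) z - a z * Dx (Dx (\<phi> j)) z) \<in> Lp p Q" using f_Lp[of j] unfolding f_def[abs_def] .
    show "Linf_norm Q (\<phi> j) + Linf_norm Q (Dx (\<phi> j))
      + ereal (Lp_norm p Q (\<lambda>z. Dt (\<phi> j) z - a z * Dx (Dx (\<phi> j)) z)) \<le> ereal (2 * K + R + 1)"
      using Linf[of j] unfolding f_def[abs_def] .
    show "c * ln (real j) \<le> (\<integral>z. \<bar>Dx (Dx (\<phi> j)) z\<bar> powr p \<partial>lebesgue_on D)" by (rule log) fact
  qed (use c(1) K(1) R0 in auto)
  have ev: "\<forall>\<^sub>F j in sequentially. c * ln (real j) \<le> (\<integral>z. \<bar>Dx (v j) z\<bar> powr p \<partial>lebesgue_on D)"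
    using eventually_ge_at_top[of 1] unfolding v_def by eventually_elim (rule log)
  have norms: "Lp_norm p Q (f j) + Lp_norm p Q (v j) \<le> 2 * R + 1" for j
    using f_norm[of j] v_norm[of j] by linarith
  have R1: "0 < 2 * R + 1" using R0 by simp
  show ?thesis
  proof (rule conjI[OF pii], rule exI[of _ v], rule exI[of _ f], rule exI[of _ c], rule conjI[OF c(1)],
      rule exI[of _ "2 * R + 1"], rule conjI[OF R1], rule conjI[OF _ ev])
    show "\<forall>j\<ge>1. v j \<in> test_functions Q \<and> v j \<in> Lp p Q \<and> f j \<in> Lp p Q \<and>
        weak_div_solution Q a (f j) (v j) \<and> Lp_norm p Q (f j) + Lp_norm p Q (v j) \<le> 2 * R + 1"
      by (intro allI impI conjI test(2) v_Lp f_Lp solution norms)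
  qed
qed

end

theorem corollary2p3:
  fixes Q D :: "(real \<times> real) set" and \<kappa> p t0 t1 x0 x1 :: real
  assumes Q: "Q = {-1<..<0} \<times> {-1<..<1}"
    and D: "D = {t0<..<t1} \<times> {x0<..<x1}" "D \<noteq> {}"
    and D_inside: "compact (closure D)" "closure D \<subseteq> {-1/4<..<0} \<times> {-1/2<..<1/2}"
    and \<kappa>: "0 < \<kappa>" "\<kappa> < 1"
    and p: "p = 2 / (1 - \<kappa>)"
  shows "\<exists>a :: real \<times> real \<Rightarrow> real.
    a \<in> borel_measurable (restrict_space borel Q) \<and> (\<forall>z\<in>Q. \<kappa> \<le> a z \<and> a z \<le> inverse \<kappa>) \<and>
    property_i Q D p a \<and> property_ii Q D p a \<and>
    (\<exists>v vx.
       bounded (v ` Q) \<and> continuous_on Q v \<and> weak_div_solution Q a (\<lambda>_. 0) v \<and>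
       has_weak_dx Q v vx \<and> vx \<in> Lp 2 Q \<inter> weak_Lp p Q \<and> vx \<notin> Lp p D) \<and>
    (\<exists>(v :: nat \<Rightarrow> real \<times> real \<Rightarrow> real) (f :: nat \<Rightarrow> real \<times> real \<Rightarrow> real). \<exists>c>0. \<exists>N>0.
       (\<forall>j\<ge>1. v j \<in> test_functions Q \<and> v j \<in> Lp p Q \<and> f j \<in> Lp p Q \<and>
          weak_div_solution Q a (f j) (v j) \<and>
          Lp_norm p Q (f j) + Lp_norm p Q (v j) \<le> N) \<and>
       (\<forall>\<^sub>F j in sequentially.
          (\<integral>z. \<bar>Dx (v j) z\<bar> powr p \<partial>lebesgue_on D) \<ge> c * ln (real j)))"
proof -
  have ne: "t0 < t1" "x0 < x1" using D by auto
  have "closure D = {t0..t1} \<times> {x0..x1}" using ne by (simp add: D(1) closure_Times)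
  \<comment> \<open>Two opposite corners of the closed rectangle give all four strict inequalities
    required by the locale.\<close>
  then have "(t0, x0) \<in> closure D" "(t1, x1) \<in> closure D" using ne by auto
  then have "(t0, x0) \<in> {-1/4<..<0} \<times> {-1/2<..<1/2}" "(t1, x1) \<in> {-1/4<..<0} \<times> {-1/2<..<1/2}"
    using D_inside(2) by blast+
  then have inside: "- 1 / 4 < t0" "t1 < 0" "- 1 / 2 < x0" "x1 < 1 / 2" by auto
  obtain S W where SW: "S 0 = ({t0<..<t1}, {x0<..<x1})"
    "\<And>k. stair_step \<kappa> (real (Suc k) + p) (real (Suc k) / (real (Suc k) + p / 2)) ((1 / 2) ^ (k + 2))
       (S k) (W k) (S (Suc k))"
    by (rule staircase_exists[OF \<kappa> p interval_union.interval[OF ne(1)] interval_union.interval[OF ne(2)]]) blast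
  interpret s: staircase \<kappa> p t0 t1 x0 x1 S W
    by unfold_locales (rule \<kappa> p ne inside SW)+
  have QD: "Q = s.Q" "D = s.D" unfolding Q D(1) s.Q_def s.D_def by simp_all
  show ?thesis unfolding QD
    by (intro exI[of _ s.a] conjI ballI s.coefficient_property_i s.divergence_solution s.approximation_properties[THEN conjunct1]
        s.approximation_properties[THEN conjunct2] s.a_bounds measurable_restrict_space1 s.a_measurable)
qed

end
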